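(* Let $G\in\mathcal{G}_2$ be a Lie group with Lie algebra $\mathfrak{g}$, equipped with a left invariant Randers metric $F(x,y)=\sqrt{g(y,y)}+g(X(x),y)$ of Douglas type defined by a left invariant Riemannian metric $g$ and a left invariant vector field $X$. Let $\mathsf{e}$, $\Gamma$, $\phi$ and $f$ be the data associated with $(G,g)$ as in the context. Then for every flag $(P,y)$ in $\mathfrak{g}$, writing $y=\eta\mathsf{e}+v$ with $\eta\in\mathbb{R}$ and $v\in\Gamma$, the flag curvature of $F$ is $$K^F(P,y)=\frac{g(y,y)}{F^2}K^g(P)+\frac{1}{4F^4}\Big\{3\big(\eta^2\phi(X)+\eta\, g(f(X),v)\big)^2+2F\big(2\eta^2\phi(v)\phi(X)+\eta\,\phi(v)\,g(f(X),v)+\eta^2 g(f(X),f(v))-\eta^3\phi(f(X))\big)\Big\},$$ where $F=F(y)$ and $K^g$ is the sectional curvature of $g$. In particular, $$K^F(P,y)=\frac{g(y,y)}{F^2}K^g(P)+\frac{1}{4F^4}\left(3\eta^4\phi(X)^2-2F\eta^3\phi(f(X))\right)\quad\text{if } y\in\mathrm{span}\{\mathsf{e}\},$$ $$K^F(P,y)=\frac{g(y,y)}{F^2}K^g(P)\quad\text{if } y\in\Gamma.$$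
   Context: $\mathcal{G}_2$ is the family of Lie groups whose commutator group $G'$ is one-dimensional. Let $\mathfrak{g}'=[\mathfrak{g},\mathfrak{g}]$ be the Lie algebra of $G'$, $\mathsf{e}\in\mathfrak{g}'$ a unit vector with respect to $g$, and $\Gamma\subset\mathfrak{g}$ the hyperplane orthogonal to $\mathsf{e}$ with respect to $g$. The linear map $\phi:\Gamma\to\mathbb{R}$ is defined by $[z,\mathsf{e}]=\phi(z)\mathsf{e}$ for $z\in\Gamma$. The skew-adjoint linear map $f:\Gamma\to\Gamma$ is defined by $[z,y]=g(f(z),y)\,\mathsf{e}$ for $z,y\in\Gamma$. A left invariant Randers metric $F(x,y)=\sqrt{g(y,y)}+g(X(x),y)$ on $G\in\mathcal{G}_2$, defined by a left invariant Riemannian metric $g$ and a left invariant vector field $X$, is of Douglas type if and only if $X\in\Gamma$, so $\phi(X)$ and $f(X)$ make sense. The Randers metric is a Finsler metric (smooth off the zero section, positively homogeneous of degree one in $y$, with $(g_{ij})=\left(\frac12\frac{\partial^2F^2}{\partial y^i\partial y^j}\right)$ positive definite) if and only if $\sqrt{g(X,X)}<1$; this is assumed. A Finsler metric is of Douglas type if in standard local coordinates its spray coefficients $G^i=\frac14 g^{il}\left([F^2]_{x^my^l}y^m-[F^2]_{x^l}\right)$ have the form $G^i=\frac12\Gamma^i_{jk}(x)y^jy^k+P(x,y)y^i$ with $P$ positively homogeneous of degree one in $y$. A flag $(P,y)$ consists of a 2-dimensional subspace $P$ and a nonzero vector $y\in P$. The flag curvature is $$K^F(P,y)=\frac{g_y(R_y(u),u)}{g_y(y,y)g_y(u,u)-g_y(y,u)^2},$$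 where $P=\mathrm{span}\{u,y\}$, $g_y(u,v)=\frac12\frac{\partial^2}{\partial s\,\partial t}F^2(y+su+tv)\big|_{s=t=0}$, $R_y(u)=R(u,y)y=\nabla_u\nabla_yy-\nabla_y\nabla_uy-\nabla_{[u,y]}y$ and $\nabla$ is the Chern connection of $F$. *)

theory Defs
  imports "HOL-Analysis.Analysis"
begin

section \<open>Smooth maps between Euclidean spaces\<close>

primrec Ck_on :: "nat \<Rightarrow> ('a::real_normed_vector \<Rightarrow> 'b::real_normed_vector) \<Rightarrow> 'a set \<Rightarrow> bool" where
  "Ck_on 0 f S \<longleftrightarrow> continuous_on S f"
| "Ck_on (Suc k) f S \<longleftrightarrow> (\<forall>x\<in>S. f differentiable (at x)) \<and>
     (\<forall>v. Ck_on k (\<lambda>x. frechet_derivative f (at x) v) S)"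

text \<open>Only used on open sets of finite-dimensional spaces.\<close>
definition smooth_on :: "('a::real_normed_vector \<Rightarrow> 'b::real_normed_vector) \<Rightarrow> 'a set \<Rightarrow> bool" where
  "smooth_on f S \<longleftrightarrow> (\<forall>k. Ck_on k f S)"


section \<open>Smooth manifolds, tangent vectors, Lie groups\<close>

text \<open>A smooth atlas on the space \<open>'a\<close>, modelled on \<open>'e\<close>, presented by a preferred chart around
  each point.  A tangent vector at \<open>p\<close> is represented by its component vector (an element
  of \<open>'e\<close>) in the preferred chart at \<open>p\<close>; so every tangent space is a copy of \<open>'e\<close>, and a field of
  tangent vectors is a function \<open>'a \<Rightarrow> 'e\<close>.\<close>
record ('a, 'e) atlas =
  chart_dom :: "'a \<Rightarrow> 'a set"
  chart :: "'a \<Rightarrow> 'a \<Rightarrow> 'e"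

record ('a, 'e) lie_group_data = "('a, 'e) atlas" +
  gmul :: "'a \<Rightarrow> 'a \<Rightarrow> 'a"
  gone :: 'a
  ginv :: "'a \<Rightarrow> 'a"

definition chart_inv :: "('a, 'e, 'm) atlas_scheme \<Rightarrow> 'a \<Rightarrow> 'e \<Rightarrow> 'a" where
  "chart_inv M p = inv_into (chart_dom M p) (chart M p)"

definition chart_image :: "('a, 'e, 'm) atlas_scheme \<Rightarrow> 'a \<Rightarrow> 'e set" where
  "chart_image M p = chart M p ` chart_dom M p"

definition smooth_manifold ::
    "('a::{t2_space,second_countable_topology}, 'e::euclidean_space, 'm) atlas_scheme \<Rightarrow> bool" where
  "smooth_manifold M \<longleftrightarrow>
     (\<forall>p. p \<in> chart_dom M p \<and> open (chart_dom M p) \<and> open (chart_image M p) \<and>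
          homeomorphism (chart_dom M p) (chart_image M p) (chart M p) (chart_inv M p)) \<and>
     (\<forall>p q. smooth_on (chart M q \<circ> chart_inv M p) (chart M p ` (chart_dom M p \<inter> chart_dom M q)))"

definition lie_group ::
    "('a::{t2_space,second_countable_topology}, 'e::euclidean_space, 'm) lie_group_data_scheme \<Rightarrow> bool"
  where
  "lie_group G \<longleftrightarrow> smooth_manifold G \<and> group (gmul G) (gone G) (ginv G) \<and>
     continuous_on UNIV (\<lambda>(a, b). gmul G a b) \<and>
     (\<forall>p q r. smooth_on (\<lambda>(x, y). chart G r (gmul G (chart_inv G p x) (chart_inv G q y)))
        {(chart G p a, chart G q b) | a b.
           a \<in> chart_dom G p \<and> b \<in> chart_dom G q \<and> gmul G a b \<in> chart_dom G r}) \<and>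
     continuous_on UNIV (ginv G) \<and>
     (\<forall>p r. smooth_on (\<lambda>x. chart G r (ginv G (chart_inv G p x)))
        {chart G p a | a. a \<in> chart_dom G p \<and> ginv G a \<in> chart_dom G r})"

text \<open>The differential at \<open>p\<close> of a map \<open>h\<close>, from the tangent space at \<open>p\<close> to that at \<open>h p\<close>.\<close>
definition tangent_map ::
    "('a, 'e::real_normed_vector, 'm) atlas_scheme \<Rightarrow> ('a \<Rightarrow> 'a) \<Rightarrow> 'a \<Rightarrow> 'e \<Rightarrow> 'e" where
  "tangent_map M h p = frechet_derivative (chart M (h p) \<circ> h \<circ> chart_inv M p) (at (chart M p p))"

text \<open>Change of components of tangent vectors from the chart at \<open>p\<close> to the chart at \<open>q\<close>; the base
  point has coordinates \<open>x\<close> in the chart at \<open>p\<close>.\<close>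
definition transition ::
    "('a, 'e::real_normed_vector, 'm) atlas_scheme \<Rightarrow> 'a \<Rightarrow> 'a \<Rightarrow> 'e \<Rightarrow> 'e \<Rightarrow> 'e" where
  "transition M p q x = frechet_derivative (chart M q \<circ> chart_inv M p) (at x)"


section \<open>Vector fields and the Lie algebra\<close>

text \<open>Coordinate expression of a vector field in the chart at \<open>p\<close>.\<close>
definition local_field ::
    "('a, 'e::real_normed_vector, 'm) atlas_scheme \<Rightarrow> ('a \<Rightarrow> 'e) \<Rightarrow> 'a \<Rightarrow> 'e \<Rightarrow> 'e" where
  "local_field M X p x = (let q = chart_inv M p x in transition M q p (chart M q q) (X q))"

definition smooth_field :: "('a, 'e::real_normed_vector, 'm) atlas_scheme \<Rightarrow> ('a \<Rightarrow> 'e) \<Rightarrow> bool" where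
  "smooth_field M X \<longleftrightarrow> (\<forall>p. smooth_on (local_field M X p) (chart_image M p))"

definition field_bracket ::
    "('a, 'e::real_normed_vector, 'm) atlas_scheme \<Rightarrow> ('a \<Rightarrow> 'e) \<Rightarrow> ('a \<Rightarrow> 'e) \<Rightarrow> 'a \<Rightarrow> 'e" where
  "field_bracket M X Y p =
     frechet_derivative (local_field M Y p) (at (chart M p p)) (X p) -
     frechet_derivative (local_field M X p) (at (chart M p p)) (Y p)"

definition left_invariant_field ::
    "('a, 'e::real_normed_vector, 'm) lie_group_data_scheme \<Rightarrow> ('a \<Rightarrow> 'e) \<Rightarrow> bool" where
  "left_invariant_field G X \<longleftrightarrow> (\<forall>a p. X (gmul G a p) = tangent_map G (gmul G a) p (X p))"

definition left_field ::
    "('a, 'e::real_normed_vector, 'm) lie_group_data_scheme \<Rightarrow> 'e \<Rightarrow> 'a \<Rightarrow> 'e" where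
  "left_field G v p = tangent_map G (gmul G p) (gone G) v"

text \<open>The Lie algebra is the tangent space at the identity, with the bracket of the left invariant
  extensions.\<close>
definition bracket ::
    "('a, 'e::real_normed_vector, 'm) lie_group_data_scheme \<Rightarrow> 'e \<Rightarrow> 'e \<Rightarrow> 'e" where
  "bracket G u v = field_bracket G (left_field G u) (left_field G v) (gone G)"

definition derived_algebra ::
    "('a, 'e::real_normed_vector, 'm) lie_group_data_scheme \<Rightarrow> 'e set" where
  "derived_algebra G = span {bracket G u v | u v. True}"

text \<open>The family \<open>\<G>\<^sub>2\<close>.  The dimension of the commutator group is that of its Lie algebra, which
  is the derived algebra.\<close>
definition in_G2 ::
    "('a::{t2_space,second_countable_topology}, 'e::euclidean_space, 'm) lie_group_data_scheme \<Rightarrow> bool"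
  where
  "in_G2 G \<longleftrightarrow> lie_group G \<and> dim (derived_algebra G) = 1"


section \<open>Riemannian metrics and sectional curvature\<close>

definition local_metric ::
    "('a, 'e::real_normed_vector, 'm) atlas_scheme \<Rightarrow> ('a \<Rightarrow> 'e \<Rightarrow> 'e \<Rightarrow> real)
      \<Rightarrow> 'a \<Rightarrow> 'e \<Rightarrow> 'e \<Rightarrow> 'e \<Rightarrow> real" where
  "local_metric M g p x u v =
     (let q = chart_inv M p x in g q (transition M p q x u) (transition M p q x v))"

definition riemannian_metric ::
    "('a, 'e::euclidean_space, 'm) atlas_scheme \<Rightarrow> ('a \<Rightarrow> 'e \<Rightarrow> 'e \<Rightarrow> real) \<Rightarrow> bool" where
  "riemannian_metric M g \<longleftrightarrow>
     (\<forall>p. bilinear (g p) \<and> (\<forall>u v. g p u v = g p v u) \<and> (\<forall>u. u \<noteq> 0 \<longrightarrow> g p u u > 0)) \<and>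
     (\<forall>p u v. smooth_on (\<lambda>x. local_metric M g p x u v) (chart_image M p))"

definition left_invariant_metric ::
    "('a, 'e::real_normed_vector, 'm) lie_group_data_scheme \<Rightarrow> ('a \<Rightarrow> 'e \<Rightarrow> 'e \<Rightarrow> real) \<Rightarrow> bool" where
  "left_invariant_metric G g \<longleftrightarrow>
     (\<forall>a p u v. g (gmul G a p) (tangent_map G (gmul G a) p u) (tangent_map G (gmul G a) p v) = g p u v)"

text \<open>In the following, \<open>h x u v\<close> is a Riemannian metric on an open set of \<open>'e\<close>.  Indices are
  raised by solving \<open>h x \<xi> w = (\<dots>)(w)\<close> for \<open>\<xi>\<close>, which is multiplication with the inverse
  matrix of \<open>h x\<close>.  The curvature is evaluated on constant vector fields, whose brackets vanish.\<close>

definition christoffel ::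
    "('e::real_normed_vector \<Rightarrow> 'e \<Rightarrow> 'e \<Rightarrow> real) \<Rightarrow> 'e \<Rightarrow> 'e \<Rightarrow> 'e \<Rightarrow> 'e" where
  "christoffel h x u v = (THE \<xi>. \<forall>w. h x \<xi> w =
     (frechet_derivative (\<lambda>x. h x v w) (at x) u + frechet_derivative (\<lambda>x. h x u w) (at x) v
      - frechet_derivative (\<lambda>x. h x u v) (at x) w) / 2)"

definition levi_civita ::
    "('e::real_normed_vector \<Rightarrow> 'e \<Rightarrow> 'e \<Rightarrow> real) \<Rightarrow> 'e \<Rightarrow> ('e \<Rightarrow> 'e) \<Rightarrow> 'e \<Rightarrow> 'e" where
  "levi_civita h u Z x = frechet_derivative Z (at x) u + christoffel h x u (Z x)"

definition riemann_curvature ::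
    "('e::real_normed_vector \<Rightarrow> 'e \<Rightarrow> 'e \<Rightarrow> real) \<Rightarrow> 'e \<Rightarrow> 'e \<Rightarrow> 'e \<Rightarrow> 'e \<Rightarrow> 'e" where
  "riemann_curvature h x u v w =
     levi_civita h u (levi_civita h v (\<lambda>_. w)) x - levi_civita h v (levi_civita h u (\<lambda>_. w)) x"

definition sectional_curvature ::
    "('a, 'e::real_normed_vector, 'm) atlas_scheme \<Rightarrow> ('a \<Rightarrow> 'e \<Rightarrow> 'e \<Rightarrow> real) \<Rightarrow> 'a \<Rightarrow> 'e set \<Rightarrow> real" where
  "sectional_curvature M g p P = (THE k. \<forall>u v. P = span {u, v} \<longrightarrow>
     (let h = local_metric M g p; x = chart M p p in
        k = h x (riemann_curvature h x u v v) u / (h x v v * h x u u - (h x v u)\<^sup>2)))"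


section \<open>Finsler metrics, Chern connection and flag curvature\<close>

definition local_finsler ::
    "('a, 'e::real_normed_vector, 'm) atlas_scheme \<Rightarrow> ('a \<Rightarrow> 'e \<Rightarrow> real) \<Rightarrow> 'a \<Rightarrow> 'e \<Rightarrow> 'e \<Rightarrow> real" where
  "local_finsler M F p x y = (let q = chart_inv M p x in F q (transition M p q x y))"

text \<open>In the following, \<open>L x y\<close> is a Finsler metric on an open set of \<open>'e\<close>: \<open>x\<close> is the position
  and \<open>y\<close> the tangent vector.\<close>

definition fund_tensor ::
    "('e::real_normed_vector \<Rightarrow> 'e \<Rightarrow> real) \<Rightarrow> 'e \<Rightarrow> 'e \<Rightarrow> 'e \<Rightarrow> 'e \<Rightarrow> real" where
  "fund_tensor L x y u v =
     deriv (\<lambda>s. deriv (\<lambda>t. (L x (y + s *\<^sub>R u + t *\<^sub>R v))\<^sup>2) 0) 0 / 2"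

definition pos_deriv ::
    "('e::real_normed_vector \<Rightarrow> 'e \<Rightarrow> 'b::real_normed_vector) \<Rightarrow> 'e \<Rightarrow> 'e \<Rightarrow> 'e \<Rightarrow> 'b" where
  "pos_deriv Z x y u = frechet_derivative (\<lambda>x. Z x y) (at x) u"

definition vert_deriv ::
    "('e::real_normed_vector \<Rightarrow> 'e \<Rightarrow> 'b::real_normed_vector) \<Rightarrow> 'e \<Rightarrow> 'e \<Rightarrow> 'e \<Rightarrow> 'b" where
  "vert_deriv Z x y u = frechet_derivative (\<lambda>y. Z x y) (at y) u"

text \<open>The spray coefficients \<open>G\<^sup>i = 1/4 g\<^sup>i\<^sup>l ([F\<^sup>2]\<^sub>x\<^sub>m\<^sub>y\<^sub>l y\<^sup>m - [F\<^sup>2]\<^sub>x\<^sub>l)\<close>, with the index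
  raised as above.\<close>
definition spray :: "('e::real_normed_vector \<Rightarrow> 'e \<Rightarrow> real) \<Rightarrow> 'e \<Rightarrow> 'e \<Rightarrow> 'e" where
  "spray L x y = (let E = (\<lambda>x y. (L x y)\<^sup>2) in
     THE \<xi>. \<forall>w. fund_tensor L x y \<xi> w =
       (pos_deriv (\<lambda>x y. vert_deriv E x y w) x y y - pos_deriv E x y w) / 4)"

text \<open>The horizontal derivative \<open>\<delta>/\<delta>x\<^sup>k = \<partial>/\<partial>x\<^sup>k - N\<^sup>m\<^sub>k \<partial>/\<partial>y\<^sup>m\<close> with
  \<open>N\<^sup>m\<^sub>k = \<partial>G\<^sup>m/\<partial>y\<^sup>k\<close>.\<close>
definition hor_deriv ::
    "('e::real_normed_vector \<Rightarrow> 'e \<Rightarrow> real) \<Rightarrow> ('e \<Rightarrow> 'e \<Rightarrow> 'b::real_normed_vector)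
      \<Rightarrow> 'e \<Rightarrow> 'e \<Rightarrow> 'e \<Rightarrow> 'b" where
  "hor_deriv L Z x y u = pos_deriv Z x y u - vert_deriv Z x y (vert_deriv (spray L) x y u)"

text \<open>The coefficients of the Chern connection,
  \<open>\<Gamma>\<^sup>i\<^sub>j\<^sub>k = 1/2 g\<^sup>i\<^sup>l (\<delta>g\<^sub>l\<^sub>j/\<delta>x\<^sup>k + \<delta>g\<^sub>l\<^sub>k/\<delta>x\<^sup>j - \<delta>g\<^sub>j\<^sub>k/\<delta>x\<^sup>l)\<close>.\<close>
definition chern_coeff ::
    "('e::real_normed_vector \<Rightarrow> 'e \<Rightarrow> real) \<Rightarrow> 'e \<Rightarrow> 'e \<Rightarrow> 'e \<Rightarrow> 'e \<Rightarrow> 'e" where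
  "chern_coeff L x y u v = (THE \<xi>. \<forall>w. fund_tensor L x y \<xi> w =
     (hor_deriv L (\<lambda>x y. fund_tensor L x y v w) x y u
      + hor_deriv L (\<lambda>x y. fund_tensor L x y u w) x y v
      - hor_deriv L (\<lambda>x y. fund_tensor L x y u v) x y w) / 2)"

text \<open>The Chern connection lives on the pullback of the tangent bundle to the slit tangent bundle.
  Here \<open>Z\<close> is a section of the pullback bundle and the derivative is taken along the horizontal lift
  of \<open>u\<close>; the Chern connection has no coefficients in vertical directions.\<close>
definition chern_connection ::
    "('e::real_normed_vector \<Rightarrow> 'e \<Rightarrow> real) \<Rightarrow> 'e \<Rightarrow> ('e \<Rightarrow> 'e \<Rightarrow> 'e) \<Rightarrow> 'e \<Rightarrow> 'e \<Rightarrow> 'e" where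
  "chern_connection L u Z x y = hor_deriv L Z x y u + chern_coeff L x y u (Z x y)"

text \<open>\<open>R(u,v)w = \<nabla>\<^sub>u\<nabla>\<^sub>vw - \<nabla>\<^sub>v\<nabla>\<^sub>uw - \<nabla>\<^bsub>[u,v]\<^esub>w\<close> for constant \<open>u, v, w\<close>.  The last term is absent:
  the constant fields commute, and the bracket of their horizontal lifts is vertical, where the
  Chern connection has no coefficients.\<close>
definition chern_curvature ::
    "('e::real_normed_vector \<Rightarrow> 'e \<Rightarrow> real) \<Rightarrow> 'e \<Rightarrow> 'e \<Rightarrow> 'e \<Rightarrow> 'e \<Rightarrow> 'e \<Rightarrow> 'e" where
  "chern_curvature L x y u v w =
     chern_connection L u (chern_connection L v (\<lambda>_ _. w)) x y
     - chern_connection L v (chern_connection L u (\<lambda>_ _. w)) x y"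

text \<open>\<open>R\<^sub>y(u) = R(u,y)y\<close>, with reference vector \<open>y\<close>.\<close>
definition flag_operator ::
    "('e::real_normed_vector \<Rightarrow> 'e \<Rightarrow> real) \<Rightarrow> 'e \<Rightarrow> 'e \<Rightarrow> 'e \<Rightarrow> 'e" where
  "flag_operator L x y u = chern_curvature L x y u y y"

definition is_flag :: "'e::euclidean_space set \<Rightarrow> 'e \<Rightarrow> bool" where
  "is_flag P y \<longleftrightarrow> subspace P \<and> dim P = 2 \<and> y \<in> P \<and> y \<noteq> 0"

definition flag_curvature ::
    "('a, 'e::real_normed_vector, 'm) atlas_scheme \<Rightarrow> ('a \<Rightarrow> 'e \<Rightarrow> real) \<Rightarrow> 'a \<Rightarrow> 'e set \<Rightarrow> 'e \<Rightarrow> real" where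
  "flag_curvature M F p P y = (THE k. \<forall>u. P = span {u, y} \<longrightarrow>
     (let L = local_finsler M F p; x = chart M p p; gy = fund_tensor L x y in
        k = gy (flag_operator L x y u) u / (gy y y * gy u u - (gy y u)\<^sup>2)))"

definition douglas_type ::
    "('a, 'e::real_normed_vector, 'm) atlas_scheme \<Rightarrow> ('a \<Rightarrow> 'e \<Rightarrow> real) \<Rightarrow> bool" where
  "douglas_type M F \<longleftrightarrow> (\<forall>p. \<exists>\<Gamma> Q.
     (\<forall>x\<in>chart_image M p. bilinear (\<Gamma> x) \<and> (\<forall>c y. c > 0 \<and> y \<noteq> 0 \<longrightarrow> Q x (c *\<^sub>R y) = c * Q x y) \<and>
        (\<forall>y. y \<noteq> 0 \<longrightarrow> spray (local_finsler M F p) x y = (1/2) *\<^sub>R \<Gamma> x y y + Q x y *\<^sub>R y)))"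

definition randers_metric ::
    "('a \<Rightarrow> 'e \<Rightarrow> 'e \<Rightarrow> real) \<Rightarrow> ('a \<Rightarrow> 'e) \<Rightarrow> 'a \<Rightarrow> 'e \<Rightarrow> real" where
  "randers_metric g X p y = sqrt (g p y y) + g p (X p) y"

end

theory Submission
  imports Defs
begin

text \<open>In a chart the Randers metric is \<open>L = \<alpha> + b\<close>, where \<open>\<alpha>\<close> is the norm of the Riemannian metric and \<open>b\<close>
  a covector field. Its spray is that of \<open>\<alpha>\<close>, plus a multiple of \<open>y\<close>, plus a term \<open>\<alpha> S\<close> with \<open>S\<close> orthogonal
  to \<open>y\<close> and odd in \<open>y\<close>, which encodes the exterior derivative of \<open>b\<close>. Comparing \<open>y\<close> with \<open>-y\<close>, Douglas type forces
  \<open>S = 0\<close>, so \<open>b\<close> is closed and \<open>X\<close> is orthogonal to the derived algebra. The spray is then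
  \<open>G\<^sub>\<alpha> + P y\<close> with \<open>P = r / (2 L)\<close>, where \<open>r(y) = (\<nabla>\<^sub>y b)(y)\<close>; this projective change turns the flag operator
  into the Riemannian one plus \<open>(P\<^sup>2 - P\<^sub>;\<^sub>m y\<^sup>m) u\<close> modulo \<open>y\<close>. Hence the flag curvature is
  \<open>\<alpha>\<^sup>2 K / L\<^sup>2 + (3 r\<^sup>2 - 2 L r') / (4 L\<^sup>4)\<close>, where \<open>r'\<close> is the derivative of \<open>r\<close> along the geodesic flow of \<open>\<alpha>\<close>.
  On a Lie group \<open>r\<close> is constant along left invariant fields, and \<open>r(y) = - g(y, [X, y])\<close>,
  \<open>r'(y) = g(w, [X, y]) + g(y, [X, w])\<close> for \<open>w = \<nabla>\<^sub>y y\<close>, that is \<open>g(w, z) = g(y, [z, y])\<close>.\<close>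

section \<open>Calculus of smooth maps\<close>

text \<open>The definitions raise indices with \<open>THE\<close>, as solutions \<open>\<xi>\<close>
  of linear systems \<open>B x \<xi> w = r x w\<close> with positive definite \<open>B x\<close>.
  Existence, uniqueness and regular dependence of such solutions on the parameter therefore carry
  the analytic part: they give the Christoffel symbols, the spray and the Chern coefficients their
  regularity, and identities between these objects are verified by testing against every
  \<open>w\<close>.

  The flag operator is determined only up to a multiple of \<open>y\<close>, and this multiple is
  never computed. The fundamental tensor of a Randers metric is an angular part, which annihilates
  \<open>y\<close>, plus the square of the differential of \<open>L\<close>, which annihilates the
  flag operator because the energy is constant in horizontal directions. Both facts together remove
  the multiple from the quotient.

  The curvature involves derivatives in position, whereas the final formula lives in the Lie
  algebra. The passage uses that \<open>r\<close> is constant along left invariant fields: position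
  derivatives turn into vertical derivatives of an explicit quadratic form at the identity, and only
  linear algebra remains.\<close>

lemma frechet_derivative_eqI:
  assumes "(f has_derivative f') (at x)"
  shows "frechet_derivative f (at x) v = f' v"
  using frechet_derivative_at[OF assms] by simp

lemma frechet_derivative_cong_open:
  assumes "open S" "x \<in> S" "\<And>z. z \<in> S \<Longrightarrow> f z = g z"
  shows "frechet_derivative f (at x) = frechet_derivative g (at x)"
proof -
  have "(f has_derivative D) (at x) \<longleftrightarrow> (g has_derivative D) (at x)" for D
    using has_derivative_transform_within_open[OF _ assms(1,2), of f D UNIV g]
      has_derivative_transform_within_open[OF _ assms(1,2), of g D UNIV f] assms(3) by auto
  then show ?thesis by (simp add: frechet_derivative_def)
qed

lemma Ck_on_cong:
  assumes "open S" "\<And>x. x \<in> S \<Longrightarrow> f x = g x"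
  shows "Ck_on k f S \<longleftrightarrow> Ck_on k g S"
  using assms(2)
proof (induction k arbitrary: f g)
  case 0
  then show ?case by (simp cong: continuous_on_cong)
next
  case (Suc k)
  have d: "f differentiable at x \<longleftrightarrow> g differentiable at x" if "x \<in> S" for x
    using has_derivative_transform_within_open[OF _ assms(1) that, of f _ UNIV g]
      has_derivative_transform_within_open[OF _ assms(1) that, of g _ UNIV f] Suc.prems
    unfolding differentiable_def by auto
  have "frechet_derivative f (at x) v = frechet_derivative g (at x) v" if "x \<in> S" for x v
    using frechet_derivative_cong_open[OF assms(1) that, of f g] Suc.prems by simp
  then have "Ck_on k (\<lambda>x. frechet_derivative f (at x) v) S \<longleftrightarrow>
      Ck_on k (\<lambda>x. frechet_derivative g (at x) v) S" for v
    by (rule Suc.IH)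
  with d show ?case by simp
qed

lemma Ck_on_imp_continuous_on: "Ck_on k f S \<Longrightarrow> continuous_on S f"
  by (cases k) (auto intro!: continuous_at_imp_continuous_on differentiable_imp_continuous_within)

lemma Ck_on_SucD: "Ck_on (Suc k) f S \<Longrightarrow> Ck_on k f S"
proof (induction k arbitrary: f)
  case 0
  then show ?case using Ck_on_imp_continuous_on Ck_on.simps(1) by blast
next
  case (Suc k)
  then show ?case using Ck_on.simps(2) by blast
qed

lemma Ck_on_subset: "Ck_on k f S \<Longrightarrow> T \<subseteq> S \<Longrightarrow> Ck_on k f T"
proof (induction k arbitrary: f)
  case 0
  then show ?case using continuous_on_subset by auto
next
  case (Suc k)
  then show ?case by auto
qed

text \<open>Replaces the choice operator \<open>frechet_derivative\<close> in the recursion by any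
  explicit derivative; most inductions below run on such formulas.\<close>

lemma Ck_on_SucI:
  assumes "open S"
    and "\<And>x. x \<in> S \<Longrightarrow> (f has_derivative f' x) (at x)"
    and "\<And>v. Ck_on k (\<lambda>x. f' x v) S"
  shows "Ck_on (Suc k) f S"
proof -
  have "Ck_on k (\<lambda>x. frechet_derivative f (at x) v) S \<longleftrightarrow> Ck_on k (\<lambda>x. f' x v) S" for v
    by (rule Ck_on_cong[OF assms(1)]) (simp add: frechet_derivative_eqI[OF assms(2)])
  then show ?thesis using assms(2,3) by (auto simp: differentiable_def)
qed

lemma Ck_on_Suc_has_derivative:
  "Ck_on (Suc k) f S \<Longrightarrow> x \<in> S \<Longrightarrow> (f has_derivative frechet_derivative f (at x)) (at x)"
  using frechet_derivative_works by auto

lemma Ck_on_const: "Ck_on k (\<lambda>x. c) S"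
  by (induction k arbitrary: c) (auto simp: frechet_derivative_const)

lemma Ck_on_add:
  assumes "open S" "Ck_on k f S" "Ck_on k g S"
  shows "Ck_on k (\<lambda>x. f x + g x) S"
  using assms(2,3)
proof (induction k arbitrary: f g)
  case 0
  then show ?case by (auto intro: continuous_on_add)
next
  case (Suc k)
  show ?case
  proof (rule Ck_on_SucI[OF assms(1)])
    fix x assume "x \<in> S"
    then show "((\<lambda>x. f x + g x) has_derivative
        (\<lambda>v. frechet_derivative f (at x) v + frechet_derivative g (at x) v)) (at x)"
      by (intro has_derivative_add Ck_on_Suc_has_derivative[OF Suc.prems(1)]
          Ck_on_Suc_has_derivative[OF Suc.prems(2)])
  next
    fix v show "Ck_on k (\<lambda>x. frechet_derivative f (at x) v + frechet_derivative g (at x) v) S"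
      using Suc by auto
  qed
qed

lemma Ck_on_bounded_linear:
  assumes "bounded_linear F" "open S" "Ck_on k f S"
  shows "Ck_on k (\<lambda>x. F (f x)) S"
  using assms(3)
proof (induction k arbitrary: f)
  case 0
  then show ?case using bounded_linear.continuous_on[OF assms(1)] by auto
next
  case (Suc k)
  show ?case
  proof (rule Ck_on_SucI[OF assms(2)])
    fix x assume "x \<in> S"
    then show "((\<lambda>x. F (f x)) has_derivative (\<lambda>v. F (frechet_derivative f (at x) v))) (at x)"
      by (intro bounded_linear.has_derivative[OF assms(1)] Ck_on_Suc_has_derivative[OF Suc.prems])
  next
    fix v show "Ck_on k (\<lambda>x. F (frechet_derivative f (at x) v)) S"
      using Suc by auto
  qed
qed

lemma Ck_on_id: "Ck_on k (\<lambda>x. x) S"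
proof (cases k)
  case 0
  then show ?thesis by simp
next
  case (Suc n)
  then show ?thesis using Ck_on_const by (auto simp: frechet_derivative_ident)
qed

lemma Ck_on_bounded_bilinear:
  assumes "bounded_bilinear pr" "open S" "Ck_on k f S" "Ck_on k g S"
  shows "Ck_on k (\<lambda>x. pr (f x) (g x)) S"
  using assms(3,4)
proof (induction k arbitrary: f g)
  case 0
  then show ?case using bounded_bilinear.continuous_on[OF assms(1)] by auto
next
  case (Suc k)
  show ?case
  proof (rule Ck_on_SucI[OF assms(2)])
    fix x assume "x \<in> S"
    then show "((\<lambda>x. pr (f x) (g x)) has_derivative
       (\<lambda>v. pr (f x) (frechet_derivative g (at x) v) + pr (frechet_derivative f (at x) v) (g x))) (at x)"
      by (intro bounded_bilinear.FDERIV[OF assms(1)] Ck_on_Suc_has_derivative[OF Suc.prems(1)]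
          Ck_on_Suc_has_derivative[OF Suc.prems(2)])
  next
    fix v show "Ck_on k (\<lambda>x. pr (f x) (frechet_derivative g (at x) v)
        + pr (frechet_derivative f (at x) v) (g x)) S"
      using Suc by (intro Ck_on_add Suc.IH) (auto intro: Ck_on_SucD simp: assms(2))
  qed
qed

lemma Ck_on_sum:
  assumes "open S" "\<And>i. i \<in> I \<Longrightarrow> Ck_on k (f i) S"
  shows "Ck_on k (\<lambda>x. \<Sum>i\<in>I. f i x) S"
  using assms(2)
proof (induction I rule: infinite_finite_induct)
  case (insert i I)
  have "Ck_on k (\<lambda>x. f i x + (\<Sum>i\<in>I. f i x)) S"
    using insert by (intro Ck_on_add[OF assms(1)]) auto
  then show ?case using insert by simp
qed (simp_all add: Ck_on_const)

lemma Ck_on_compose: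
  fixes g :: "'a::real_normed_vector \<Rightarrow> 'b::euclidean_space" and f :: "'b \<Rightarrow> 'c::real_normed_vector"
  assumes "open S" "Ck_on k f T" "Ck_on k g S" "g ` S \<subseteq> T"
  shows "Ck_on k (\<lambda>x. f (g x)) S"
  using assms(2,3)
proof (induction k arbitrary: f)
  case 0
  then show ?case using assms(4) continuous_on_compose2[of T f S g] by auto
next
  case (Suc k)
  note df = Ck_on_Suc_has_derivative[OF Suc.prems(1)]
  show ?case
  proof (rule Ck_on_SucI[OF assms(1)])
    fix x assume x: "x \<in> S"
    then have gx: "g x \<in> T" using assms(4) by auto
    have 1: "((\<lambda>x. f (g x)) has_derivative
      (\<lambda>v. frechet_derivative f (at (g x)) (frechet_derivative g (at x) v))) (at x)"
      using diff_chain_at[OF Ck_on_Suc_has_derivative[OF Suc.prems(2) x] df[OF gx]]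
      by (simp add: o_def)
    interpret l: bounded_linear "frechet_derivative f (at (g x))"
      using df[OF gx] has_derivative_bounded_linear by blast
    \<comment> \<open>\<open>Ck_on\<close> controls derivatives in fixed directions, whereas the
      chain rule applies the derivative of \<open>f\<close> to the moving direction
      \<open>frechet_derivative g (at x) v\<close>. Expanding that direction in the basis separates
      the two, which is why the middle space is Euclidean.\<close>
    have "frechet_derivative f (at (g x)) u =
        (\<Sum>i\<in>Basis. (u \<bullet> i) *\<^sub>R frechet_derivative f (at (g x)) i)" for u
      by (subst euclidean_representation[of u, symmetric]) (simp only: l.sum l.scaleR)
    from 1[unfolded this[of "frechet_derivative g (at x) _"]]
    show "((\<lambda>x. f (g x)) has_derivative (\<lambda>v. \<Sum>i\<in>Basis.
        (frechet_derivative g (at x) v \<bullet> i) *\<^sub>R frechet_derivative f (at (g x)) i)) (at x)" .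
  next
    fix v
    show "Ck_on k (\<lambda>x. \<Sum>i\<in>Basis.
        (frechet_derivative g (at x) v \<bullet> i) *\<^sub>R frechet_derivative f (at (g x)) i) S"
      using Suc.prems
      by (intro Ck_on_sum[OF assms(1)] Ck_on_bounded_bilinear[OF bounded_bilinear_scaleR assms(1)]
          Ck_on_bounded_linear[OF bounded_linear_inner_left assms(1)] Suc.IH)
        (auto intro: Ck_on_SucD)
  qed
qed

text \<open>The derivative is a product of values of \<open>inverse\<close> itself, so the induction
  closes on the product rule. Positive arguments cover the denominators that occur: numerals, square
  roots and values of a Finsler norm.\<close>

lemma Ck_on_inverse: "Ck_on k (inverse :: real \<Rightarrow> real) {0<..}"
proof (induction k)
  case 0
  then show ?case by (auto intro!: continuous_intros)
next
  case (Suc k)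
  show ?case
  proof (rule Ck_on_SucI)
    fix x :: real assume "x \<in> {0<..}"
    then show "(inverse has_derivative (\<lambda>h. - (inverse x * h * inverse x))) (at x)"
      by (intro has_derivative_inverse') auto
  next
    fix v :: real
    have "Ck_on k (\<lambda>x::real. (- v) * (inverse x * inverse x)) {0<..}"
      by (intro Ck_on_bounded_linear[OF bounded_linear_mult_right]
          Ck_on_bounded_bilinear[OF bounded_bilinear_mult] Suc) auto
    then show "Ck_on k (\<lambda>x::real. - (inverse x * v * inverse x)) {0<..}"
      by (simp add: mult_ac)
  qed simp
qed

lemma Ck_on_sqrt: "Ck_on k sqrt {0<..}"
proof (induction k)
  case 0
  then show ?case by (auto intro!: continuous_intros)
next
  case (Suc k)
  show ?case
  proof (rule Ck_on_SucI)
    fix x :: real assume "x \<in> {0<..}"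
    then show "(sqrt has_derivative (\<lambda>h. h * (inverse (sqrt x) / 2))) (at x)"
      using has_derivative_real_sqrt[of "\<lambda>x. x" x "\<lambda>x. x" UNIV] by (auto intro!: derivative_eq_intros simp: field_simps)
  next
    fix v :: real
    have "Ck_on k (\<lambda>x::real. (v / 2) * inverse (sqrt x)) {0<..}"
      by (intro Ck_on_bounded_linear[OF bounded_linear_mult_right]
          Ck_on_compose[OF _ Ck_on_inverse Suc]) auto
    then show "Ck_on k (\<lambda>x::real. v * (inverse (sqrt x) / 2)) {0<..}"
      by (simp add: mult_ac)
  qed simp
qed

section \<open>Closure properties of smooth maps\<close>

lemma smooth_on_cong:
  "open S \<Longrightarrow> (\<And>x. x \<in> S \<Longrightarrow> f x = g x) \<Longrightarrow> smooth_on f S \<longleftrightarrow> smooth_on g S"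
  unfolding smooth_on_def using Ck_on_cong by blast

lemma smooth_on_transform:
  "open S \<Longrightarrow> smooth_on f S \<Longrightarrow> (\<And>x. x \<in> S \<Longrightarrow> f x = g x) \<Longrightarrow> smooth_on g S"
  using smooth_on_cong[of S f g] by simp

lemma smooth_on_subset: "smooth_on f S \<Longrightarrow> T \<subseteq> S \<Longrightarrow> smooth_on f T"
  unfolding smooth_on_def using Ck_on_subset by blast

lemma smooth_on_has_derivative:
  "smooth_on f S \<Longrightarrow> x \<in> S \<Longrightarrow> (f has_derivative frechet_derivative f (at x)) (at x)"
  unfolding smooth_on_def using Ck_on_Suc_has_derivative by blast

lemma smooth_on_imp_continuous_on: "smooth_on f S \<Longrightarrow> continuous_on S f"
  unfolding smooth_on_def using Ck_on_imp_continuous_on by blast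

lemma smooth_on_frechet_derivative:
  "smooth_on f S \<Longrightarrow> smooth_on (\<lambda>x. frechet_derivative f (at x) v) S"
  unfolding smooth_on_def
proof
  fix k assume "\<forall>k. Ck_on k f S"
  then have "Ck_on (Suc k) f S" by blast
  then show "Ck_on k (\<lambda>x. frechet_derivative f (at x) v) S" by simp
qed

named_theorems smooth_intros

lemma smooth_on_const [smooth_intros]: "smooth_on (\<lambda>x. c) S"
  by (simp add: smooth_on_def Ck_on_const)

lemma smooth_on_id [smooth_intros]: "smooth_on (\<lambda>x. x) S"
  by (simp add: smooth_on_def Ck_on_id)

lemma smooth_on_add [smooth_intros]:
  "open S \<Longrightarrow> smooth_on f S \<Longrightarrow> smooth_on g S \<Longrightarrow> smooth_on (\<lambda>x. f x + g x) S"
  by (simp add: smooth_on_def Ck_on_add)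

lemma smooth_on_sum [smooth_intros]:
  "open S \<Longrightarrow> (\<And>i. i \<in> I \<Longrightarrow> smooth_on (f i) S) \<Longrightarrow> smooth_on (\<lambda>x. \<Sum>i\<in>I. f i x) S"
  by (simp add: smooth_on_def Ck_on_sum)

lemma smooth_on_bounded_linear:
  "bounded_linear F \<Longrightarrow> open S \<Longrightarrow> smooth_on f S \<Longrightarrow> smooth_on (\<lambda>x. F (f x)) S"
  by (simp add: smooth_on_def Ck_on_bounded_linear)

lemma smooth_on_bounded_bilinear:
  "bounded_bilinear pr \<Longrightarrow> open S \<Longrightarrow> smooth_on f S \<Longrightarrow> smooth_on g S
    \<Longrightarrow> smooth_on (\<lambda>x. pr (f x) (g x)) S"
  by (simp add: smooth_on_def Ck_on_bounded_bilinear)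

lemmas smooth_on_scaleR [smooth_intros] = smooth_on_bounded_bilinear[OF bounded_bilinear_scaleR]
lemmas smooth_on_inner [smooth_intros] = smooth_on_bounded_bilinear[OF bounded_bilinear_inner]
lemmas smooth_on_mult [smooth_intros] =
  smooth_on_bounded_bilinear[OF bounded_bilinear_mult]
lemmas smooth_on_minus [smooth_intros] =
  smooth_on_bounded_linear[OF bounded_linear_minus[OF bounded_linear_ident]]
lemmas smooth_on_fst [smooth_intros] = smooth_on_bounded_linear[OF bounded_linear_fst]
lemmas smooth_on_snd [smooth_intros] = smooth_on_bounded_linear[OF bounded_linear_snd]

lemma smooth_on_diff [smooth_intros]:
  "open S \<Longrightarrow> smooth_on f S \<Longrightarrow> smooth_on g S \<Longrightarrow> smooth_on (\<lambda>x. f x - g x) S"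
  using smooth_on_add[of S f "\<lambda>x. - g x"] smooth_on_minus[of S g] by simp

lemma smooth_on_compose:
  fixes g :: "'a::real_normed_vector \<Rightarrow> 'b::euclidean_space"
  shows "open S \<Longrightarrow> smooth_on f T \<Longrightarrow> smooth_on g S \<Longrightarrow> g ` S \<subseteq> T \<Longrightarrow> smooth_on (\<lambda>x. f (g x)) S"
  unfolding smooth_on_def using Ck_on_compose by blast

lemma smooth_on_Pair [smooth_intros]:
  assumes "open S" "smooth_on f S" "smooth_on g S"
  shows "smooth_on (\<lambda>x. (f x, g x)) S"
proof -
  have "bounded_linear (\<lambda>x. (x, 0))" "bounded_linear (\<lambda>x. (0, x))"
    by (auto intro!: bounded_linear_Pair bounded_linear_ident bounded_linear_zero)
  then have "smooth_on (\<lambda>x. (f x, 0) + (0, g x)) S"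
    using assms by (intro smooth_on_add smooth_on_bounded_linear[of "\<lambda>x. (x, 0)"]
        smooth_on_bounded_linear[of "\<lambda>x. (0, x)"]) auto
  then show ?thesis by simp
qed

lemma smooth_on_inverse [smooth_intros]:
  fixes f :: "_ \<Rightarrow> real"
  shows "open S \<Longrightarrow> smooth_on f S \<Longrightarrow> (\<And>x. x \<in> S \<Longrightarrow> 0 < f x) \<Longrightarrow> smooth_on (\<lambda>x. inverse (f x)) S"
  by (rule smooth_on_compose[of _ _ "{0<..}"]) (auto simp: smooth_on_def Ck_on_inverse)

lemma smooth_on_divide [smooth_intros]:
  fixes f g :: "_ \<Rightarrow> real"
  shows "open S \<Longrightarrow> smooth_on f S \<Longrightarrow> smooth_on g S \<Longrightarrow> (\<And>x. x \<in> S \<Longrightarrow> 0 < g x)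
    \<Longrightarrow> smooth_on (\<lambda>x. f x / g x) S"
  unfolding divide_inverse by (intro smooth_intros)

lemma smooth_on_sqrt [smooth_intros]:
  fixes f :: "_ \<Rightarrow> real"
  shows "open S \<Longrightarrow> smooth_on f S \<Longrightarrow> (\<And>x. x \<in> S \<Longrightarrow> 0 < f x) \<Longrightarrow> smooth_on (\<lambda>x. sqrt (f x)) S"
  by (rule smooth_on_compose[of _ _ "{0<..}"]) (auto simp: smooth_on_def Ck_on_sqrt)

section \<open>Symmetry of second derivatives\<close>

lemma has_real_derivative_along_line:
  fixes f :: "'a::real_normed_vector \<Rightarrow> real"
  assumes "(f has_derivative f') (at (a + t *\<^sub>R v))"
  shows "((\<lambda>t. f (a + t *\<^sub>R v)) has_real_derivative f' v) (at t)"
proof -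
  have "((\<lambda>t. a + t *\<^sub>R v) has_derivative (\<lambda>k. k *\<^sub>R v)) (at t)"
    by (auto intro!: derivative_eq_intros)
  from diff_chain_at[OF this assms] show ?thesis
    using linear_cmul[OF has_derivative_linear[OF assms]]
    by (auto simp: has_field_derivative_def o_def mult.commute fun_eq_iff elim!: has_derivative_eq_rhs)
qed

lemma norm_combination_le:
  assumes "0 \<le> s" "s \<le> h" "0 \<le> t" "t \<le> h"
  shows "norm (s *\<^sub>R u + t *\<^sub>R v) \<le> norm u * h + norm v * h"
proof -
  have "norm (s *\<^sub>R u + t *\<^sub>R v) \<le> \<bar>s\<bar> * norm u + \<bar>t\<bar> * norm v"
    using norm_triangle_ineq[of "s *\<^sub>R u" "t *\<^sub>R v"] by simp
  also have "\<dots> \<le> norm u * h + norm v * h"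
    using assms by (intro add_mono) (auto simp: mult.commute intro: mult_right_mono)
  finally show ?thesis .
qed

text \<open>Schwarz's theorem by the double mean value argument: the second difference quotient is a value
  of either mixed derivative near the base point.\<close>

lemma second_difference_mean_value:
  fixes f :: "'a::real_normed_vector \<Rightarrow> real"
  assumes "smooth_on f (ball x r)" "norm u * h + norm v * h < r" "0 < h"
  shows "\<exists>s t. 0 < s \<and> s < h \<and> 0 < t \<and> t < h \<and>
    f (x + h *\<^sub>R u + h *\<^sub>R v) - f (x + h *\<^sub>R u) - f (x + h *\<^sub>R v) + f x =
      h\<^sup>2 * frechet_derivative (\<lambda>z. frechet_derivative f (at z) u) (at (x + s *\<^sub>R u + t *\<^sub>R v)) v"
proof -
  have inb: "x + s *\<^sub>R u + t *\<^sub>R v \<in> ball x r" if "0 \<le> s" "s \<le> h" "0 \<le> t" "t \<le> h" for s t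
  proof -
    have "norm (s *\<^sub>R u + t *\<^sub>R v) < r" using norm_combination_le[OF that, of u v] assms(2) by simp
    moreover have "dist x (x + s *\<^sub>R u + t *\<^sub>R v) = norm (s *\<^sub>R u + t *\<^sub>R v)"
      by (metis add.assoc add_diff_cancel_left' dist_commute dist_norm)
    ultimately show ?thesis by simp
  qed
  define \<phi> where "\<phi> s = f (x + s *\<^sub>R u + h *\<^sub>R v) - f (x + s *\<^sub>R u)" for s
  define f' where "f' z = frechet_derivative f (at z) u" for z
  have f': "smooth_on f' (ball x r)"
    unfolding f'_def by (rule smooth_on_frechet_derivative[OF assms(1)])
  have line: "((\<lambda>s. f (x + s *\<^sub>R u + t *\<^sub>R v)) has_real_derivative f' (x + s *\<^sub>R u + t *\<^sub>R v)) (at s)"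
    if "0 \<le> s" "s \<le> h" "0 \<le> t" "t \<le> h" for s t
    using has_real_derivative_along_line[OF smooth_on_has_derivative[OF assms(1)], of "x + t *\<^sub>R v" s u] inb[OF that]
    by (simp add: f'_def add_ac)
  have "\<exists>s. 0 < s \<and> s < h \<and> \<phi> h - \<phi> 0 = (h - 0) * (f' (x + s *\<^sub>R u + h *\<^sub>R v) - f' (x + s *\<^sub>R u))"
    unfolding \<phi>_def
  proof (rule MVT2[OF assms(3)])
    fix s :: real assume "0 \<le> s" "s \<le> h"
    then show "((\<lambda>s. f (x + s *\<^sub>R u + h *\<^sub>R v) - f (x + s *\<^sub>R u)) has_real_derivative
       f' (x + s *\<^sub>R u + h *\<^sub>R v) - f' (x + s *\<^sub>R u)) (at s)"
      using line[of s h] line[of s 0] assms(3) by (intro DERIV_diff) auto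
  qed
  then obtain s where s: "0 < s" "s < h"
    "\<phi> h - \<phi> 0 = h * (f' (x + s *\<^sub>R u + h *\<^sub>R v) - f' (x + s *\<^sub>R u))" by auto
  have "\<exists>t. 0 < t \<and> t < h \<and> f' (x + s *\<^sub>R u + h *\<^sub>R v) - f' (x + s *\<^sub>R u + 0 *\<^sub>R v) =
      (h - 0) * frechet_derivative f' (at (x + s *\<^sub>R u + t *\<^sub>R v)) v"
  proof (rule MVT2[OF assms(3)])
    fix t assume t: "0 \<le> t" "t \<le> h"
    show "((\<lambda>t. f' (x + s *\<^sub>R u + t *\<^sub>R v)) has_real_derivative
        frechet_derivative f' (at (x + s *\<^sub>R u + t *\<^sub>R v)) v) (at t)"
      using s t by (intro has_real_derivative_along_line smooth_on_has_derivative[OF f'] inb) auto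
  qed
  then obtain t where t: "0 < t" "t < h"
    "f' (x + s *\<^sub>R u + h *\<^sub>R v) - f' (x + s *\<^sub>R u) = h * frechet_derivative f' (at (x + s *\<^sub>R u + t *\<^sub>R v)) v"
    by auto
  have "f (x + h *\<^sub>R u + h *\<^sub>R v) - f (x + h *\<^sub>R u) - f (x + h *\<^sub>R v) + f x = \<phi> h - \<phi> 0"
    by (simp add: \<phi>_def)
  also have "\<dots> = h\<^sup>2 * frechet_derivative f' (at (x + s *\<^sub>R u + t *\<^sub>R v)) v"
    using s t by (simp add: power2_eq_square)
  finally show ?thesis using s t unfolding f'_def by blast
qed

lemma second_derivative_symmetric_real:
  fixes f :: "'a::real_normed_vector \<Rightarrow> real"
  assumes "open S" "smooth_on f S" "x \<in> S"
  shows "frechet_derivative (\<lambda>z. frechet_derivative f (at z) u) (at x) v =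
         frechet_derivative (\<lambda>z. frechet_derivative f (at z) v) (at x) u"
proof -
  obtain r where r: "r > 0" "ball x r \<subseteq> S" using assms(1,3) open_contains_ball by blast
  have f: "smooth_on f (ball x r)" using assms(2) r(2) smooth_on_subset by blast
  define D where "D u v z = frechet_derivative (\<lambda>z. frechet_derivative f (at z) u) (at z) v" for u v z
  have D: "isCont (D u v) x" for u v
    using smooth_on_imp_continuous_on[OF smooth_on_frechet_derivative[OF smooth_on_frechet_derivative[OF f]]]
      r(1) unfolding D_def by (simp add: continuous_on_eq_continuous_at)
  have "\<bar>D u v x - D v u x\<bar> \<le> 2 * \<epsilon>" if e: "\<epsilon> > 0" for \<epsilon>
  proof -
    obtain d1 where d1: "d1 > 0" "\<And>z. dist z x < d1 \<Longrightarrow> dist (D u v z) (D u v x) < \<epsilon>"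
      using D[of u v] e unfolding continuous_at_eps_delta by (auto simp: dist_norm)
    obtain d2 where d2: "d2 > 0" "\<And>z. dist z x < d2 \<Longrightarrow> dist (D v u z) (D v u x) < \<epsilon>"
      using D[of v u] e unfolding continuous_at_eps_delta by (auto simp: dist_norm)
    define d where "d = min r (min d1 d2)"
    \<comment> \<open>Small enough for the parallelogram spanned by \<open>h u\<close> and
      \<open>h v\<close> to stay within distance \<open>d / 2\<close> of \<open>x\<close>; the
      summand 1 keeps the denominator positive when both vectors vanish.\<close>
    define h where "h = d / (2 * (norm u + norm v + 1))"
    have dpos: "d > 0" using r d1 d2 by (simp add: d_def)
    have den: "norm u + norm v + 1 > 0" using norm_ge_zero[of u] norm_ge_zero[of v] by linarith
    have h: "h > 0" using dpos den by (simp add: h_def)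
    have "h * (norm u + norm v + 1) = d / 2" using den by (simp add: h_def field_simps)
    then have hd: "norm u * h + norm v * h < d" using h dpos by (simp add: algebra_simps)
    have near: "dist (x + s *\<^sub>R a + t *\<^sub>R b) x < d"
      if "norm a * h + norm b * h < d" "0 < s" "s < h" "0 < t" "t < h" for s t a b
      using norm_combination_le[of s h t a b] that by (simp add: dist_norm add.assoc)
    obtain s t where st: "0 < s" "s < h" "0 < t" "t < h"
      "f (x + h *\<^sub>R u + h *\<^sub>R v) - f (x + h *\<^sub>R u) - f (x + h *\<^sub>R v) + f x = h\<^sup>2 * D u v (x + s *\<^sub>R u + t *\<^sub>R v)"
      using second_difference_mean_value[OF f _ h, of u v] hd unfolding D_def d_def by auto
    obtain s' t' where st': "0 < s'" "s' < h" "0 < t'" "t' < h"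
      "f (x + h *\<^sub>R v + h *\<^sub>R u) - f (x + h *\<^sub>R v) - f (x + h *\<^sub>R u) + f x = h\<^sup>2 * D v u (x + s' *\<^sub>R v + t' *\<^sub>R u)"
      using second_difference_mean_value[OF f _ h, of v u] hd unfolding D_def d_def by auto
    have "h\<^sup>2 * D u v (x + s *\<^sub>R u + t *\<^sub>R v) = h\<^sup>2 * D v u (x + s' *\<^sub>R v + t' *\<^sub>R u)"
      using st(5) st'(5) by (simp add: algebra_simps)
    then have "D u v (x + s *\<^sub>R u + t *\<^sub>R v) = D v u (x + s' *\<^sub>R v + t' *\<^sub>R u)" using h by simp
    moreover have "dist (D u v (x + s *\<^sub>R u + t *\<^sub>R v)) (D u v x) < \<epsilon>"
      using d1(2) near[OF hd st(1-4)] by (simp add: d_def)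
    moreover have "dist (D v u (x + s' *\<^sub>R v + t' *\<^sub>R u)) (D v u x) < \<epsilon>"
      using d2(2) near[OF _ st'(1-4), of v u] hd by (simp add: d_def)
    ultimately show ?thesis by (simp add: dist_real_def)
  qed
  \<comment> \<open>A nonzero difference d would satisfy |d| \<le> |d| / 2 for this choice of
    \<epsilon>.\<close>
  from this[of "\<bar>D u v x - D v u x\<bar> / 4"] have "D u v x = D v u x" by fastforce
  then show ?thesis by (simp add: D_def)
qed

lemma frechet_derivative_bounded_linear:
  assumes "bounded_linear F" "f differentiable (at x)"
  shows "frechet_derivative (\<lambda>z. F (f z)) (at x) v = F (frechet_derivative f (at x) v)"
  by (rule frechet_derivative_eqI)
    (intro bounded_linear.has_derivative[OF assms(1)] frechet_derivative_works[THEN iffD1] assms(2))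

lemma smooth_on_differentiable: "smooth_on f S \<Longrightarrow> x \<in> S \<Longrightarrow> f differentiable (at x)"
  using smooth_on_has_derivative differentiable_def by blast

lemma second_derivative_symmetric:
  fixes f :: "'a::real_normed_vector \<Rightarrow> 'b::euclidean_space"
  assumes "open S" "smooth_on f S" "x \<in> S"
  shows "frechet_derivative (\<lambda>z. frechet_derivative f (at z) u) (at x) v =
         frechet_derivative (\<lambda>z. frechet_derivative f (at z) v) (at x) u"
proof (rule euclidean_eqI)
  fix i :: 'b assume "i \<in> Basis"
  have *: "frechet_derivative (\<lambda>z. frechet_derivative f (at z) a) (at x) b \<bullet> i =
    frechet_derivative (\<lambda>z. frechet_derivative (\<lambda>y. f y \<bullet> i) (at z) a) (at x) b" for a b
  proof -
    have "frechet_derivative (\<lambda>z. frechet_derivative f (at z) a) (at x) b \<bullet> i =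
       frechet_derivative (\<lambda>z. frechet_derivative f (at z) a \<bullet> i) (at x) b"
      using smooth_on_differentiable[OF smooth_on_frechet_derivative[OF assms(2)] assms(3)]
      by (simp add: frechet_derivative_bounded_linear[OF bounded_linear_inner_left])
    also have "\<dots> = frechet_derivative (\<lambda>z. frechet_derivative (\<lambda>y. f y \<bullet> i) (at z) a) (at x) b"
      using smooth_on_differentiable[OF assms(2)]
      by (intro fun_cong[OF frechet_derivative_cong_open[OF assms(1,3)]])
        (simp add: frechet_derivative_bounded_linear[OF bounded_linear_inner_left])
    finally show ?thesis .
  qed
  have "smooth_on (\<lambda>y. f y \<bullet> i) S"
    by (rule smooth_on_bounded_linear[OF bounded_linear_inner_left assms(1,2)])
  from second_derivative_symmetric_real[OF assms(1) this assms(3)]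
  show "frechet_derivative (\<lambda>z. frechet_derivative f (at z) u) (at x) v \<bullet> i =
         frechet_derivative (\<lambda>z. frechet_derivative f (at z) v) (at x) u \<bullet> i"
    unfolding * .
qed


section \<open>Linear systems given by positive definite forms\<close>

lemma norm_le_sum_if_coercive:
  fixes B :: "'a::euclidean_space \<Rightarrow> 'a \<Rightarrow> real"
  assumes "c > 0" "c * (norm u)\<^sup>2 \<le> B u u" "\<And>w. B u w = r w" "linear r"
  shows "norm u \<le> (\<Sum>b\<in>Basis. \<bar>r b\<bar>) / c"
proof (cases "u = 0")
  case True
  then show ?thesis using assms(1) by (simp add: sum_nonneg)
next
  case False
  have "r u = (\<Sum>b\<in>Basis. (u \<bullet> b) * r b)"
    by (subst euclidean_representation[of u, symmetric], subst linear_sum[OF assms(4)])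
      (simp add: linear_cmul[OF assms(4)])
  also have "\<dots> \<le> (\<Sum>b\<in>Basis. norm u * \<bar>r b\<bar>)"
  proof (rule sum_mono)
    fix b :: 'a assume "b \<in> Basis"
    then have "\<bar>u \<bullet> b\<bar> \<le> norm u" by (rule Basis_le_norm)
    then have "\<bar>(u \<bullet> b) * r b\<bar> \<le> norm u * \<bar>r b\<bar>" by (simp add: abs_mult mult_right_mono)
    then show "(u \<bullet> b) * r b \<le> norm u * \<bar>r b\<bar>" by linarith
  qed
  finally have "c * (norm u)\<^sup>2 \<le> norm u * (\<Sum>b\<in>Basis. \<bar>r b\<bar>)"
    using assms(2,3) by (simp add: sum_distrib_left)
  then have "norm u * (c * norm u) \<le> norm u * (\<Sum>b\<in>Basis. \<bar>r b\<bar>)"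
    by (simp add: power2_eq_square algebra_simps)
  then have "c * norm u \<le> (\<Sum>b\<in>Basis. \<bar>r b\<bar>)" using False by simp
  then show ?thesis using assms(1) by (simp add: field_simps)
qed

text \<open>The constant is the minimum of the quadratic form over the unit sphere, attained by
  compactness; scaling extends the bound to all vectors.\<close>

lemma positive_definite_coercive:
  fixes B :: "'a::euclidean_space \<Rightarrow> 'a \<Rightarrow> real"
  assumes B: "bilinear B" and pos: "\<And>u. u \<noteq> 0 \<Longrightarrow> 0 < B u u"
  obtains c where "c > 0" "\<And>u. c * (norm u)\<^sup>2 \<le> B u u"
proof -
  have "continuous_on (sphere 0 1) (\<lambda>u. B u u)"
    by (intro bilinear_continuous_on_compose[OF _ _ B] continuous_intros)
  moreover have "sphere 0 1 \<noteq> ({} :: 'a set)" by simp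
  ultimately obtain m where m: "m \<in> sphere 0 1" "\<And>u. u \<in> sphere 0 1 \<Longrightarrow> B m m \<le> B u u"
    using continuous_attains_inf[OF compact_sphere] by blast
  have "B m m > 0" using m(1) by (intro pos) auto
  moreover have "B m m * (norm u)\<^sup>2 \<le> B u u" for u
  proof (cases "u = 0")
    case False
    define n where "n = u /\<^sub>R norm u"
    have "norm n = 1" using False by (simp add: n_def)
    then have "B m m \<le> B n n" by (intro m(2)) simp
    moreover have "u = norm u *\<^sub>R n" using False by (simp add: n_def)
    then have "B u u = (norm u)\<^sup>2 * B n n"
      by (metis bilinear_lmul[OF B] bilinear_rmul[OF B] power2_eq_square real_scaleR_def mult.assoc)
    ultimately show ?thesis by (simp add: mult.commute[of "B n n"] mult_right_mono mult.commute[of _ "(norm u)\<^sup>2"] mult_left_mono)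
  qed (simp add: bilinear_lzero[OF B])
  ultimately show thesis by (rule that)
qed

lemma bilinear_expand:
  assumes "bilinear B"
  shows "B u v = (\<Sum>i\<in>Basis. \<Sum>j\<in>Basis. ((u \<bullet> i) * (v \<bullet> j)) *\<^sub>R B i j)"
proof -
  have "B u v = B (\<Sum>i\<in>Basis. (u \<bullet> i) *\<^sub>R i) (\<Sum>i\<in>Basis. (v \<bullet> i) *\<^sub>R i)"
    by (simp only: euclidean_representation)
  then show ?thesis
    by (simp add: bilinear_sum[OF assms] sum.cartesian_product bilinear_lmul[OF assms] bilinear_rmul[OF assms] mult.commute)
qed

lemma linear_expand:
  assumes "linear A"
  shows "A u = (\<Sum>i\<in>Basis. (u \<bullet> i) *\<^sub>R A i)"
  by (subst euclidean_representation[of u, symmetric], subst linear_sum[OF assms])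
    (simp add: linear_cmul[OF assms])

text \<open>If the matrix entries of \<open>B x\<close> and \<open>B x0\<close> differ by less than
  \<open>c / 2\<close> in sum, the quadratic forms differ by at most half of the coercivity bound at
  \<open>x0\<close>. A constant uniform in \<open>x\<close> is what the continuity of solutions
  rests on.\<close>

lemma coercive_nearby:
  fixes B :: "'b::t2_space \<Rightarrow> 'a::euclidean_space \<Rightarrow> 'a \<Rightarrow> real"
  assumes "open S" "x0 \<in> S" "\<And>x. x \<in> S \<Longrightarrow> bilinear (B x)"
    and pos: "\<And>u. u \<noteq> 0 \<Longrightarrow> 0 < B x0 u u"
    and cont: "\<And>u v. continuous (at x0) (\<lambda>x. B x u v)"
  shows "\<exists>c>0. eventually (\<lambda>x. \<forall>u. c * (norm u)\<^sup>2 \<le> B x u u) (at x0)"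
proof -
  obtain c where c: "c > 0" "\<And>u. c * (norm u)\<^sup>2 \<le> B x0 u u"
    using positive_definite_coercive[OF assms(3)[OF assms(2)] pos] by blast
  have "((\<lambda>x. \<Sum>i\<in>Basis. \<Sum>j\<in>Basis. \<bar>B x i j - B x0 i j\<bar>) \<longlongrightarrow> (\<Sum>i\<in>(Basis::'a set). \<Sum>j\<in>(Basis::'a set). \<bar>B x0 i j - B x0 i j\<bar>)) (at x0)"
    using cont by (intro tendsto_intros) (auto simp: continuous_within)
  then have "eventually (\<lambda>x. (\<Sum>i\<in>Basis. \<Sum>j\<in>Basis. \<bar>B x i j - B x0 i j\<bar>) < c / 2) (at x0)"
    using c(1) by (intro order_tendstoD(2)) auto
  moreover have "eventually (\<lambda>x. x \<in> S) (at x0)"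
    using assms(1,2) by (rule eventually_at_in_open')
  ultimately have "eventually (\<lambda>x. \<forall>u. (c/2) * (norm u)\<^sup>2 \<le> B x u u) (at x0)"
  proof eventually_elim
    case (elim x)
    show ?case
    proof
      fix u
      have "B x u u - B x0 u u = (\<Sum>i\<in>Basis. \<Sum>j\<in>Basis. ((u \<bullet> i) * (u \<bullet> j)) * (B x i j - B x0 i j))"
        by (subst bilinear_expand[OF assms(3)[OF elim(2)]], subst bilinear_expand[OF assms(3)[OF assms(2)]])
          (simp add: sum_subtractf right_diff_distrib)
      also have "\<bar>\<dots>\<bar> \<le> (\<Sum>i\<in>Basis. \<Sum>j\<in>Basis. (norm u)\<^sup>2 * \<bar>B x i j - B x0 i j\<bar>)"
      proof (rule order_trans[OF sum_abs], rule sum_mono, rule order_trans[OF sum_abs], rule sum_mono)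
        fix i j :: 'a assume "i \<in> Basis" "j \<in> Basis"
        then have "\<bar>u \<bullet> i\<bar> * \<bar>u \<bullet> j\<bar> \<le> norm u * norm u" by (intro mult_mono) (auto simp: Basis_le_norm)
        then show "\<bar>((u \<bullet> i) * (u \<bullet> j)) * (B x i j - B x0 i j)\<bar> \<le> (norm u)\<^sup>2 * \<bar>B x i j - B x0 i j\<bar>"
          by (simp add: abs_mult power2_eq_square mult_right_mono)
      qed
      also have "\<dots> = (norm u)\<^sup>2 * (\<Sum>i\<in>Basis. \<Sum>j\<in>Basis. \<bar>B x i j - B x0 i j\<bar>)"
        by (simp add: sum_distrib_left)
      also have "\<dots> \<le> (norm u)\<^sup>2 * (c / 2)" using elim by (intro mult_left_mono) auto
      finally have "\<bar>B x u u - B x0 u u\<bar> \<le> c * (norm u)\<^sup>2 / 2" by (simp add: mult.commute)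
      then show "(c/2) * (norm u)\<^sup>2 \<le> B x u u" using c(2)[of u] abs_ge_minus_self[of "B x u u - B x0 u u"]
        by (simp add: field_simps)
    qed
  qed
  then show ?thesis using c(1) by (intro exI[of _ "c/2"]) auto
qed

text \<open>The map \<open>T\<close> sends \<open>\<xi>\<close> to the vector representing the
  functional \<open>B \<xi>\<close>; positivity makes it injective, hence surjective in finite
  dimension. This is what makes the \<open>THE\<close> in \<open>christoffel\<close>,
  \<open>spray\<close> and \<open>chern_coeff\<close> denote a solution.\<close>

lemma bilinear_solution_ex1:
  fixes B :: "'a::euclidean_space \<Rightarrow> 'a \<Rightarrow> real"
  assumes B: "bilinear B" and pos: "\<And>u. u \<noteq> 0 \<Longrightarrow> 0 < B u u" and r: "linear r"
  shows "\<exists>!\<xi>. \<forall>w. B \<xi> w = r w"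
proof -
  define T where "T \<xi> = (\<Sum>b\<in>Basis. B \<xi> b *\<^sub>R b)" for \<xi>
  have T: "linear T"
    unfolding T_def by (intro linearI)
      (simp_all add: bilinear_ladd[OF B] bilinear_lmul[OF B] scaleR_add_left sum.distrib scaleR_sum_right)
  have Tb: "T \<xi> \<bullet> b = B \<xi> b" if "b \<in> Basis" for \<xi> b
    using that by (simp add: T_def inner_sum_left inner_Basis if_distrib sum.delta cong: if_cong)
  have lin: "linear (B \<xi>)" for \<xi> using B by (simp add: bilinear_def)
  have "inj T"
  proof (subst linear_injective_0[OF T], intro allI impI)
    fix \<xi> assume "T \<xi> = 0"
    then have "B \<xi> b = 0" if "b \<in> Basis" for b using Tb[OF that] by (metis inner_zero_left)
    then have "B \<xi> = (\<lambda>_. 0)" by (intro linear_eq_stdbasis[OF lin linear_zero]) auto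
    then show "\<xi> = 0" using pos[of \<xi>] by (metis less_irrefl)
  qed
  then obtain \<xi> where "T \<xi> = (\<Sum>b\<in>Basis. r b *\<^sub>R b)"
    using eucl.linear_inj_imp_surj[OF T] by (metis surjD)
  then have "B \<xi> b = r b" if "b \<in> Basis" for b
    using Tb[OF that, of \<xi>] that by (simp add: inner_sum_left inner_Basis if_distrib sum.delta cong: if_cong)
  then have "B \<xi> = r" by (intro linear_eq_stdbasis[OF lin r])
  moreover have "\<xi>' = \<xi>" if "\<forall>w. B \<xi>' w = r w" for \<xi>'
  proof (rule ccontr)
    assume "\<xi>' \<noteq> \<xi>"
    moreover have "B (\<xi>' - \<xi>) (\<xi>' - \<xi>) = 0"
      using that \<open>B \<xi> = r\<close> by (simp add: bilinear_lsub[OF B])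
    ultimately show False using pos[of "\<xi>' - \<xi>"] by simp
  qed
  ultimately show ?thesis by blast
qed

lemma THE_bilinear_solution:
  fixes B :: "'a::euclidean_space \<Rightarrow> 'a \<Rightarrow> real"
  assumes "bilinear B" "\<And>u. u \<noteq> 0 \<Longrightarrow> 0 < B u u" "linear r"
  shows "B (THE \<xi>. \<forall>w. B \<xi> w = r w) w = r w"
  using theI'[OF bilinear_solution_ex1[OF assms]] by blast

lemma THE_bilinear_solution_eqI:
  fixes B :: "'a::euclidean_space \<Rightarrow> 'a \<Rightarrow> real"
  assumes "bilinear B" "\<And>u. u \<noteq> 0 \<Longrightarrow> 0 < B u u" "\<And>w. B \<xi> w = r w"
  shows "(THE \<xi>. \<forall>w. B \<xi> w = r w) = \<xi>"
proof -
  have "r = B \<xi>" using assms(3) by auto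
  then have "linear r" using assms(1) by (simp add: bilinear_def)
  then show ?thesis using bilinear_solution_ex1[OF assms(1,2)] assms(3) by (intro the1_equality) auto
qed

lemma positive_definite_cancel:
  fixes B :: "'a::euclidean_space \<Rightarrow> 'a \<Rightarrow> real"
  assumes B: "bilinear B" and "\<And>u. u \<noteq> 0 \<Longrightarrow> 0 < B u u" "\<And>w. B \<xi> w = B \<zeta> w"
  shows "\<xi> = \<zeta>"
  using THE_bilinear_solution_eqI[OF assms] THE_bilinear_solution_eqI[OF assms(1,2), of \<zeta> "B \<zeta>"] by simp

text \<open>The difference of the solutions at \<open>x\<close> and \<open>x0\<close> solves the
  system at \<open>x\<close> with right-hand side \<open>q x\<close>, which tends to 0. Uniform
  coercivity near \<open>x0\<close> carries this over to the solutions.\<close>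

lemma bilinear_solution_continuous:
  fixes B :: "'b::t2_space \<Rightarrow> 'a::euclidean_space \<Rightarrow> 'a \<Rightarrow> real"
  assumes S: "open S" "x0 \<in> S" and B: "\<And>x. x \<in> S \<Longrightarrow> bilinear (B x)"
    and pos: "\<And>u. u \<noteq> 0 \<Longrightarrow> 0 < B x0 u u"
    and Bc: "\<And>u v. continuous (at x0) (\<lambda>x. B x u v)"
    and rc: "\<And>w. continuous (at x0) (\<lambda>x. r x w)"
    and sol: "\<And>x w. x \<in> S \<Longrightarrow> B x (\<xi> x) w = r x w"
  shows "continuous (at x0) \<xi>"
proof -
  obtain c where c: "c > 0" "eventually (\<lambda>x. \<forall>u. c * (norm u)\<^sup>2 \<le> B x u u) (at x0)"
    using coercive_nearby[where B = B, OF S B pos Bc] by blast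
  define q where "q x w = r x w - B x (\<xi> x0) w" for x w
  have q0: "q x0 w = 0" for w using sol[OF S(2)] by (simp add: q_def)
  have "((\<lambda>x. (\<Sum>b\<in>Basis. \<bar>q x b\<bar>) / c) \<longlongrightarrow> (\<Sum>b\<in>(Basis::'a set). \<bar>q x0 b\<bar>) / c) (at x0)"
    unfolding q_def using Bc rc c(1) by (intro tendsto_intros) (auto simp: continuous_within)
  then have lim: "((\<lambda>x. (\<Sum>b\<in>Basis. \<bar>q x b\<bar>) / c) \<longlongrightarrow> 0) (at x0)" by (simp add: q0)
  moreover have "eventually (\<lambda>x. x \<in> S) (at x0)"
    using S by (rule eventually_at_in_open')
  with c(2) have "eventually (\<lambda>x. norm (\<xi> x - \<xi> x0) \<le> (\<Sum>b\<in>Basis. \<bar>q x b\<bar>) / c) (at x0)"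
  proof eventually_elim
    case (elim x)
    have e: "B x (\<xi> x - \<xi> x0) w = q x w" for w
      using sol[OF elim(2)] bilinear_lsub[OF B[OF elim(2)]] by (simp add: q_def)
    have "linear (B x (\<xi> x - \<xi> x0))" using B[OF elim(2)] by (simp add: bilinear_def)
    moreover have "q x = B x (\<xi> x - \<xi> x0)" using e by auto
    ultimately have "linear (q x)" by simp
    then show ?case using elim(1)
      by (intro norm_le_sum_if_coercive[where B = "B x", OF c(1)] e) auto
  qed
  ultimately have "((\<lambda>x. \<xi> x - \<xi> x0) \<longlongrightarrow> 0) (at x0)" by (rule Lim_null_comparison[rotated])
  then show ?thesis by (simp add: continuous_within LIM_zero_iff)
qed

text \<open>Product rule at a zero of the scalar factor: the increment of \<open>s\<close> is
  multiplied by a quantity of first order, so continuity of \<open>s\<close> suffices. This gains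
  one derivative for solutions of linear systems and handles coefficients known only to be
  continuous.\<close>

lemma has_derivative_scaleR_vanishing:
  fixes f :: "'a::real_normed_vector \<Rightarrow> real" and s :: "'a \<Rightarrow> 'b::real_normed_vector"
  assumes f: "(f has_derivative f') (at x0)" and "f x0 = 0" and s: "continuous (at x0) s"
  shows "((\<lambda>x. f x *\<^sub>R s x) has_derivative (\<lambda>v. f' v *\<^sub>R s x0)) (at x0)"
proof -
  have f'0: "bounded_linear f'" using f has_derivative_bounded_linear by blast
  then obtain K where K: "\<And>v. norm (f' v) \<le> norm v * K" using bounded_linear.bounded by blast
  define R where "R x = norm (f x - f' (x - x0)) / norm (x - x0)" for x
  have R: "(R \<longlongrightarrow> 0) (at x0)"
    using f \<open>f x0 = 0\<close> unfolding has_derivative_iff_norm R_def by simp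
  have "((\<lambda>x. f x *\<^sub>R (s x - s x0)) has_derivative (\<lambda>v. 0)) (at x0)"
    unfolding has_derivative_iff_norm
  proof (rule conjI[OF bounded_linear_zero])
    have "((\<lambda>x. (R x + K) * norm (s x - s x0)) \<longlongrightarrow> (0 + K) * norm (s x0 - s x0)) (at x0)"
      using s by (intro tendsto_intros R) (auto simp: continuous_within)
    then have "((\<lambda>x. (R x + K) * norm (s x - s x0)) \<longlongrightarrow> 0) (at x0)" by simp
    moreover have "norm (norm (f x *\<^sub>R (s x - s x0)) / norm (x - x0)) \<le> (R x + K) * norm (s x - s x0)" for x
    proof (cases "x = x0")
      case False
      have "\<bar>f x\<bar> \<le> norm (f x - f' (x - x0)) + norm (x - x0) * K"
        using K[of "x - x0"] by auto
      then have "\<bar>f x\<bar> / norm (x - x0) \<le> R x + K"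
        using False by (simp add: R_def field_simps)
      then have "\<bar>f x\<bar> / norm (x - x0) * norm (s x - s x0) \<le> (R x + K) * norm (s x - s x0)"
        by (rule mult_right_mono) simp
      then show ?thesis by simp
    qed simp
    ultimately have "((\<lambda>x. norm (f x *\<^sub>R (s x - s x0)) / norm (x - x0)) \<longlongrightarrow> 0) (at x0)"
      by (rule Lim_null_comparison[OF always_eventually[OF allI], rotated])
    then show "((\<lambda>x. norm (f x *\<^sub>R (s x - s x0) - f x0 *\<^sub>R (s x0 - s x0) - 0) / norm (x - x0)) \<longlongrightarrow> 0) (at x0)"
      by simp
  qed
  moreover have "((\<lambda>x. f x *\<^sub>R s x0) has_derivative (\<lambda>v. f' v *\<^sub>R s x0)) (at x0)"
    by (rule bounded_linear.has_derivative[OF bounded_linear_scaleR_left f])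
  ultimately have "((\<lambda>x. f x *\<^sub>R (s x - s x0) + f x *\<^sub>R s x0) has_derivative (\<lambda>v. 0 + f' v *\<^sub>R s x0)) (at x0)"
    by (rule has_derivative_add)
  then show ?thesis by (simp add: scaleR_diff_right)
qed

lemma linear_family_frechet_derivative:
  assumes "open S" "x0 \<in> S" "\<And>x. x \<in> S \<Longrightarrow> linear (A x)"
    and "\<And>w. (\<lambda>x. A x w) differentiable (at x0)"
  shows "linear (\<lambda>w. frechet_derivative (\<lambda>x. A x w) (at x0) v)"
proof (rule linearI)
  fix a b :: 'b
  have "frechet_derivative (\<lambda>x. A x (a + b)) (at x0) = frechet_derivative (\<lambda>x. A x a + A x b) (at x0)"
    by (rule frechet_derivative_cong_open[OF assms(1,2)]) (simp add: assms(3) linear_add)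
  also have "\<dots> = (\<lambda>v. frechet_derivative (\<lambda>x. A x a) (at x0) v + frechet_derivative (\<lambda>x. A x b) (at x0) v)"
    using assms(4)
    by (intro frechet_derivative_at[symmetric] has_derivative_add frechet_derivative_works[THEN iffD1])
  finally show "frechet_derivative (\<lambda>x. A x (a + b)) (at x0) v =
    frechet_derivative (\<lambda>x. A x a) (at x0) v + frechet_derivative (\<lambda>x. A x b) (at x0) v" by simp
next
  fix c and b :: 'b
  have "frechet_derivative (\<lambda>x. A x (c *\<^sub>R b)) (at x0) = frechet_derivative (\<lambda>x. c *\<^sub>R A x b) (at x0)"
    by (rule frechet_derivative_cong_open[OF assms(1,2)]) (simp add: assms(3) linear_cmul)
  also have "\<dots> = (\<lambda>v. c *\<^sub>R frechet_derivative (\<lambda>x. A x b) (at x0) v)"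
    using assms(4)
    by (intro frechet_derivative_at[symmetric] has_derivative_scaleR_right frechet_derivative_works[THEN iffD1])
  finally show "frechet_derivative (\<lambda>x. A x (c *\<^sub>R b)) (at x0) v =
    c *\<^sub>R frechet_derivative (\<lambda>x. A x b) (at x0) v" by simp
qed

text \<open>The solutions \<open>\<sigma> b\<close> for the right-hand sides
  \<open>w \<bullet> b\<close> play the role of the inverse matrix. Their derivative is the familiar
  - B^(-1) B' B^(-1), polynomial in the \<open>\<sigma>\<close> themselves and in derivatives of
  \<open>B\<close>, so each order of differentiability yields the next.\<close>

lemma bilinear_solution_Ck:
  fixes B :: "'b::real_normed_vector \<Rightarrow> 'a::euclidean_space \<Rightarrow> 'a \<Rightarrow> real"
  assumes S: "open S" and B: "\<And>x. x \<in> S \<Longrightarrow> bilinear (B x)"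
    and pos: "\<And>x u. x \<in> S \<Longrightarrow> u \<noteq> 0 \<Longrightarrow> 0 < B x u u"
    and Bs: "\<And>u v. smooth_on (\<lambda>x. B x u v) S"
    and sol: "\<And>x b w. x \<in> S \<Longrightarrow> b \<in> Basis \<Longrightarrow> B x (\<sigma> b x) w = w \<bullet> b"
  shows "b \<in> Basis \<Longrightarrow> Ck_on k (\<sigma> b) S"
proof (induction k arbitrary: b)
  case 0
  have "continuous (at x) (\<sigma> b)" if "x \<in> S" for x
  proof (rule bilinear_solution_continuous[where B = B and r = "\<lambda>x w. w \<bullet> b", OF S that B pos[OF that]])
    show "continuous (at x) (\<lambda>x. B x u v)" for u v
      using smooth_on_imp_continuous_on[OF Bs] S that by (simp add: continuous_on_eq_continuous_at)
  qed (use sol 0 in auto)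
  then show ?case by (simp add: continuous_at_imp_continuous_on)
next
  case (Suc k)
  define B' where "B' x v u w = frechet_derivative (\<lambda>x. B x u w) (at x) v" for x v u w
  have B'lin: "linear (\<lambda>u. B' x v u w)" if "x \<in> S" for x v w
    unfolding B'_def
    by (rule linear_family_frechet_derivative[OF S that, of "\<lambda>x u. B x u w"])
      (use B smooth_on_differentiable[OF Bs that] in \<open>auto simp: bilinear_def\<close>)
  have cont: "continuous (at x) (\<sigma> c)" if "x \<in> S" "c \<in> Basis" for x c
    using Ck_on_imp_continuous_on[OF Suc.IH[OF that(2)]] S that(1)
    by (simp add: continuous_on_eq_continuous_at)
  show ?case
  proof (rule Ck_on_SucI[OF S])
    fix x0 assume x0: "x0 \<in> S"
    \<comment> \<open>\<open>q c x\<close> is the defect of the old solution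
      \<open>\<sigma> b x0\<close> in the system at \<open>x\<close>. Correcting by the solutions at
      \<open>x\<close> gives \<open>\<sigma> b x\<close> exactly, and as the defect vanishes at
      \<open>x0\<close>, continuity of the \<open>\<sigma> c\<close> yields differentiability of
      \<open>\<sigma> b\<close>.\<close>
    define q where "q c x = c \<bullet> b - B x (\<sigma> b x0) c" for c x
    have "((\<lambda>x. q c x) has_derivative (\<lambda>v. 0 - B' x0 v (\<sigma> b x0) c)) (at x0)" for c
      unfolding q_def B'_def
      by (intro has_derivative_diff smooth_on_has_derivative[OF Bs x0] has_derivative_const)
    moreover have "q c x0 = 0" if "c \<in> Basis" for c
      using sol[OF x0 Suc.prems] by (simp add: q_def)
    ultimately have "((\<lambda>x. \<sigma> b x0 + (\<Sum>c\<in>Basis. q c x *\<^sub>R \<sigma> c x)) has_derivative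
        (\<lambda>v. 0 + (\<Sum>c\<in>Basis. (0 - B' x0 v (\<sigma> b x0) c) *\<^sub>R \<sigma> c x0))) (at x0)"
      by (intro has_derivative_add has_derivative_const has_derivative_sum
          has_derivative_scaleR_vanishing cont[OF x0])
    moreover have "\<sigma> b x0 + (\<Sum>c\<in>Basis. q c x *\<^sub>R \<sigma> c x) = \<sigma> b x" if x: "x \<in> S" for x
    proof (rule positive_definite_cancel[where B = "B x", OF B[OF x] pos[OF x]])
      fix w
      have l: "linear (\<lambda>u. B x u w)" "linear (B x (\<sigma> b x0))" using B[OF x] by (auto simp: bilinear_def)
      have "B x (\<sigma> b x0 + (\<Sum>c\<in>Basis. q c x *\<^sub>R \<sigma> c x)) w
          = B x (\<sigma> b x0) w + (\<Sum>c\<in>Basis. q c x * (w \<bullet> c))"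
        by (simp add: linear_add[OF l(1)] linear_sum[OF l(1)] linear_cmul[OF l(1)] sol[OF x])
      also have "(\<Sum>c\<in>Basis. q c x * (w \<bullet> c)) =
          (\<Sum>c\<in>Basis. (c \<bullet> b) * (w \<bullet> c)) - (\<Sum>c\<in>Basis. (w \<bullet> c) *\<^sub>R B x (\<sigma> b x0) c)"
        by (simp add: q_def sum_subtractf algebra_simps)
      also have "(\<Sum>c\<in>Basis. (w \<bullet> c) *\<^sub>R B x (\<sigma> b x0) c) = B x (\<sigma> b x0) w"
        by (rule linear_expand[OF l(2), symmetric])
      also have "(\<Sum>c\<in>Basis. (c \<bullet> b) * (w \<bullet> c)) = w \<bullet> b"
        by (subst euclidean_inner[of w b]) (simp add: inner_commute mult.commute)
      finally show "B x (\<sigma> b x0 + (\<Sum>c\<in>Basis. q c x *\<^sub>R \<sigma> c x)) w = B x (\<sigma> b x) w"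
        by (simp add: sol[OF x Suc.prems])
    qed auto
    ultimately have "(\<sigma> b has_derivative
        (\<lambda>v. 0 + (\<Sum>c\<in>Basis. (0 - B' x0 v (\<sigma> b x0) c) *\<^sub>R \<sigma> c x0))) (at x0)"
      by (rule has_derivative_transform_within_open[OF _ S x0])
    then show "(\<sigma> b has_derivative
        (\<lambda>v. - (\<Sum>c\<in>Basis. (\<Sum>i\<in>Basis. (\<sigma> b x0 \<bullet> i) *\<^sub>R B' x0 v i c) *\<^sub>R \<sigma> c x0))) (at x0)"
      by (simp add: sum_negf linear_expand[OF B'lin[OF x0], of _ "\<sigma> b x0"])
  next
    fix v
    have "Ck_on k (\<lambda>x. B' x v i c) S" for i c
      using smooth_on_frechet_derivative[OF Bs] unfolding B'_def smooth_on_def by blast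
    then show "Ck_on k (\<lambda>x. - (\<Sum>c\<in>Basis. (\<Sum>i\<in>Basis. (\<sigma> b x \<bullet> i) *\<^sub>R B' x v i c) *\<^sub>R \<sigma> c x)) S"
      by (intro Ck_on_bounded_linear[OF bounded_linear_minus[OF bounded_linear_ident] S] Ck_on_sum[OF S]
          Ck_on_bounded_bilinear[OF bounded_bilinear_scaleR S]
          Ck_on_bounded_linear[OF bounded_linear_inner_left S] Suc)
  qed
qed

text \<open>By linearity the solution is the combination of the \<open>\<sigma> b\<close> with
  coefficients \<open>r x b\<close>, so smoothness of the right-hand side is all that is added to
  the previous result.\<close>

lemma smooth_on_bilinear_solution:
  fixes B :: "'b::real_normed_vector \<Rightarrow> 'a::euclidean_space \<Rightarrow> 'a \<Rightarrow> real"
  assumes S: "open S" and B: "\<And>x. x \<in> S \<Longrightarrow> bilinear (B x)"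
    and pos: "\<And>x u. x \<in> S \<Longrightarrow> u \<noteq> 0 \<Longrightarrow> 0 < B x u u"
    and Bs: "\<And>u v. smooth_on (\<lambda>x. B x u v) S"
    and rs: "\<And>w. smooth_on (\<lambda>x. r x w) S"
    and sol: "\<And>x w. x \<in> S \<Longrightarrow> B x (\<xi> x) w = r x w"
  shows "smooth_on \<xi> S"
proof -
  define \<sigma> where "\<sigma> b x = (THE \<xi>. \<forall>w. B x \<xi> w = w \<bullet> b)" for b x
  have \<sigma>: "B x (\<sigma> b x) w = w \<bullet> b" if "x \<in> S" for x b w
    unfolding \<sigma>_def by (rule THE_bilinear_solution[where B = "B x", OF B[OF that] pos[OF that]])
      (auto intro: bounded_linear.linear bounded_linear_inner_left)
  have "smooth_on (\<sigma> b) S" if "b \<in> Basis" for b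
    using bilinear_solution_Ck[where B = B and \<sigma> = \<sigma>, OF S B pos Bs \<sigma> that] by (auto simp: smooth_on_def)
  then have "smooth_on (\<lambda>x. \<Sum>b\<in>Basis. r x b *\<^sub>R \<sigma> b x) S"
    by (intro smooth_intros S rs) auto
  moreover have "(\<Sum>b\<in>Basis. r x b *\<^sub>R \<sigma> b x) = \<xi> x" if x: "x \<in> S" for x
  proof (rule positive_definite_cancel[where B = "B x", OF B[OF x] pos[OF x]])
    fix w
    have l: "linear (\<lambda>u. B x u w)" "linear (B x (\<xi> x))" using B[OF x] by (auto simp: bilinear_def)
    have "B x (\<Sum>b\<in>Basis. r x b *\<^sub>R \<sigma> b x) w = (\<Sum>b\<in>Basis. (w \<bullet> b) *\<^sub>R B x (\<xi> x) b)"
      by (simp add: linear_sum[OF l(1)] linear_cmul[OF l(1)] \<sigma>[OF x] sol[OF x] mult.commute)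
    then show "B x (\<Sum>b\<in>Basis. r x b *\<^sub>R \<sigma> b x) w = B x (\<xi> x) w"
      by (simp only: linear_expand[OF l(2), of w])
  qed auto
  ultimately show ?thesis by (rule smooth_on_transform[OF S])
qed

section \<open>Linear and bilinear maps depending on a parameter\<close>

lemma smooth_on_linear_family:
  fixes A :: "'b::euclidean_space \<Rightarrow> 'a::euclidean_space \<Rightarrow> 'c::real_normed_vector"
  assumes S: "open S" and A: "\<And>x. x \<in> T \<Longrightarrow> linear (A x)"
    and "\<And>u. smooth_on (\<lambda>x. A x u) T" "smooth_on k S" "k ` S \<subseteq> T" "smooth_on f S"
  shows "smooth_on (\<lambda>z. A (k z) (f z)) S"
proof -
  have "smooth_on (\<lambda>z. A (k z) i) S" for i
    by (rule smooth_on_compose[of S "\<lambda>x. A x i" T k]) (use assms in auto)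
  then have "smooth_on (\<lambda>z. \<Sum>i\<in>Basis. (f z \<bullet> i) *\<^sub>R A (k z) i) S"
    using assms(6) by (intro smooth_intros S)
  moreover have "(\<Sum>i\<in>Basis. (f z \<bullet> i) *\<^sub>R A (k z) i) = A (k z) (f z)" if "z \<in> S" for z
    using linear_expand[OF A[of "k z"], of "f z"] that assms(5) by auto
  ultimately show ?thesis by (rule smooth_on_transform[OF S])
qed

text \<open>The map \<open>k\<close> selects the base point: the identity, or \<open>fst\<close>
  when tensors on \<open>U\<close> are evaluated on vectors that depend on position and
  direction.\<close>

lemma smooth_on_bilinear_family:
  fixes B :: "'b::euclidean_space \<Rightarrow> 'a::euclidean_space \<Rightarrow> 'd::euclidean_space \<Rightarrow> 'c::real_normed_vector"
  assumes S: "open S" and B: "\<And>x. x \<in> T \<Longrightarrow> bilinear (B x)"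
    and "\<And>u v. smooth_on (\<lambda>x. B x u v) T" "smooth_on k S" "k ` S \<subseteq> T" "smooth_on f S" "smooth_on g S"
  shows "smooth_on (\<lambda>z. B (k z) (f z) (g z)) S"
proof -
  have "smooth_on (\<lambda>z. B (k z) i (g z)) S" for i
    by (rule smooth_on_linear_family[of S T "\<lambda>x. B x i" k]) (use assms in \<open>auto simp: bilinear_def\<close>)
  then have "smooth_on (\<lambda>z. \<Sum>i\<in>Basis. (f z \<bullet> i) *\<^sub>R B (k z) i (g z)) S"
    using assms(6) by (intro smooth_intros S)
  moreover have "(\<Sum>i\<in>Basis. (f z \<bullet> i) *\<^sub>R B (k z) i (g z)) = B (k z) (f z) (g z)" if "z \<in> S" for z
    using linear_expand[of "\<lambda>u. B (k z) u (g z)" "f z"] B[of "k z"] that assms(5)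
    by (auto simp: bilinear_def)
  ultimately show ?thesis by (rule smooth_on_transform[OF S])
qed

text \<open>Product rule for a family whose regularity is known vector by vector: the first term
  differentiates \<open>A\<close> with the vector frozen at \<open>f x0\<close>. Expansion in the
  basis reduces it to finitely many such vectors.\<close>

lemma has_derivative_linear_family:
  fixes A :: "'b::real_normed_vector \<Rightarrow> 'a::euclidean_space \<Rightarrow> 'c::real_normed_vector"
  assumes S: "open S" "x0 \<in> S" and A: "\<And>x. x \<in> S \<Longrightarrow> linear (A x)"
    and d: "\<And>w. (\<lambda>x. A x w) differentiable (at x0)" and f: "(f has_derivative f') (at x0)"
  shows "((\<lambda>x. A x (f x)) has_derivative
    (\<lambda>v. frechet_derivative (\<lambda>x. A x (f x0)) (at x0) v + A x0 (f' v))) (at x0)"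
proof -
  have "((\<lambda>x. \<Sum>i\<in>Basis. (f x \<bullet> i) *\<^sub>R A x i) has_derivative
     (\<lambda>v. \<Sum>i\<in>Basis. (f x0 \<bullet> i) *\<^sub>R frechet_derivative (\<lambda>x. A x i) (at x0) v + (f' v \<bullet> i) *\<^sub>R A x0 i)) (at x0)"
    by (intro has_derivative_sum has_derivative_scaleR has_derivative_inner_left f
        frechet_derivative_works[THEN iffD1] d)
  then have "((\<lambda>x. A x (f x)) has_derivative
     (\<lambda>v. \<Sum>i\<in>Basis. (f x0 \<bullet> i) *\<^sub>R frechet_derivative (\<lambda>x. A x i) (at x0) v + (f' v \<bullet> i) *\<^sub>R A x0 i)) (at x0)"
    by (rule has_derivative_transform_within_open[OF _ S]) (rule linear_expand[OF A, symmetric])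
  then show ?thesis
    by (simp add: sum.distrib linear_expand[OF A[OF S(2)], of "f' _"]
        linear_expand[OF linear_family_frechet_derivative[OF S A d], of "f x0"])
qed

lemma has_derivative_bilinear_family:
  fixes B :: "'b::real_normed_vector \<Rightarrow> 'a::euclidean_space \<Rightarrow> 'd::euclidean_space \<Rightarrow> 'c::real_normed_vector"
  assumes S: "open S" "x0 \<in> S" and B: "\<And>x. x \<in> S \<Longrightarrow> bilinear (B x)"
    and d: "\<And>u w. (\<lambda>x. B x u w) differentiable (at x0)"
    and f: "(f has_derivative f') (at x0)" and g: "(g has_derivative g') (at x0)"
  shows "((\<lambda>x. B x (f x) (g x)) has_derivative
    (\<lambda>v. frechet_derivative (\<lambda>x. B x (f x0) (g x0)) (at x0) v + B x0 (f' v) (g x0) + B x0 (f x0) (g' v))) (at x0)"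
proof -
  have 1: "((\<lambda>x. B x u (g x)) has_derivative
    (\<lambda>v. frechet_derivative (\<lambda>x. B x u (g x0)) (at x0) v + B x0 u (g' v))) (at x0)" for u
    using B by (intro has_derivative_linear_family[OF S _ d g]) (auto simp: bilinear_def)
  have "((\<lambda>x. B x (f x) (g x)) has_derivative
    (\<lambda>v. frechet_derivative (\<lambda>x. B x (f x0) (g x)) (at x0) v + B x0 (f' v) (g x0))) (at x0)"
    using B differentiableI[OF 1]
    by (intro has_derivative_linear_family[OF S _ _ f, of "\<lambda>x u. B x u (g x)"]) (auto simp: bilinear_def)
  then show ?thesis by (simp add: frechet_derivative_eqI[OF 1] add_ac)
qed

section \<open>Functions of position and direction\<close>

locale slit_bundle =
  fixes U :: "'e::euclidean_space set"
  assumes open_U: "open U"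
begin

definition W :: "('e \<times> 'e) set" where "W = U \<times> (- {0})"

lemma open_W: "open W"
  unfolding W_def by (intro open_Times open_U) auto

lemma in_W: "z \<in> W \<longleftrightarrow> fst z \<in> U \<and> snd z \<noteq> 0"
  by (simp add: W_def mem_Times_iff)

text \<open>Off the zero section, since norms are not differentiable there; jointly rather than
  separately, so that position and direction derivatives commute.\<close>

definition smooth2 :: "('e \<Rightarrow> 'e \<Rightarrow> 'b::real_normed_vector) \<Rightarrow> bool" where
  "smooth2 Z \<longleftrightarrow> smooth_on (\<lambda>z. Z (fst z) (snd z)) W"

context
  fixes Z :: "'e \<Rightarrow> 'e \<Rightarrow> 'b::euclidean_space" and x y :: 'e
  assumes Z: "smooth2 Z" and x: "x \<in> U" and y: "y \<noteq> 0"
begin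

lemma has_derivative_pair:
  "((\<lambda>z. Z (fst z) (snd z)) has_derivative frechet_derivative (\<lambda>z. Z (fst z) (snd z)) (at (x, y))) (at (x, y))"
  using smooth_on_has_derivative[OF Z[unfolded smooth2_def], of "(x, y)"] x y by (simp add: W_def)

lemma has_derivative_pos_aux:
  "((\<lambda>x. Z x y) has_derivative (\<lambda>u. frechet_derivative (\<lambda>z. Z (fst z) (snd z)) (at (x, y)) (u, 0))) (at x)"
proof -
  have "((\<lambda>x. (x, y)) has_derivative (\<lambda>u. (u, 0))) (at x)" by (auto intro!: derivative_eq_intros)
  from diff_chain_at[OF this has_derivative_pair] show ?thesis by (simp add: o_def)
qed

lemma has_derivative_vert_aux:
  "((\<lambda>y. Z x y) has_derivative (\<lambda>u. frechet_derivative (\<lambda>z. Z (fst z) (snd z)) (at (x, y)) (0, u))) (at y)"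
proof -
  have "((\<lambda>y. (x, y)) has_derivative (\<lambda>u. (0, u))) (at y)" by (auto intro!: derivative_eq_intros)
  from diff_chain_at[OF this has_derivative_pair] show ?thesis by (simp add: o_def)
qed

lemma pos_deriv_eq: "pos_deriv Z x y u = frechet_derivative (\<lambda>z. Z (fst z) (snd z)) (at (x, y)) (u, 0)"
  unfolding pos_deriv_def by (rule frechet_derivative_eqI[OF has_derivative_pos_aux])

lemma vert_deriv_eq: "vert_deriv Z x y u = frechet_derivative (\<lambda>z. Z (fst z) (snd z)) (at (x, y)) (0, u)"
  unfolding vert_deriv_def by (rule frechet_derivative_eqI[OF has_derivative_vert_aux])

lemma has_derivative_pos: "((\<lambda>x. Z x y) has_derivative pos_deriv Z x y) (at x)"
  using has_derivative_pos_aux unfolding pos_deriv_eq[symmetric] .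

lemma has_derivative_vert: "((\<lambda>y. Z x y) has_derivative vert_deriv Z x y) (at y)"
  using has_derivative_vert_aux unfolding vert_deriv_eq[symmetric] .

lemma linear_pos_deriv: "linear (pos_deriv Z x y)"
  by (rule has_derivative_linear[OF has_derivative_pos])

lemma linear_vert_deriv: "linear (vert_deriv Z x y)"
  by (rule has_derivative_linear[OF has_derivative_vert])

end

lemma pos_derivI: "((\<lambda>x. Z x y) has_derivative D) (at x) \<Longrightarrow> pos_deriv Z x y u = D u"
  unfolding pos_deriv_def by (rule frechet_derivative_eqI)

lemma vert_derivI: "((\<lambda>y. Z x y) has_derivative D) (at y) \<Longrightarrow> vert_deriv Z x y u = D u"
  unfolding vert_deriv_def by (rule frechet_derivative_eqI)

lemma pos_deriv_cong:
  "x \<in> U \<Longrightarrow> (\<And>x. x \<in> U \<Longrightarrow> Z x y = Z' x y) \<Longrightarrow> pos_deriv Z x y = pos_deriv Z' x y"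
  unfolding pos_deriv_def by (rule frechet_derivative_cong_open[OF open_U])

lemma vert_deriv_cong:
  "y \<noteq> 0 \<Longrightarrow> (\<And>y. y \<noteq> 0 \<Longrightarrow> Z x y = Z' x y) \<Longrightarrow> vert_deriv Z x y = vert_deriv Z' x y"
  unfolding vert_deriv_def by (rule frechet_derivative_cong_open[of "- {0}"]) auto

lemma smooth2_cong:
  "smooth2 Z \<Longrightarrow> (\<And>x y. x \<in> U \<Longrightarrow> y \<noteq> 0 \<Longrightarrow> Z x y = Z' x y) \<Longrightarrow> smooth2 Z'"
  unfolding smooth2_def by (erule smooth_on_transform[OF open_W]) (simp add: in_W)

lemma smooth2_pos_deriv:
  fixes Z :: "'e \<Rightarrow> 'e \<Rightarrow> 'b::euclidean_space"
  assumes "smooth2 Z" shows "smooth2 (\<lambda>x y. pos_deriv Z x y u)"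
  unfolding smooth2_def
  by (rule smooth_on_transform[OF open_W smooth_on_frechet_derivative[OF assms[unfolded smooth2_def], of "(u, 0)"]])
    (simp add: in_W pos_deriv_eq[OF assms])

lemma smooth2_vert_deriv:
  fixes Z :: "'e \<Rightarrow> 'e \<Rightarrow> 'b::euclidean_space"
  assumes "smooth2 Z" shows "smooth2 (\<lambda>x y. vert_deriv Z x y u)"
  unfolding smooth2_def
  by (rule smooth_on_transform[OF open_W smooth_on_frechet_derivative[OF assms[unfolded smooth2_def], of "(0, u)"]])
    (simp add: in_W vert_deriv_eq[OF assms])

lemma second_pair_derivative:
  fixes Z :: "'e \<Rightarrow> 'e \<Rightarrow> 'b::euclidean_space"
  assumes Z: "smooth2 Z" and x: "x \<in> U" "y \<noteq> 0"
    and Y: "smooth2 Y" "\<And>x y. x \<in> U \<Longrightarrow> y \<noteq> 0 \<Longrightarrow> Y x y = frechet_derivative (\<lambda>z. Z (fst z) (snd z)) (at (x, y)) a"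
  shows "frechet_derivative (\<lambda>z. Y (fst z) (snd z)) (at (x, y)) b =
     frechet_derivative (\<lambda>z. frechet_derivative (\<lambda>z. Z (fst z) (snd z)) (at z) a) (at (x, y)) b"
  by (rule fun_cong[OF frechet_derivative_cong_open[OF open_W]]) (use x Y(2) in \<open>simp_all add: in_W\<close>)

context
  fixes Z :: "'e \<Rightarrow> 'e \<Rightarrow> 'b::euclidean_space" and x y :: 'e
  assumes Z: "smooth2 Z" and x: "x \<in> U" and y: "y \<noteq> 0"
begin

private lemma sym: "frechet_derivative (\<lambda>z. frechet_derivative (\<lambda>z. Z (fst z) (snd z)) (at z) a) (at (x, y)) b
   = frechet_derivative (\<lambda>z. frechet_derivative (\<lambda>z. Z (fst z) (snd z)) (at z) b) (at (x, y)) a"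
  by (rule second_derivative_symmetric[OF open_W Z[unfolded smooth2_def]]) (use x y in \<open>simp add: W_def\<close>)

text \<open>Both sides are second derivatives of the uncurried map, in the directions
  \<open>(u, 0)\<close> and \<open>(0, v)\<close>.\<close>

lemma pos_vert_commute:
  "pos_deriv (\<lambda>x y. vert_deriv Z x y v) x y u = vert_deriv (\<lambda>x y. pos_deriv Z x y u) x y v"
  by (simp add: pos_deriv_eq[OF smooth2_vert_deriv[OF Z] x y] vert_deriv_eq[OF smooth2_pos_deriv[OF Z] x y]
      second_pair_derivative[OF Z x y smooth2_vert_deriv[OF Z] vert_deriv_eq[OF Z]]
      second_pair_derivative[OF Z x y smooth2_pos_deriv[OF Z] pos_deriv_eq[OF Z]] sym[of "(u,0)"])

lemma vert_vert_commute:
  "vert_deriv (\<lambda>x y. vert_deriv Z x y v) x y u = vert_deriv (\<lambda>x y. vert_deriv Z x y u) x y v"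
  by (simp add: vert_deriv_eq[OF smooth2_vert_deriv[OF Z] x y]
      second_pair_derivative[OF Z x y smooth2_vert_deriv[OF Z] vert_deriv_eq[OF Z]] sym[of "(0,u)"])

lemma pos_pos_commute:
  "pos_deriv (\<lambda>x y. pos_deriv Z x y v) x y u = pos_deriv (\<lambda>x y. pos_deriv Z x y u) x y v"
  by (simp add: pos_deriv_eq[OF smooth2_pos_deriv[OF Z] x y]
      second_pair_derivative[OF Z x y smooth2_pos_deriv[OF Z] pos_deriv_eq[OF Z]] sym[of "(u,0)"])

text \<open>The inner direction \<open>f y'\<close> is frozen while the outer derivative is taken;
  the separate name \<open>y'\<close>, equal to \<open>y\<close>, keeps it from being captured by
  the bound variable.\<close>

lemma has_derivative_vert_pos:
  assumes "(f has_derivative f') (at y)" and that: "y' = y"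
  shows "((\<lambda>y. pos_deriv Z x y (f y)) has_derivative
    (\<lambda>v. vert_deriv (\<lambda>x y. pos_deriv Z x y (f y')) x y v + pos_deriv Z x y (f' v))) (at y)"
  using has_derivative_linear_family[of "- {0}" y "\<lambda>y. pos_deriv Z x y" f f', OF _ _ linear_pos_deriv[OF Z x]
      differentiableI[OF has_derivative_vert[OF smooth2_pos_deriv[OF Z] x y]] assms(1)] y
  unfolding that vert_deriv_def[of "\<lambda>x y. pos_deriv Z x y (f _)"] by auto

lemma has_derivative_pos_vert:
  assumes "(f has_derivative f') (at x)" and that: "x' = x"
  shows "((\<lambda>x. vert_deriv Z x y (f x)) has_derivative
    (\<lambda>v. pos_deriv (\<lambda>x y. vert_deriv Z x y (f x')) x y v + vert_deriv Z x y (f' v))) (at x)"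
  using has_derivative_linear_family[of U x "\<lambda>x. vert_deriv Z x y" f f', OF open_U x linear_vert_deriv[OF Z _ y]
      differentiableI[OF has_derivative_pos[OF smooth2_vert_deriv[OF Z] x y]] assms(1)]
  unfolding that pos_deriv_def[of "\<lambda>x y. vert_deriv Z x y (f _)"] by simp

lemma has_derivative_vert_vert:
  assumes "(f has_derivative f') (at y)" and that: "y' = y"
  shows "((\<lambda>y. vert_deriv Z x y (f y)) has_derivative
    (\<lambda>v. vert_deriv (\<lambda>x y. vert_deriv Z x y (f y')) x y v + vert_deriv Z x y (f' v))) (at y)"
  using has_derivative_linear_family[of "- {0}" y "\<lambda>y. vert_deriv Z x y" f f', OF _ _ linear_vert_deriv[OF Z x]
      differentiableI[OF has_derivative_vert[OF smooth2_vert_deriv[OF Z] x y]] assms(1)] y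
  unfolding that vert_deriv_def[of "\<lambda>x y. vert_deriv Z x y (f _)"] by auto

end

lemma smooth2_pos_deriv_dir:
  fixes Z :: "'e \<Rightarrow> 'e \<Rightarrow> 'b::euclidean_space"
  assumes Z: "smooth2 Z" and f: "smooth2 f"
  shows "smooth2 (\<lambda>x y. pos_deriv Z x y (f x y))"
  unfolding smooth2_def
  by (rule smooth_on_linear_family[of W W "\<lambda>z. pos_deriv Z (fst z) (snd z)" "\<lambda>z. z"])
    (use linear_pos_deriv[OF Z] smooth2_pos_deriv[OF Z] f in \<open>simp_all add: open_W smooth_on_id smooth2_def in_W\<close>)

lemma smooth2_vert_deriv_dir:
  fixes Z :: "'e \<Rightarrow> 'e \<Rightarrow> 'b::euclidean_space"
  assumes Z: "smooth2 Z" and f: "smooth2 f"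
  shows "smooth2 (\<lambda>x y. vert_deriv Z x y (f x y))"
  unfolding smooth2_def
  by (rule smooth_on_linear_family[of W W "\<lambda>z. vert_deriv Z (fst z) (snd z)" "\<lambda>z. z"])
    (use linear_vert_deriv[OF Z] smooth2_vert_deriv[OF Z] f in \<open>simp_all add: open_W smooth_on_id smooth2_def in_W\<close>)

lemma smooth2_snd: "smooth2 (\<lambda>x y. y)"
  unfolding smooth2_def by (intro smooth_intros open_W)

text \<open>Positive factors only, because a Randers norm is in general not even in
  \<open>y\<close>.\<close>

definition homogeneous :: "nat \<Rightarrow> ('e \<Rightarrow> 'e \<Rightarrow> 'b::real_normed_vector) \<Rightarrow> bool" where
  "homogeneous n Z \<longleftrightarrow> (\<forall>x\<in>U. \<forall>y c. y \<noteq> 0 \<longrightarrow> c > 0 \<longrightarrow> Z x (c *\<^sub>R y) = c ^ n *\<^sub>R Z x y)"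

lemma homogeneousD:
  "homogeneous n Z \<Longrightarrow> x \<in> U \<Longrightarrow> y \<noteq> 0 \<Longrightarrow> c > 0 \<Longrightarrow> Z x (c *\<^sub>R y) = c ^ n *\<^sub>R Z x y"
  unfolding homogeneous_def by blast

text \<open>The function \<open>c \<mapsto> Z x (c y)\<close> is differentiated at
  \<open>c = 1\<close>, once by the chain rule and once as a power of \<open>c\<close>.\<close>

lemma euler:
  fixes Z :: "'e \<Rightarrow> 'e \<Rightarrow> 'b::euclidean_space"
  assumes Z: "smooth2 Z" "homogeneous n Z" and x: "x \<in> U" "y \<noteq> 0"
  shows "vert_deriv Z x y y = real n *\<^sub>R Z x y"
proof -
  have 1: "((\<lambda>c. c *\<^sub>R y) has_derivative (\<lambda>k. k *\<^sub>R y)) (at (1::real))"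
    by (auto intro!: derivative_eq_intros)
  have "((\<lambda>c. Z x (c *\<^sub>R y)) has_derivative (\<lambda>k. vert_deriv Z x y (k *\<^sub>R y))) (at (1::real))"
    using diff_chain_at[OF 1, of "Z x" "vert_deriv Z x y"] has_derivative_vert[OF Z(1) x] by (simp add: o_def)
  moreover have "((\<lambda>c. c ^ n *\<^sub>R Z x y) has_derivative (\<lambda>k. (real n * k) *\<^sub>R Z x y)) (at (1::real))"
    by (auto intro!: derivative_eq_intros)
  then have "((\<lambda>c. Z x (c *\<^sub>R y)) has_derivative (\<lambda>k. (real n * k) *\<^sub>R Z x y)) (at (1::real))"
    by (rule has_derivative_transform_within_open[of _ _ _ _ "{0<..}"])
      (auto simp: homogeneousD[OF Z(2) x])
  ultimately have "(\<lambda>k. vert_deriv Z x y (k *\<^sub>R y)) = (\<lambda>k. (real n * k) *\<^sub>R Z x y)"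
    by (rule has_derivative_unique)
  from fun_cong[OF this, of 1] show ?thesis by simp
qed

lemma homogeneous_pos_deriv:
  fixes Z :: "'e \<Rightarrow> 'e \<Rightarrow> 'b::euclidean_space"
  assumes Z: "smooth2 Z" "homogeneous n Z"
  shows "homogeneous n (\<lambda>x y. pos_deriv Z x y u)"
  unfolding homogeneous_def
proof (intro ballI allI impI)
  fix x y :: 'e and c :: real assume x: "x \<in> U" "y \<noteq> 0" "c > 0"
  have "((\<lambda>x. c ^ n *\<^sub>R Z x y) has_derivative (\<lambda>u. c ^ n *\<^sub>R pos_deriv Z x y u)) (at x)"
    by (rule has_derivative_scaleR_right[OF has_derivative_pos[OF Z(1) x(1,2)]])
  then have "((\<lambda>x. Z x (c *\<^sub>R y)) has_derivative (\<lambda>u. c ^ n *\<^sub>R pos_deriv Z x y u)) (at x)"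
    by (rule has_derivative_transform_within_open[OF _ open_U x(1)]) (simp add: homogeneousD[OF Z(2) _ x(2,3)])
  then show "pos_deriv Z x (c *\<^sub>R y) u = c ^ n *\<^sub>R pos_deriv Z x y u" by (rule pos_derivI)
qed

lemma homogeneous_vert_deriv:
  fixes Z :: "'e \<Rightarrow> 'e \<Rightarrow> 'b::euclidean_space"
  assumes Z: "smooth2 Z" "homogeneous (Suc n) Z"
  shows "homogeneous n (\<lambda>x y. vert_deriv Z x y u)"
  unfolding homogeneous_def
proof (intro ballI allI impI)
  fix x y :: 'e and c :: real assume x: "x \<in> U" "y \<noteq> 0" "c > 0"
  have 1: "((\<lambda>y. c *\<^sub>R y) has_derivative (\<lambda>k. c *\<^sub>R k)) (at y)"
    by (auto intro!: derivative_eq_intros)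
  have cy: "c *\<^sub>R y \<noteq> 0" using x by simp
  have "((\<lambda>y. Z x (c *\<^sub>R y)) has_derivative (\<lambda>k. vert_deriv Z x (c *\<^sub>R y) (c *\<^sub>R k))) (at y)"
    using diff_chain_at[OF 1, of "Z x" "vert_deriv Z x (c *\<^sub>R y)"] has_derivative_vert[OF Z(1) x(1) cy]
    by (simp add: o_def)
  moreover have "((\<lambda>y. c ^ Suc n *\<^sub>R Z x y) has_derivative (\<lambda>k. c ^ Suc n *\<^sub>R vert_deriv Z x y k)) (at y)"
    by (rule has_derivative_scaleR_right[OF has_derivative_vert[OF Z(1) x(1,2)]])
  then have "((\<lambda>y. Z x (c *\<^sub>R y)) has_derivative (\<lambda>k. c ^ Suc n *\<^sub>R vert_deriv Z x y k)) (at y)"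
    by (rule has_derivative_transform_within_open[of _ _ _ _ "- {0}"])
      (use x in \<open>auto simp: homogeneousD[OF Z(2) x(1) _ x(3)]\<close>)
  ultimately have "(\<lambda>k. vert_deriv Z x (c *\<^sub>R y) (c *\<^sub>R k)) = (\<lambda>k. c ^ Suc n *\<^sub>R vert_deriv Z x y k)"
    by (rule has_derivative_unique)
  then have "vert_deriv Z x (c *\<^sub>R y) (c *\<^sub>R u) = c ^ Suc n *\<^sub>R vert_deriv Z x y u" by (rule fun_cong)
  then have "c *\<^sub>R vert_deriv Z x (c *\<^sub>R y) u = c *\<^sub>R (c ^ n *\<^sub>R vert_deriv Z x y u)"
    by (simp add: linear_cmul[OF linear_vert_deriv[OF Z(1) x(1) cy]])
  then show "vert_deriv Z x (c *\<^sub>R y) u = c ^ n *\<^sub>R vert_deriv Z x y u"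
    using x(3) by (metis scaleR_cancel_left less_irrefl)
qed

lemma deriv_along_line:
  fixes f :: "'e \<Rightarrow> real"
  assumes "(f has_derivative f') (at a)"
  shows "deriv (\<lambda>t. f (a + t *\<^sub>R v)) 0 = f' v"
  using DERIV_imp_deriv[OF has_real_derivative_along_line[of f f' a 0 v]] assms by simp

end

section \<open>Finsler metrics on open sets\<close>

text \<open>Kept apart from \<open>finsler\<close> because for a Randers norm the positivity of the
  fundamental tensor is proved from its explicit formula, and that formula already rests on
  \<open>fund_tensor_eq\<close>.\<close>

locale smooth_energy = slit_bundle U for U :: "'e::euclidean_space set" +
  fixes L :: "'e \<Rightarrow> 'e \<Rightarrow> real"
  assumes smooth2_energy: "smooth2 (\<lambda>x y. (L x y)\<^sup>2)"
begin

abbreviation E :: "'e \<Rightarrow> 'e \<Rightarrow> real" where "E \<equiv> \<lambda>x y. (L x y)\<^sup>2"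
abbreviation Ev :: "'e \<Rightarrow> 'e \<Rightarrow> 'e \<Rightarrow> real" where "Ev w \<equiv> \<lambda>x y. vert_deriv E x y w"

lemma smooth2_Ev: "smooth2 (Ev w)"
  by (rule smooth2_vert_deriv[OF smooth2_energy])

lemma fund_tensor_eq:
  assumes x: "x \<in> U" "y \<noteq> 0"
  shows "fund_tensor L x y u v = vert_deriv (Ev v) x y u / 2"
proof -
  have inner: "deriv (\<lambda>t. (L x (y + s *\<^sub>R u + t *\<^sub>R v))\<^sup>2) 0 = Ev v x (y + s *\<^sub>R u)"
    if "y + s *\<^sub>R u \<noteq> 0" for s
    by (rule deriv_along_line[OF has_derivative_vert[OF smooth2_energy x(1) that]])
  \<comment> \<open>The inner derivative is known only where \<open>y + s u\<close> is nonzero; this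
    holds for \<open>s\<close> near 0, which is enough for the outer derivative.\<close>
  have "((\<lambda>s. y + s *\<^sub>R u) \<longlongrightarrow> y + 0 *\<^sub>R u) (nhds 0)"
    by (intro tendsto_intros filterlim_ident)
  then have "((\<lambda>s. y + s *\<^sub>R u) \<longlongrightarrow> y) (nhds 0)" by simp
  then have "eventually (\<lambda>s. y + s *\<^sub>R u \<in> - {0}) (nhds 0)"
    by (rule topological_tendstoD) (use x in auto)
  then have "eventually (\<lambda>s. deriv (\<lambda>t. (L x (y + s *\<^sub>R u + t *\<^sub>R v))\<^sup>2) 0 = Ev v x (y + s *\<^sub>R u)) (nhds 0)"
    by (rule eventually_mono) (simp add: inner)
  then have "deriv (\<lambda>s. deriv (\<lambda>t. (L x (y + s *\<^sub>R u + t *\<^sub>R v))\<^sup>2) 0) 0 = deriv (\<lambda>s. Ev v x (y + s *\<^sub>R u)) 0"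
    by (rule deriv_cong_ev) simp
  also have "\<dots> = vert_deriv (Ev v) x y u"
    by (rule deriv_along_line[OF has_derivative_vert[OF smooth2_Ev x]])
  finally show ?thesis by (simp add: fund_tensor_def)
qed

end

locale finsler = smooth_energy U L for U :: "'e::euclidean_space set" and L +
  assumes L_homogeneous: "homogeneous 1 L"
    and fund_tensor_pos: "x \<in> U \<Longrightarrow> y \<noteq> 0 \<Longrightarrow> u \<noteq> 0 \<Longrightarrow> 0 < fund_tensor L x y u u"
begin

abbreviation G :: "'e \<Rightarrow> 'e \<Rightarrow> 'e" where "G \<equiv> spray L"
abbreviation N :: "'e \<Rightarrow> 'e \<Rightarrow> 'e \<Rightarrow> 'e" where "N u \<equiv> \<lambda>x y. vert_deriv G x y u"
abbreviation g :: "'e \<Rightarrow> 'e \<Rightarrow> 'e \<Rightarrow> 'e \<Rightarrow> real" where "g u v \<equiv> \<lambda>x y. fund_tensor L x y u v"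

lemma homogeneous_E: "homogeneous 2 E"
  using L_homogeneous by (simp add: homogeneous_def power_mult_distrib)

lemma homogeneous_Ev: "homogeneous 1 (Ev w)"
  using homogeneous_vert_deriv[OF smooth2_energy, of 1] homogeneous_E by (simp add: numeral_2_eq_2)

lemma fund_tensor_sym: "x \<in> U \<Longrightarrow> y \<noteq> 0 \<Longrightarrow> g u v x y = g v u x y"
  by (simp add: fund_tensor_eq vert_vert_commute[OF smooth2_energy])

lemma fund_tensor_linear: 
  assumes "x \<in> U" "y \<noteq> 0" 
  shows "linear (\<lambda>u. g u v x y)" "linear (\<lambda>v. g u v x y)"
proof -
  have *: "linear (\<lambda>u. g u v x y)" for v
    unfolding fund_tensor_eq[OF assms] using linear_vert_deriv[OF smooth2_Ev assms, of v]
    by (auto simp: linear_iff add_divide_distrib)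
  show "linear (\<lambda>u. g u v x y)" by (rule *)
  show "linear (\<lambda>v. g u v x y)" using *[of u] by (simp add: fund_tensor_sym[OF assms, of u])
qed

lemma fund_tensor_bilinear: "x \<in> U \<Longrightarrow> y \<noteq> 0 \<Longrightarrow> bilinear (fund_tensor L x y)"
  using fund_tensor_linear unfolding bilinear_def by blast

lemma smooth2_fund_tensor: "smooth2 (g u v)"
proof -
  have "smooth2 (\<lambda>x y. vert_deriv (Ev v) x y u / 2)"
    using smooth2_vert_deriv[OF smooth2_Ev, of v u] unfolding smooth2_def
    by (intro smooth_intros open_W) auto
  then show ?thesis by (rule smooth2_cong) (simp add: fund_tensor_eq)
qed

lemma homogeneous_fund_tensor: "homogeneous 0 (g u v)"
  using homogeneous_vert_deriv[OF smooth2_Ev, of 0 v] homogeneous_Ev[of v]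
  by (auto simp: homogeneous_def fund_tensor_eq)

lemma fund_tensor_cancel:
  assumes "x \<in> U" "y \<noteq> 0" "\<And>w. g \<xi> w x y = g \<zeta> w x y"
  shows "\<xi> = \<zeta>"
  by (rule positive_definite_cancel[where B = "fund_tensor L x y", OF fund_tensor_bilinear[OF assms(1,2)]
        fund_tensor_pos[OF assms(1,2)] assms(3)])

lemma fund_tensor_position: "x \<in> U \<Longrightarrow> y \<noteq> 0 \<Longrightarrow> g y w x y = Ev w x y / 2"
  using euler[OF smooth2_Ev homogeneous_Ev, of x y w] by (simp add: fund_tensor_eq)

text \<open>The vertical derivative of the fundamental tensor is half the third derivative of the
  energy, that is, twice the Cartan tensor; its arguments may be exchanged because vertical
  derivatives commute.\<close>

lemma vert_fund_tensor_commute: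
  assumes "x \<in> U" "y \<noteq> 0"
  shows "vert_deriv (g u v) x y z = vert_deriv (g z v) x y u"
proof -
  have half: "vert_deriv (g u v) x y z = vert_deriv (\<lambda>x y. vert_deriv (Ev v) x y u) x y z / 2" for u z
  proof -
    have 1: "vert_deriv (g u v) x y z = vert_deriv (\<lambda>x y. vert_deriv (Ev v) x y u / 2) x y z"
      by (rule fun_cong[OF vert_deriv_cong[OF assms(2)]]) (simp add: fund_tensor_eq assms(1))
    have "((\<lambda>y. vert_deriv (Ev v) x y u / 2) has_derivative
        (\<lambda>z. vert_deriv (\<lambda>x y. vert_deriv (Ev v) x y u) x y z / 2)) (at y)"
      by (intro bounded_linear.has_derivative[OF bounded_linear_divide]
          has_derivative_vert[OF smooth2_vert_deriv[OF smooth2_Ev] assms])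
    from vert_derivI[of "\<lambda>x y. vert_deriv (Ev v) x y u / 2", OF this] 1 show ?thesis by simp
  qed
  show ?thesis
    unfolding half[of u z] half[of z u] using vert_vert_commute[OF smooth2_Ev assms, of v u z] by simp
qed

text \<open>Euler's theorem for the 0-homogeneous fundamental tensor, spread to the other arguments
  by symmetry: the Cartan tensor annihilates \<open>y\<close>.\<close>

lemma vert_fund_tensor_position:
  assumes "x \<in> U" "y \<noteq> 0"
  shows "vert_deriv (g u v) x y y = 0" "vert_deriv (g y v) x y z = 0" "vert_deriv (g u y) x y z = 0"
proof -
  show 1: "vert_deriv (g u v) x y y = 0" for u v
    using euler[OF smooth2_fund_tensor homogeneous_fund_tensor assms] by simp
  then show 2: "vert_deriv (g y v) x y z = 0" for v
    using vert_fund_tensor_commute[OF assms] by metis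
  have "vert_deriv (g u y) x y = vert_deriv (g y u) x y"
    by (rule vert_deriv_cong[OF assms(2)]) (rule fund_tensor_sym[OF assms(1)])
  then show "vert_deriv (g u y) x y z = 0" using 2[of u] by simp
qed

lemma pos_fund_tensor:
  assumes "x \<in> U" "y \<noteq> 0"
  shows "pos_deriv (g u v) x y z = vert_deriv (\<lambda>x y. pos_deriv (Ev v) x y z) x y u / 2"
proof -
  have "pos_deriv (g u v) x y z = pos_deriv (\<lambda>x y. vert_deriv (Ev v) x y u / 2) x y z"
    by (rule fun_cong[OF pos_deriv_cong[OF assms(1)]]) (simp add: fund_tensor_eq assms)
  also have "\<dots> = pos_deriv (\<lambda>x y. vert_deriv (Ev v) x y u) x y z / 2"
    by (rule pos_derivI) (intro bounded_linear.has_derivative[OF bounded_linear_divide]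
          has_derivative_pos[OF smooth2_vert_deriv[OF smooth2_Ev] assms])
  finally show ?thesis by (simp add: pos_vert_commute[OF smooth2_Ev assms])
qed

lemma pos_fund_tensor_position:
  assumes "x \<in> U" "y \<noteq> 0"
  shows "pos_deriv (g y w) x y z = pos_deriv (Ev w) x y z / 2"
    and "pos_deriv (g w y) x y z = pos_deriv (Ev w) x y z / 2"
proof -
  have "pos_deriv (g y w) x y z = pos_deriv (\<lambda>x y. Ev w x y / 2) x y z"
    by (rule fun_cong[OF pos_deriv_cong[OF assms(1)]]) (simp add: fund_tensor_position assms)
  also have "\<dots> = pos_deriv (Ev w) x y z / 2"
    by (rule pos_derivI) (intro bounded_linear.has_derivative[OF bounded_linear_divide]
          has_derivative_pos[OF smooth2_Ev assms])
  finally show 1: "pos_deriv (g y w) x y z = pos_deriv (Ev w) x y z / 2" .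
  have "pos_deriv (g w y) x y = pos_deriv (g y w) x y"
    by (rule pos_deriv_cong[OF assms(1)]) (rule fund_tensor_sym[OF _ assms(2)])
  with 1 show "pos_deriv (g w y) x y z = pos_deriv (Ev w) x y z / 2" by simp
qed

lemma pos_Ev_position:
  assumes "x \<in> U" "y \<noteq> 0"
  shows "pos_deriv (Ev y) x y z = 2 * pos_deriv E x y z"
proof -
  have "pos_deriv (Ev y) x y z = pos_deriv (\<lambda>x y. 2 * E x y) x y z"
    by (rule fun_cong[OF pos_deriv_cong[OF assms(1)]]) 
      (use euler[OF smooth2_energy homogeneous_E _ assms(2)] in simp)
  also have "\<dots> = 2 * pos_deriv E x y z"
    by (rule pos_derivI) (intro bounded_linear.has_derivative[OF bounded_linear_mult_right]
          has_derivative_pos[OF smooth2_energy assms])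
  finally show ?thesis .
qed

section \<open>Spray and nonlinear connection\<close>

definition spray_form :: "'e \<Rightarrow> 'e \<Rightarrow> 'e \<Rightarrow> real" where
  "spray_form w x y = (pos_deriv (Ev w) x y y - pos_deriv E x y w) / 4"

lemma linear_pos_Ev:
  assumes "x \<in> U" "y \<noteq> 0"
  shows "linear (\<lambda>w. pos_deriv (Ev w) x y u)"
  unfolding pos_vert_commute[OF smooth2_energy assms]
  by (rule linear_vert_deriv[OF smooth2_pos_deriv[OF smooth2_energy] assms])

lemma spray_equation:
  assumes "x \<in> U" "y \<noteq> 0"
  shows "g (G x y) w x y = spray_form w x y"
proof -
  have "linear (\<lambda>w. spray_form w x y)"
    using linear_pos_Ev[OF assms, of y] linear_pos_deriv[OF smooth2_energy assms]
    by (auto simp: linear_iff spray_form_def algebra_simps add_divide_distrib diff_divide_distrib)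
  from THE_bilinear_solution[where B = "fund_tensor L x y", OF fund_tensor_bilinear[OF assms]
      fund_tensor_pos[OF assms] this]
  show ?thesis by (simp add: spray_def spray_form_def Let_def)
qed

lemma spray_eqI:
  assumes "x \<in> U" "y \<noteq> 0" "\<And>w. g \<xi> w x y = spray_form w x y"
  shows "G x y = \<xi>"
  by (rule fund_tensor_cancel[OF assms(1,2)]) (simp add: spray_equation[OF assms(1,2)] assms(3))

lemma smooth2_spray_form: "smooth2 (spray_form w)"
  using smooth2_pos_deriv_dir[OF smooth2_Ev smooth2_snd, of w] smooth2_pos_deriv[OF smooth2_energy, of w]
  unfolding smooth2_def spray_form_def by (intro smooth_intros open_W) auto

lemma smooth2_spray: "smooth2 G"
  unfolding smooth2_def
  by (rule smooth_on_bilinear_solution[where B = "\<lambda>z. fund_tensor L (fst z) (snd z)"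
        and r = "\<lambda>z w. spray_form w (fst z) (snd z)", OF open_W])
    (simp_all add: in_W fund_tensor_bilinear fund_tensor_pos spray_equation
      smooth2_fund_tensor[unfolded smooth2_def] smooth2_spray_form[unfolded smooth2_def])

text \<open>The fundamental tensor is 0-homogeneous and the right-hand side of the spray equation
  2-homogeneous; uniqueness of the solution transfers the degree.\<close>

lemma homogeneous_spray: "homogeneous 2 G"
  unfolding homogeneous_def
proof (intro ballI allI impI)
  fix x y :: 'e and c :: real assume x: "x \<in> U" "y \<noteq> 0" "c > 0"
  have cy: "c *\<^sub>R y \<noteq> 0" using x by simp
  show "G x (c *\<^sub>R y) = c\<^sup>2 *\<^sub>R G x y"
  proof (rule spray_eqI[OF x(1) cy])
    fix w
    have "g (c\<^sup>2 *\<^sub>R G x y) w x (c *\<^sub>R y) = c\<^sup>2 * g (G x y) w x y"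
      using homogeneousD[OF homogeneous_fund_tensor x]
      by (simp add: linear_cmul[OF fund_tensor_linear(1)[OF x(1,2)]])
    also have "\<dots> = spray_form w x (c *\<^sub>R y)"
      using homogeneousD[OF homogeneous_pos_deriv[OF smooth2_energy homogeneous_E] x, of w]
        homogeneousD[OF homogeneous_pos_deriv[OF smooth2_Ev homogeneous_Ev] x]
      by (simp add: spray_equation[OF x(1,2)] spray_form_def linear_cmul[OF linear_pos_deriv[OF smooth2_Ev x(1,2)]]
          power2_eq_square[of c] algebra_simps)
    finally show "g (c\<^sup>2 *\<^sub>R G x y) w x (c *\<^sub>R y) = spray_form w x (c *\<^sub>R y)" .
  qed
qed

lemma smooth2_N: "smooth2 (N u)"
  by (rule smooth2_vert_deriv[OF smooth2_spray])

lemma N_position: "x \<in> U \<Longrightarrow> y \<noteq> 0 \<Longrightarrow> N y x y = 2 *\<^sub>R G x y"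
  using euler[OF smooth2_spray homogeneous_spray] by simp

text \<open>Vertical derivative of the spray equation
  \<open>g (G x y) w x y = spray_form w x y\<close> in the direction \<open>u\<close>; the last term
  is the Cartan tensor produced by differentiating \<open>g\<close> on the left.\<close>

lemma fund_tensor_N:
  assumes x: "x \<in> U" "y \<noteq> 0"
  shows "g (N u x y) w x y = pos_deriv (g u w) x y y / 2
    + (pos_deriv (Ev w) x y u - pos_deriv (Ev u) x y w) / 4 - vert_deriv (g u w) x y (G x y)"
proof -
  have 1: "((\<lambda>y. g (G x y) w x y) has_derivative
      (\<lambda>u. vert_deriv (g (G x y) w) x y u + g (N u x y) w x y)) (at y)"
    using has_derivative_linear_family[of "- {0}" y "\<lambda>y \<xi>. g \<xi> w x y" "G x" "vert_deriv G x y",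
        OF _ _ fund_tensor_linear(1)[OF x(1)] differentiableI[OF has_derivative_vert[OF smooth2_fund_tensor x]]
          has_derivative_vert[OF smooth2_spray x]] x(2)
    unfolding vert_deriv_def[of "\<lambda>x y. g _ w x y"] by auto
  have "((\<lambda>y. spray_form w x y) has_derivative
    (\<lambda>u. (vert_deriv (\<lambda>x y'. pos_deriv (Ev w) x y' y) x y u + pos_deriv (Ev w) x y u
       - vert_deriv (\<lambda>x y. pos_deriv E x y w) x y u) / 4)) (at y)"
    unfolding spray_form_def
    by (intro bounded_linear.has_derivative[OF bounded_linear_divide] has_derivative_diff
        has_derivative_vert_pos[OF smooth2_Ev x] has_derivative_ident refl
        has_derivative_vert[OF smooth2_pos_deriv[OF smooth2_energy] x])
  then have "((\<lambda>y. g (G x y) w x y) has_derivative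
    (\<lambda>u. (vert_deriv (\<lambda>x y'. pos_deriv (Ev w) x y' y) x y u + pos_deriv (Ev w) x y u
       - vert_deriv (\<lambda>x y. pos_deriv E x y w) x y u) / 4)) (at y)"
    by (rule has_derivative_transform_within_open[of _ _ _ _ "- {0}"])
      (use x in \<open>simp_all add: spray_equation open_Compl\<close>)
  from fun_cong[OF has_derivative_unique[OF 1 this], of u] show ?thesis
    using pos_fund_tensor[OF x, of u w y] pos_vert_commute[OF smooth2_energy x, of u w]
      vert_fund_tensor_commute[OF x, of "G x y" w u] by (simp add: field_simps)
qed

section \<open>Chern connection and flag operator\<close>

lemma hor_deriv_smooth2:
  assumes "smooth2 Z"
  shows "smooth2 (\<lambda>x y. hor_deriv L Z x y u :: 'b::euclidean_space)"
  using smooth2_pos_deriv[OF assms, of u] smooth2_vert_deriv_dir[OF assms smooth2_N, of u]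
  unfolding smooth2_def hor_deriv_def by (intro smooth_intros open_W)

lemma linear_hor_deriv:
  assumes "smooth2 (Z :: 'e \<Rightarrow> 'e \<Rightarrow> 'b::euclidean_space)" "x \<in> U" "y \<noteq> 0"
  shows "linear (hor_deriv L Z x y)"
  unfolding hor_deriv_def
  by (intro linear_compose_sub linear_pos_deriv[OF assms] linear_compose[OF linear_vert_deriv[OF smooth2_spray assms(2,3)]
        linear_vert_deriv[OF assms], unfolded o_def])

lemma linear_hor_fund_tensor:
  assumes x: "x \<in> U" "y \<noteq> 0"
  shows "linear (\<lambda>w. hor_deriv L (g v w) x y u)"
proof -
  have "linear (\<lambda>w. pos_deriv (g v w) x y u)"
    unfolding pos_deriv_def
    by (rule linear_family_frechet_derivative[of U x "\<lambda>x w. g v w x y", OF open_U x(1) fund_tensor_linear(2)[OF _ x(2)]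
          differentiableI[OF has_derivative_pos[OF smooth2_fund_tensor x]]])
  moreover have "linear (\<lambda>w. vert_deriv (g v w) x y (N u x y))"
    unfolding vert_deriv_def[of "\<lambda>x y. g v _ x y"]
    by (rule linear_family_frechet_derivative[of "- {0}" y "\<lambda>y w. g v w x y", OF _ _ fund_tensor_linear(2)[OF x(1)]
          differentiableI[OF has_derivative_vert[OF smooth2_fund_tensor x]]]) (use x in auto)
  ultimately show ?thesis unfolding hor_deriv_def by (rule linear_compose_sub)
qed

definition chern_form :: "'e \<Rightarrow> 'e \<Rightarrow> 'e \<Rightarrow> 'e \<Rightarrow> 'e \<Rightarrow> real" where
  "chern_form u v w x y = (hor_deriv L (g v w) x y u + hor_deriv L (g u w) x y v - hor_deriv L (g u v) x y w) / 2"

lemma hor_fund_tensor_sym: "x \<in> U \<Longrightarrow> y \<noteq> 0 \<Longrightarrow> hor_deriv L (g u v) x y = hor_deriv L (g v u) x y"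
proof -
  assume x: "x \<in> U" "y \<noteq> 0"
  have "pos_deriv (g u v) x y = pos_deriv (g v u) x y" "vert_deriv (g u v) x y = vert_deriv (g v u) x y"
    by (intro pos_deriv_cong vert_deriv_cong fund_tensor_sym x; assumption)+
  then show ?thesis by (simp add: hor_deriv_def fun_eq_iff)
qed

lemma chern_form_linear:
  assumes x: "x \<in> U" "y \<noteq> 0"
  shows "linear (\<lambda>w. chern_form u v w x y)" "linear (\<lambda>v. chern_form u v w x y)"
  using linear_hor_fund_tensor[OF x, of v u] linear_hor_fund_tensor[OF x, of u v]
    linear_hor_fund_tensor[OF x, of w u] linear_hor_fund_tensor[OF x, of u w]
    linear_hor_deriv[OF smooth2_fund_tensor x, of u v] linear_hor_deriv[OF smooth2_fund_tensor x, of u w]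
  unfolding chern_form_def hor_fund_tensor_sym[OF x, of _ w]
  by (auto simp: linear_iff algebra_simps add_divide_distrib diff_divide_distrib)

lemma chern_equation:
  assumes x: "x \<in> U" "y \<noteq> 0"
  shows "g (chern_coeff L x y u v) w x y = chern_form u v w x y"
  using THE_bilinear_solution[where B = "fund_tensor L x y", OF fund_tensor_bilinear[OF x]
      fund_tensor_pos[OF x] chern_form_linear(1)[OF x]]
  by (simp add: chern_coeff_def chern_form_def)

lemma chern_sym:
  assumes x: "x \<in> U" "y \<noteq> 0"
  shows "chern_coeff L x y u v = chern_coeff L x y v u"
  by (rule fund_tensor_cancel[OF x])
    (simp add: chern_equation[OF x] chern_form_def hor_fund_tensor_sym[OF x, of u v] add.commute)

lemma chern_linear:
  assumes x: "x \<in> U" "y \<noteq> 0"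
  shows "linear (chern_coeff L x y u)"
proof (rule linearI)
  show "chern_coeff L x y u (v + w) = chern_coeff L x y u v + chern_coeff L x y u w" for v w
    by (rule fund_tensor_cancel[OF x])
      (simp add: chern_equation[OF x] linear_add[OF chern_form_linear(2)[OF x]] linear_add[OF fund_tensor_linear(1)[OF x]])
  show "chern_coeff L x y u (c *\<^sub>R v) = c *\<^sub>R chern_coeff L x y u v" for c v
    by (rule fund_tensor_cancel[OF x])
      (simp add: chern_equation[OF x] linear_cmul[OF chern_form_linear(2)[OF x]] linear_cmul[OF fund_tensor_linear(1)[OF x]])
qed

lemma smooth2_continuous:
  assumes "smooth2 Z" "x \<in> U" "y \<noteq> 0"
  shows "continuous (at y) (Z x)"
proof -
  have "continuous (at (x, y)) (\<lambda>z. Z (fst z) (snd z))"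
    using smooth_on_imp_continuous_on[OF assms(1)[unfolded smooth2_def]] open_W assms(2,3)
    by (simp add: continuous_on_eq_continuous_at in_W)
  then have "continuous (at y) ((\<lambda>z. Z (fst z) (snd z)) \<circ> (\<lambda>y. (x, y)))"
    by (intro continuous_at_compose continuous_intros) simp
  then show ?thesis by (simp add: o_def)
qed

lemma chern_continuous:
  assumes x: "x \<in> U" "y \<noteq> 0"
  shows "continuous (at y) (\<lambda>y. chern_coeff L x y u v)"
proof (rule bilinear_solution_continuous[where S = "- {0}" and B = "fund_tensor L x" and r = "\<lambda>y w. chern_form u v w x y"])
  show "continuous (at y) (\<lambda>y. chern_form u v w x y)" for w
    unfolding chern_form_def
    by (intro continuous_intros smooth2_continuous[OF hor_deriv_smooth2[OF smooth2_fund_tensor] x]) auto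
  show "continuous (at y) (\<lambda>y. fund_tensor L x y u v)" for u v
    by (rule smooth2_continuous[OF smooth2_fund_tensor x])
qed (use x in \<open>auto simp: chern_equation fund_tensor_bilinear fund_tensor_pos\<close>)

text \<open>Every Cartan term with an argument \<open>y\<close> drops out, and the rest is the
  formula for \<open>N\<close>. Since the flag operator applies the curvature to \<open>y\<close>,
  this identity is what removes the Chern coefficients from it.\<close>

lemma chern_position:
  assumes x: "x \<in> U" "y \<noteq> 0"
  shows "chern_coeff L x y u y = N u x y"
proof (rule fund_tensor_cancel[OF x])
  fix w
  show "g (chern_coeff L x y u y) w x y = g (N u x y) w x y"
    by (simp add: chern_equation[OF x] chern_form_def hor_deriv_def vert_fund_tensor_position[OF x]
        pos_fund_tensor_position[OF x] N_position[OF x] fund_tensor_N[OF x]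
        linear_cmul[OF linear_vert_deriv[OF smooth2_fund_tensor x]] field_simps)
qed

text \<open>The Chern coefficients are only known to be continuous in \<open>y\<close>; this suffices, since
  differentiating \<open>chern_coeff L x y v (y - y\<^sub>0)\<close> at \<open>y\<^sub>0\<close> does not differentiate the coefficients.\<close>

lemma hor_deriv_chern:
  assumes x: "x \<in> U" "y \<noteq> 0"
  shows "hor_deriv L (\<lambda>x y'. chern_coeff L x y' v y) x y u =
    pos_deriv (N v) x y u - vert_deriv (N v) x y (N u x y) + chern_coeff L x y v (N u x y)"
proof -
  have "pos_deriv (\<lambda>x y'. chern_coeff L x y' v y) x y u = pos_deriv (N v) x y u"
    by (rule fun_cong[OF pos_deriv_cong[OF x(1)]]) (simp add: chern_position x)
  moreover have "((\<lambda>y'. \<Sum>i\<in>Basis. ((y' - y) \<bullet> i) *\<^sub>R chern_coeff L x y' v i) has_derivative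
      (\<lambda>z. \<Sum>i\<in>Basis. (z \<bullet> i) *\<^sub>R chern_coeff L x y v i)) (at y)"
    by (intro has_derivative_sum has_derivative_scaleR_vanishing chern_continuous[OF x])
      (auto intro!: derivative_eq_intros)
  then have "((\<lambda>y'. N v x y' - (\<Sum>i\<in>Basis. ((y' - y) \<bullet> i) *\<^sub>R chern_coeff L x y' v i)) has_derivative
      (\<lambda>z. vert_deriv (N v) x y z - (\<Sum>i\<in>Basis. (z \<bullet> i) *\<^sub>R chern_coeff L x y v i))) (at y)"
    by (intro has_derivative_diff has_derivative_vert[OF smooth2_N x])
  then have "((\<lambda>y'. chern_coeff L x y' v y) has_derivative
      (\<lambda>z. vert_deriv (N v) x y z - (\<Sum>i\<in>Basis. (z \<bullet> i) *\<^sub>R chern_coeff L x y v i))) (at y)"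
  proof (rule has_derivative_transform_within_open[of _ _ _ _ "- {0}"])
    fix y' :: 'e assume "y' \<in> - {0}"
    then have y': "y' \<noteq> 0" by simp
    show "N v x y' - (\<Sum>i\<in>Basis. ((y' - y) \<bullet> i) *\<^sub>R chern_coeff L x y' v i) = chern_coeff L x y' v y"
      by (simp add: linear_diff[OF chern_linear[OF x(1) y']] chern_position[OF x(1) y']
          flip: linear_expand[OF chern_linear[OF x(1) y']])
  qed (use x in auto)
  then have "vert_deriv (\<lambda>x y'. chern_coeff L x y' v y) x y z =
      vert_deriv (N v) x y z - chern_coeff L x y v z" for z
    using vert_derivI[of "\<lambda>x y'. chern_coeff L x y' v y"] by (simp flip: linear_expand[OF chern_linear[OF x]])
  ultimately show ?thesis by (simp add: hor_deriv_def)
qed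

text \<open>Both halves of the commutator contain the Chern coefficients of \<open>y\<close> with
  \<open>N u\<close> and of \<open>u\<close> with \<open>N y\<close>; these cancel and leave the
  curvature of the nonlinear connection. In \<open>N y\<close> the vector \<open>y\<close> is a
  constant direction, not differentiated along with the reference vector.\<close>

lemma flag_operator_eq:
  assumes x: "x \<in> U" "y \<noteq> 0"
  shows "flag_operator L x y u = pos_deriv (N y) x y u - vert_deriv (N y) x y (N u x y)
    - pos_deriv (N u) x y y + vert_deriv (N u) x y (N y x y)"
proof -
  have const: "chern_connection L v (\<lambda>_ _. w) = (\<lambda>x y. chern_coeff L x y v w)" for v w
    by (intro ext) (simp add: chern_connection_def hor_deriv_def pos_deriv_def vert_deriv_def)
  show ?thesis
    unfolding flag_operator_def chern_curvature_def const chern_connection_def[of L _ "\<lambda>x y. chern_coeff L x y _ _"]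
    by (simp add: hor_deriv_chern[OF x] chern_position[OF x] chern_sym[OF x, of y])
qed

text \<open>Pairing the formula for \<open>N u\<close> with \<open>y\<close> kills its Cartan term.
  The energy is thus constant in horizontal directions, which is the source of the orthogonality of
  the flag operator to \<open>y\<close>.\<close>

lemma hor_energy:
  assumes x: "x \<in> U" "y \<noteq> 0"
  shows "vert_deriv E x y (N u x y) = pos_deriv E x y u"
proof -
  have "vert_deriv E x y (N u x y) = 2 * g y (N u x y) x y" by (simp add: fund_tensor_position[OF x])
  also have "\<dots> = 2 * g (N u x y) y x y" by (simp add: fund_tensor_sym[OF x])
  finally show ?thesis
    by (simp add: fund_tensor_N[OF x] vert_fund_tensor_position[OF x] pos_fund_tensor_position[OF x]
        pos_Ev_position[OF x] field_simps)
qed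

text \<open>The horizontal derivatives of the energy vanish, hence so do those of their commutator, which is
  the derivative of the energy along the flag operator.\<close>

lemma energy_flag_operator:
  assumes x: "x \<in> U" "y \<noteq> 0"
  shows "vert_deriv E x y (flag_operator L x y u) = 0"
proof -
  have pos: "vert_deriv E x y (pos_deriv (N b) x y a)
      = pos_deriv (\<lambda>x y. pos_deriv E x y b) x y a - pos_deriv (Ev (N b x y)) x y a" for a b
  proof -
    have "((\<lambda>x. vert_deriv E x y (N b x y)) has_derivative
      (\<lambda>a. pos_deriv (Ev (N b x y)) x y a + vert_deriv E x y (pos_deriv (N b) x y a))) (at x)"
      by (rule has_derivative_pos_vert[OF smooth2_energy x has_derivative_pos[OF smooth2_N x] refl])
    moreover have "((\<lambda>x. vert_deriv E x y (N b x y)) has_derivative (\<lambda>a. pos_deriv (\<lambda>x y. pos_deriv E x y b) x y a)) (at x)"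
      by (rule has_derivative_transform_within_open[OF has_derivative_pos[OF smooth2_pos_deriv[OF smooth2_energy] x] open_U x(1)])
        (simp add: hor_energy x)
    ultimately have "(\<lambda>a. pos_deriv (Ev (N b x y)) x y a + vert_deriv E x y (pos_deriv (N b) x y a)) = (\<lambda>a. pos_deriv (\<lambda>x y. pos_deriv E x y b) x y a)"
      by (rule has_derivative_unique)
    from fun_cong[OF this, of a] show ?thesis by simp
  qed
  have vert: "vert_deriv E x y (vert_deriv (N b) x y z)
      = vert_deriv (\<lambda>x y. pos_deriv E x y b) x y z - vert_deriv (Ev (N b x y)) x y z" for b z
  proof -
    have "((\<lambda>y. vert_deriv E x y (N b x y)) has_derivative
      (\<lambda>a. vert_deriv (Ev (N b x y)) x y a + vert_deriv E x y (vert_deriv (N b) x y a))) (at y)"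
      by (rule has_derivative_vert_vert[OF smooth2_energy x has_derivative_vert[OF smooth2_N x] refl])
    moreover have "((\<lambda>y. vert_deriv E x y (N b x y)) has_derivative (\<lambda>a. vert_deriv (\<lambda>x y. pos_deriv E x y b) x y a)) (at y)"
      by (rule has_derivative_transform_within_open[OF has_derivative_vert[OF smooth2_pos_deriv[OF smooth2_energy] x], of "- {0}"])
        (use x in \<open>simp_all add: hor_energy open_Compl\<close>)
    ultimately have "(\<lambda>a. vert_deriv (Ev (N b x y)) x y a + vert_deriv E x y (vert_deriv (N b) x y a)) = (\<lambda>a. vert_deriv (\<lambda>x y. pos_deriv E x y b) x y a)"
      by (rule has_derivative_unique)
    from fun_cong[OF this, of z] show ?thesis by simp
  qed
  have "vert_deriv E x y (flag_operator L x y u) =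
     vert_deriv E x y (pos_deriv (N y) x y u) - vert_deriv E x y (vert_deriv (N y) x y (N u x y))
     - vert_deriv E x y (pos_deriv (N u) x y y) + vert_deriv E x y (vert_deriv (N u) x y (N y x y))"
    using linear_vert_deriv[OF smooth2_energy x]
    by (simp add: flag_operator_eq[OF x] linear_add linear_diff)
  \<comment> \<open>After substitution only second derivatives of the energy remain, and they cancel
    in pairs by symmetry.\<close>
  then show ?thesis
    using pos_pos_commute[OF smooth2_energy x, of u y] vert_vert_commute[OF smooth2_energy x, of "N u x y" "N y x y"]
    by (simp add: pos vert pos_vert_commute[OF smooth2_energy x])
qed

end

section \<open>Riemannian metrics on open sets\<close>

text \<open>Positivity on \<open>u\<close> minus its projection onto \<open>v\<close>.\<close>

lemma strict_Cauchy_Schwarz: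
  fixes B :: "'a::real_vector \<Rightarrow> 'a \<Rightarrow> real"
  assumes B: "bilinear B" and sym: "\<And>u v. B u v = B v u" and pos: "\<And>u. u \<noteq> 0 \<Longrightarrow> 0 < B u u"
    and v: "v \<noteq> 0" and u: "\<And>t. u \<noteq> t *\<^sub>R v"
  shows "0 < B v v * B u u - (B v u)\<^sup>2"
proof -
  define t where "t = B v u / B v v"
  have vv: "0 < B v v" by (rule pos[OF v])
  have "0 < B (u - t *\<^sub>R v) (u - t *\<^sub>R v)" using u[of t] by (intro pos) simp
  also have "\<dots> = B u u - 2 * t * B v u + t * t * B v v"
    by (simp add: bilinear_lsub[OF B] bilinear_rsub[OF B] bilinear_lmul[OF B] bilinear_rmul[OF B] sym[of u v] algebra_simps)
  also have "\<dots> = B u u - (B v u)\<^sup>2 / B v v"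
    using vv by (simp add: t_def power2_eq_square field_simps)
  finally have "(B v u)\<^sup>2 / B v v < B u u" by simp
  then show ?thesis using vv by (simp add: field_simps)
qed

locale riemannian = slit_bundle U for U :: "'e::euclidean_space set" +
  fixes h :: "'e \<Rightarrow> 'e \<Rightarrow> 'e \<Rightarrow> real"
  assumes h_bilinear: "x \<in> U \<Longrightarrow> bilinear (h x)"
    and h_sym: "x \<in> U \<Longrightarrow> h x u v = h x v u"
    and h_pos: "x \<in> U \<Longrightarrow> u \<noteq> 0 \<Longrightarrow> 0 < h x u u"
    and h_smooth: "smooth_on (\<lambda>x. h x u v) U"
begin

abbreviation dh :: "'e \<Rightarrow> 'e \<Rightarrow> 'e \<Rightarrow> 'e \<Rightarrow> real" where
  "dh x z u v \<equiv> frechet_derivative (\<lambda>x. h x u v) (at x) z"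

abbreviation chr :: "'e \<Rightarrow> 'e \<Rightarrow> 'e \<Rightarrow> 'e" where "chr \<equiv> christoffel h"

abbreviation dchr :: "'e \<Rightarrow> 'e \<Rightarrow> 'e \<Rightarrow> 'e \<Rightarrow> 'e" where
  "dchr x z u v \<equiv> frechet_derivative (\<lambda>x. chr x u v) (at x) z"

lemma h_linear: "x \<in> U \<Longrightarrow> linear (h x u)" "x \<in> U \<Longrightarrow> linear (\<lambda>u. h x u v)"
  using h_bilinear unfolding bilinear_def by auto

lemmas h_algebra =
  linear_add[OF h_linear(1)] linear_diff[OF h_linear(1)] linear_cmul[OF h_linear(1)] linear_neg[OF h_linear(1)] linear_0[OF h_linear(1)]
  linear_add[OF h_linear(2)] linear_diff[OF h_linear(2)] linear_cmul[OF h_linear(2)] linear_neg[OF h_linear(2)] linear_0[OF h_linear(2)]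

lemma h_differentiable: "x \<in> U \<Longrightarrow> (\<lambda>x. h x u v) differentiable (at x)"
  by (rule smooth_on_differentiable[OF h_smooth])

lemma dh_linear:
  assumes "x \<in> U"
  shows "linear (\<lambda>z. dh x z u v)" "linear (\<lambda>u. dh x z u v)" "linear (\<lambda>v. dh x z u v)"
proof -
  show "linear (\<lambda>z. dh x z u v)"
    by (rule linear_frechet_derivative[OF h_differentiable[OF assms]])
  show "linear (\<lambda>u. dh x z u v)"
    by (rule linear_family_frechet_derivative[of U x "\<lambda>x u. h x u v", OF open_U assms h_linear(2) h_differentiable[OF assms]])
  show "linear (\<lambda>v. dh x z u v)"
    by (rule linear_family_frechet_derivative[of U x "\<lambda>x v. h x u v", OF open_U assms h_linear(1) h_differentiable[OF assms]])
qed

lemmas dh_algebra =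
  linear_add[OF dh_linear(1)] linear_diff[OF dh_linear(1)] linear_cmul[OF dh_linear(1)] linear_neg[OF dh_linear(1)] linear_0[OF dh_linear(1)]
  linear_add[OF dh_linear(2)] linear_diff[OF dh_linear(2)] linear_cmul[OF dh_linear(2)] linear_neg[OF dh_linear(2)] linear_0[OF dh_linear(2)]
  linear_add[OF dh_linear(3)] linear_diff[OF dh_linear(3)] linear_cmul[OF dh_linear(3)] linear_neg[OF dh_linear(3)] linear_0[OF dh_linear(3)]

lemma dh_sym: "x \<in> U \<Longrightarrow> dh x z u v = dh x z v u"
  by (rule fun_cong[OF frechet_derivative_cong_open[OF open_U]]) (auto simp: h_sym)

lemma h_cancel: "x \<in> U \<Longrightarrow> (\<And>w. h x \<xi> w = h x \<zeta> w) \<Longrightarrow> \<xi> = \<zeta>"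
  by (rule positive_definite_cancel[where B = "h x", OF h_bilinear h_pos])

lemma chr_equation:
  assumes x: "x \<in> U"
  shows "h x (chr x u v) w = (dh x u v w + dh x v u w - dh x w u v) / 2"
proof -
  have "linear (\<lambda>w. (dh x u v w + dh x v u w - dh x w u v) / 2)"
    using dh_linear(1)[OF x, of u v] dh_linear(3)[OF x, of u v] dh_linear(3)[OF x, of v u]
    by (auto simp: linear_iff add_divide_distrib diff_divide_distrib algebra_simps)
  from THE_bilinear_solution[where B = "h x", OF h_bilinear[OF x] h_pos[OF x] this]
  show ?thesis by (simp add: christoffel_def)
qed

lemma chr_sym: "x \<in> U \<Longrightarrow> chr x u v = chr x v u"
  by (rule h_cancel[of x]) (simp_all add: chr_equation dh_sym[of x u v])

lemma chr_bilinear: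
  assumes x: "x \<in> U"
  shows "bilinear (chr x)"
proof -
  have "linear (chr x u)" for u
  proof (rule linearI)
    show "chr x u (v + w) = chr x u v + chr x u w" for v w
      by (rule h_cancel[OF x])
        (simp add: chr_equation[OF x] h_algebra[OF x] dh_algebra[OF x] field_simps)
    show "chr x u (c *\<^sub>R v) = c *\<^sub>R chr x u v" for c v
      by (rule h_cancel[OF x])
        (simp add: chr_equation[OF x] h_algebra[OF x] dh_algebra[OF x] field_simps)
  qed
  then show ?thesis unfolding bilinear_def using chr_sym[OF x] by simp
qed

lemma chr_linear: "x \<in> U \<Longrightarrow> linear (chr x u)" "x \<in> U \<Longrightarrow> linear (\<lambda>u. chr x u v)"
  using chr_bilinear unfolding bilinear_def by auto

lemmas chr_algebra =
  linear_add[OF chr_linear(1)] linear_diff[OF chr_linear(1)] linear_cmul[OF chr_linear(1)] linear_neg[OF chr_linear(1)] linear_0[OF chr_linear(1)]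
  linear_add[OF chr_linear(2)] linear_diff[OF chr_linear(2)] linear_cmul[OF chr_linear(2)] linear_neg[OF chr_linear(2)] linear_0[OF chr_linear(2)]

lemma chr_smooth: "smooth_on (\<lambda>x. chr x u v) U"
proof (rule smooth_on_bilinear_solution[where B = h and r = "\<lambda>x w. (dh x u v w + dh x v u w - dh x w u v) / 2", OF open_U])
  show "smooth_on (\<lambda>x. (dh x u v w + dh x v u w - dh x w u v) / 2) U" for w
    by (intro smooth_intros open_U smooth_on_frechet_derivative[OF h_smooth]) auto
qed (simp_all add: h_bilinear h_pos h_smooth chr_equation)

lemma chr_differentiable: "x \<in> U \<Longrightarrow> (\<lambda>x. chr x u v) differentiable (at x)"
  by (rule smooth_on_differentiable[OF chr_smooth])

lemma dchr_linear:
  assumes "x \<in> U"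
  shows "linear (\<lambda>z. dchr x z u v)" "linear (\<lambda>u. dchr x z u v)" "linear (\<lambda>v. dchr x z u v)"
proof -
  show "linear (\<lambda>z. dchr x z u v)"
    by (rule linear_frechet_derivative[OF chr_differentiable[OF assms]])
  show "linear (\<lambda>u. dchr x z u v)"
    by (rule linear_family_frechet_derivative[of U x "\<lambda>x u. chr x u v", OF open_U assms chr_linear(2) chr_differentiable[OF assms]])
  show "linear (\<lambda>v. dchr x z u v)"
    by (rule linear_family_frechet_derivative[of U x "\<lambda>x v. chr x u v", OF open_U assms chr_linear(1) chr_differentiable[OF assms]])
qed

lemma metric_compatible: "x \<in> U \<Longrightarrow> dh x a v w = h x (chr x a v) w + h x v (chr x a w)"
  using h_sym[of x v "chr x a w"] dh_sym[of x w v a] by (simp add: chr_equation field_simps)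

lemma riemann_curvature_eq:
  assumes x: "x \<in> U"
  shows "riemann_curvature h x u v w =
    dchr x u v w + chr x u (chr x v w) - (dchr x v u w + chr x v (chr x u w))"
proof -
  have "levi_civita h v (\<lambda>_. w) = (\<lambda>x. chr x v w)" for v
    by (simp add: levi_civita_def fun_eq_iff)
  then show ?thesis by (simp add: riemann_curvature_def levi_civita_def[of h _ "\<lambda>x. chr x _ w"])
qed

lemma riemann_linear:
  assumes x: "x \<in> U"
  shows "linear (\<lambda>u. riemann_curvature h x u v w)" "linear (\<lambda>v. riemann_curvature h x u v w)"
    "linear (riemann_curvature h x u v)"
  using dchr_linear[OF x] chr_linear[OF x]
  by (simp_all add: linear_iff riemann_curvature_eq[OF x] algebra_simps)

lemmas riemann_algebra =
  linear_add[OF riemann_linear(1)] linear_diff[OF riemann_linear(1)] linear_cmul[OF riemann_linear(1)] linear_neg[OF riemann_linear(1)] linear_0[OF riemann_linear(1)]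
  linear_add[OF riemann_linear(2)] linear_diff[OF riemann_linear(2)] linear_cmul[OF riemann_linear(2)] linear_neg[OF riemann_linear(2)] linear_0[OF riemann_linear(2)]
  linear_add[OF riemann_linear(3)] linear_diff[OF riemann_linear(3)] linear_cmul[OF riemann_linear(3)] linear_neg[OF riemann_linear(3)] linear_0[OF riemann_linear(3)]

lemma riemann_antisym: "x \<in> U \<Longrightarrow> riemann_curvature h x u v w = - riemann_curvature h x v u w"
  by (simp add: riemann_curvature_eq)

text \<open>The second derivatives of \<open>h x w w\<close> commute; expanding them by metric compatibility gives the skew
  symmetry of the curvature.\<close>

lemma riemann_skew_diag:
  assumes x: "x \<in> U"
  shows "h x (riemann_curvature h x u v w) w = 0"
proof -
  have second: "frechet_derivative (\<lambda>x. dh x v w w) (at x) u =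
      2 * (h x (dchr x u v w + chr x u (chr x v w)) w + h x (chr x v w) (chr x u w))" for u v
  proof -
    have "((\<lambda>x. 2 * h x (chr x v w) w) has_derivative (\<lambda>u. 2 * (dh x u (chr x v w) w + h x (dchr x u v w) w + h x (chr x v w) 0))) (at x)"
      by (intro bounded_linear.has_derivative[OF bounded_linear_mult_right] has_derivative_const
          has_derivative_bilinear_family[of U x h, OF open_U x h_bilinear h_differentiable[OF x]]
          smooth_on_has_derivative[OF chr_smooth x])
    then have "((\<lambda>x. dh x v w w) has_derivative (\<lambda>u. 2 * (dh x u (chr x v w) w + h x (dchr x u v w) w + h x (chr x v w) 0))) (at x)"
      by (rule has_derivative_transform_within_open[OF _ open_U x]) (simp add: metric_compatible h_sym[of _ w])
    from frechet_derivative_eqI[OF this, of u] show ?thesis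
      by (simp add: h_algebra[OF x] metric_compatible[OF x] )
  qed
  have "frechet_derivative (\<lambda>x. dh x v w w) (at x) u = frechet_derivative (\<lambda>x. dh x u w w) (at x) v"
    by (rule second_derivative_symmetric[OF open_U h_smooth x])
  then have "h x (dchr x u v w + chr x u (chr x v w)) w = h x (dchr x v u w + chr x v (chr x u w)) w"
    by (simp add: second h_sym[OF x, of "chr x u w"])
  then show ?thesis
    by (simp only: riemann_curvature_eq[OF x] linear_diff[OF h_linear(2)[OF x]])
qed

text \<open>Polarisation of the diagonal case.\<close>

lemma riemann_skew:
  assumes x: "x \<in> U"
  shows "h x (riemann_curvature h x u v a) b = - h x (riemann_curvature h x u v b) a"
  using riemann_skew_diag[OF x, of u v "a + b"]
  by (simp add: riemann_algebra[OF x] h_algebra[OF x] riemann_skew_diag[OF x])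

section \<open>Curvature of planes\<close>

definition gram :: "'e \<Rightarrow> 'e \<Rightarrow> 'e \<Rightarrow> real" where
  "gram x u v = h x v v * h x u u - (h x v u)\<^sup>2"

definition curv :: "'e \<Rightarrow> 'e \<Rightarrow> 'e \<Rightarrow> real" where
  "curv x u v = h x (riemann_curvature h x u v v) u"

lemma gram_pos:
  assumes "x \<in> U" "v \<noteq> 0" "\<And>t. u \<noteq> t *\<^sub>R v"
  shows "0 < gram x u v"
  unfolding gram_def
  by (rule strict_Cauchy_Schwarz[where B = "h x", OF h_bilinear h_sym h_pos]) (use assms in auto)

lemma gram_change_basis:
  assumes x: "x \<in> U"
  shows "gram x (a *\<^sub>R u + b *\<^sub>R v) (c *\<^sub>R u + d *\<^sub>R v) = (a * d - b * c)\<^sup>2 * gram x u v"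
  by (simp add: gram_def h_algebra[OF x] h_sym[OF x, of v u] power2_eq_square algebra_simps)

text \<open>Antisymmetry in the first two arguments makes the curvature operator scale with the
  determinant; skew symmetry in the last pair supplies the second factor. The Gram determinant
  scales alike, so the quotient depends on the plane alone.\<close>

lemma curv_change_basis:
  assumes x: "x \<in> U"
  shows "curv x (a *\<^sub>R u + b *\<^sub>R v) (c *\<^sub>R u + d *\<^sub>R v) = (a * d - b * c)\<^sup>2 * curv x u v"
proof -
  have same: "riemann_curvature h x u u w = 0" for u w
    using riemann_curvature_eq[OF x, of u u w] by simp
  have R: "riemann_curvature h x (a *\<^sub>R u + b *\<^sub>R v) (c *\<^sub>R u + d *\<^sub>R v) w = (a * d - b * c) *\<^sub>R riemann_curvature h x u v w" for w
    by (simp add: riemann_algebra[OF x] same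
        riemann_antisym[OF x, of v u] algebra_simps)
  show ?thesis
    unfolding curv_def R
    by (simp add: linear_add[OF riemann_linear(3)[OF x]] linear_cmul[OF riemann_linear(3)[OF x]] h_algebra[OF x]
      riemann_skew_diag[OF x] riemann_skew[OF x, of u v u v] power2_eq_square algebra_simps)
qed

lemma span_pair_cases:
  assumes "w \<in> span {u, v}"
  obtains a b where "w = a *\<^sub>R u + b *\<^sub>R v"
proof -
  obtain a where "w - a *\<^sub>R u \<in> span {v}" using assms span_breakdown_eq by blast
  then obtain b where "w - a *\<^sub>R u = b *\<^sub>R v" by (auto simp: span_singleton)
  then have "w = a *\<^sub>R u + b *\<^sub>R v" by (simp add: algebra_simps)
  then show ?thesis by (rule that)
qed

lemma curvature_quotient_basis_independent:
  assumes x: "x \<in> U" and span: "span {u', v'} = span {u, v}" and gram: "gram x u v \<noteq> 0"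
  shows "curv x u' v' / gram x u' v' = curv x u v / gram x u v" "gram x u' v' \<noteq> 0"
proof -
  have "u' \<in> span {u, v}" "v' \<in> span {u, v}" "u \<in> span {u', v'}" "v \<in> span {u', v'}"
    using span by (auto intro: span_base)
  then obtain a b c d a' b' c' d' where *: "u' = a *\<^sub>R u + b *\<^sub>R v" "v' = c *\<^sub>R u + d *\<^sub>R v"
    "u = a' *\<^sub>R u' + b' *\<^sub>R v'" "v = c' *\<^sub>R u' + d' *\<^sub>R v'"
    by (meson span_pair_cases)
  \<comment> \<open>Expressing the old basis in the new one shows that the new Gram determinant is
    nonzero; the reverse expression then shows that the change of basis is invertible.\<close>
  have "gram x u v = (a' * d' - b' * c')\<^sup>2 * gram x u' v'" using gram_change_basis[OF x] *(3,4) by metis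
  then show "gram x u' v' \<noteq> 0" using gram by auto
  moreover have "gram x u' v' = (a * d - b * c)\<^sup>2 * gram x u v" using gram_change_basis[OF x] *(1,2) by metis
  ultimately have "(a * d - b * c)\<^sup>2 \<noteq> 0" by auto
  moreover have "curv x u' v' = (a * d - b * c)\<^sup>2 * curv x u v" using curv_change_basis[OF x] *(1,2) by metis
  ultimately show "curv x u' v' / gram x u' v' = curv x u v / gram x u v"
    using \<open>gram x u' v' = _\<close> by simp
qed

end

section \<open>Randers metrics\<close>

text \<open>In the application \<open>b\<close> is the covector field dual to \<open>X\<close>, and
  the strict bound expresses that \<open>X\<close> has norm below 1.\<close>

locale randers = riemannian U h for U :: "'e::euclidean_space set" and h +
  fixes b L :: "'e \<Rightarrow> 'e \<Rightarrow> real"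
  assumes b_linear: "x \<in> U \<Longrightarrow> linear (b x)"
    and b_smooth: "smooth_on (\<lambda>x. b x u) U"
    and b_bound: "x \<in> U \<Longrightarrow> y \<noteq> 0 \<Longrightarrow> \<bar>b x y\<bar> < sqrt (h x y y)"
    and L_eq: "x \<in> U \<Longrightarrow> L x y = sqrt (h x y y) + b x y"
begin

abbreviation db :: "'e \<Rightarrow> 'e \<Rightarrow> 'e \<Rightarrow> real" where
  "db x z v \<equiv> frechet_derivative (\<lambda>x. b x v) (at x) z"

definition \<alpha> :: "'e \<Rightarrow> 'e \<Rightarrow> real" where "\<alpha> x y = sqrt (h x y y)"

text \<open>The differential of \<open>L x\<close> at \<open>y\<close>, applied to
  \<open>v\<close>.\<close>

definition ell :: "'e \<Rightarrow> 'e \<Rightarrow> 'e \<Rightarrow> real" where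
  "ell v x y = h x y v / \<alpha> x y + b x v"

lemma alpha_pos: "x \<in> U \<Longrightarrow> y \<noteq> 0 \<Longrightarrow> 0 < \<alpha> x y"
  by (simp add: \<alpha>_def h_pos)

lemma L_alpha: "x \<in> U \<Longrightarrow> L x y = \<alpha> x y + b x y"
  by (simp add: L_eq \<alpha>_def)

lemma alpha_square: "x \<in> U \<Longrightarrow> (\<alpha> x y)\<^sup>2 = h x y y"
  using h_pos[of x y] linear_0[OF h_linear(1)] by (cases "y = 0") (simp_all add: \<alpha>_def less_imp_le)

lemma L_pos: "x \<in> U \<Longrightarrow> y \<noteq> 0 \<Longrightarrow> 0 < L x y"
  using b_bound[of x y] L_eq[of x y] by auto

lemma b_differentiable: "x \<in> U \<Longrightarrow> (\<lambda>x. b x v) differentiable (at x)"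
  by (rule smooth_on_differentiable[OF b_smooth])

lemma db_linear:
  assumes "x \<in> U"
  shows "linear (\<lambda>z. db x z v)" "linear (\<lambda>v. db x z v)"
proof -
  show "linear (\<lambda>z. db x z v)"
    by (rule linear_frechet_derivative[OF b_differentiable[OF assms]])
  show "linear (\<lambda>v. db x z v)"
    by (rule linear_family_frechet_derivative[of U x b, OF open_U assms b_linear b_differentiable[OF assms]])
qed

lemmas db_algebra =
  linear_add[OF db_linear(1)] linear_diff[OF db_linear(1)] linear_cmul[OF db_linear(1)] linear_neg[OF db_linear(1)] linear_0[OF db_linear(1)]
  linear_add[OF db_linear(2)] linear_diff[OF db_linear(2)] linear_cmul[OF db_linear(2)] linear_neg[OF db_linear(2)] linear_0[OF db_linear(2)]

section \<open>Smoothness and derivatives of the Randers norm\<close>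

lemma smooth2_h: "smooth2 f \<Longrightarrow> smooth2 k \<Longrightarrow> smooth2 (\<lambda>x y. h x (f x y) (k x y))"
  unfolding smooth2_def
  by (rule smooth_on_bilinear_family[of W U h fst])
    (auto simp: open_W h_bilinear h_smooth in_W intro!: smooth_on_fst smooth_on_id)

lemma smooth2_b: "smooth2 f \<Longrightarrow> smooth2 (\<lambda>x y. b x (f x y))"
  unfolding smooth2_def
  by (rule smooth_on_linear_family[of W U b fst])
    (auto simp: open_W b_linear b_smooth in_W intro!: smooth_on_fst smooth_on_id)

lemma smooth2_alpha: "smooth2 \<alpha>"
  using smooth2_h[OF smooth2_snd smooth2_snd] unfolding smooth2_def \<alpha>_def
  by (intro smooth_intros open_W) (auto simp: in_W h_pos)

lemma smooth2_L: "smooth2 L"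
proof -
  have "smooth2 (\<lambda>x y. \<alpha> x y + b x y)"
    using smooth2_alpha smooth2_b[OF smooth2_snd] unfolding smooth2_def by (intro smooth_intros open_W)
  then show ?thesis by (rule smooth2_cong) (simp add: L_alpha)
qed

lemma alpha_vert:
  assumes x: "x \<in> U" "y \<noteq> 0"
  shows "((\<lambda>y. \<alpha> x y) has_derivative (\<lambda>u. h x y u / \<alpha> x y)) (at y)"
proof -
  have bb: "bounded_bilinear (h x)" using h_bilinear[OF x(1)] by (simp add: bilinear_conv_bounded_bilinear)
  have "((\<lambda>y. h x y y) has_derivative (\<lambda>u. h x y u + h x u y)) (at y)"
    by (rule bounded_bilinear.FDERIV[OF bb has_derivative_ident has_derivative_ident])
  moreover have "(sqrt has_derivative (\<lambda>k. inverse (\<alpha> x y) / 2 * k)) (at (h x y y))"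
    using DERIV_real_sqrt[OF h_pos[OF x]] unfolding has_field_derivative_def \<alpha>_def .
  ultimately have "((\<lambda>y. \<alpha> x y) has_derivative (\<lambda>u. inverse (\<alpha> x y) / 2 * (h x y u + h x u y))) (at y)"
    using diff_chain_at[of "\<lambda>y. h x y y" "\<lambda>u. h x y u + h x u y" y sqrt] by (simp add: o_def \<alpha>_def)
  moreover have "inverse (\<alpha> x y) / 2 * (h x y u + h x u y) = h x y u / \<alpha> x y" for u
    by (simp add: h_sym[OF x(1), of u y] field_simps)
  ultimately show ?thesis by simp
qed

lemma alpha_pos_deriv:
  assumes x: "x \<in> U" "y \<noteq> 0"
  shows "((\<lambda>x. \<alpha> x y) has_derivative (\<lambda>u. dh x u y y / (2 * \<alpha> x y))) (at x)"
proof -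
  have "(sqrt has_derivative (\<lambda>k. inverse (\<alpha> x y) / 2 * k)) (at (h x y y))"
    using DERIV_real_sqrt[OF h_pos[OF x]] unfolding has_field_derivative_def \<alpha>_def .
  then have "((\<lambda>x. \<alpha> x y) has_derivative (\<lambda>u. inverse (\<alpha> x y) / 2 * dh x u y y)) (at x)"
    using diff_chain_at[OF smooth_on_has_derivative[OF h_smooth x(1), of y y], of sqrt] by (simp add: o_def \<alpha>_def)
  moreover have "inverse (\<alpha> x y) / 2 * dh x u y y = dh x u y y / (2 * \<alpha> x y)" for u
    by (simp add: field_simps)
  ultimately show ?thesis by (simp only:)
qed

lemma L_vert:
  assumes x: "x \<in> U" "y \<noteq> 0"
  shows "((\<lambda>y. L x y) has_derivative (\<lambda>u. ell u x y)) (at y)"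
  unfolding L_alpha[OF x(1)] ell_def
  by (intro has_derivative_add alpha_vert[OF x] linear_imp_has_derivative b_linear x)

lemma L_pos_deriv:
  assumes x: "x \<in> U" "y \<noteq> 0"
  shows "((\<lambda>x. L x y) has_derivative (\<lambda>u. dh x u y y / (2 * \<alpha> x y) + db x u y)) (at x)"
  by (rule has_derivative_transform_within_open[OF _ open_U x(1)],
      rule has_derivative_add[OF alpha_pos_deriv[OF x] smooth_on_has_derivative[OF b_smooth x(1)]])
    (simp add: L_alpha)

text \<open>This is the Hessian of \<open>\<alpha>\<close>, to which the linear part
  \<open>b\<close> contributes nothing; multiplied by \<open>L\<close> it is the angular part of the
  fundamental tensor.\<close>

lemma ell_vert:
  assumes x: "x \<in> U" "y \<noteq> 0"
  shows "((\<lambda>y. ell v x y) has_derivative (\<lambda>u. h x u v / \<alpha> x y - h x y u * h x y v / (\<alpha> x y) ^ 3)) (at y)"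
proof -
  have a: "\<alpha> x y \<noteq> 0" using alpha_pos[OF x] by simp
  have "((\<lambda>y. h x y v / \<alpha> x y + b x v) has_derivative
      (\<lambda>u. (h x u v * \<alpha> x y - h x y v * (h x y u / \<alpha> x y)) / (\<alpha> x y * \<alpha> x y) + 0)) (at y)"
    by (intro has_derivative_add has_derivative_divide' alpha_vert[OF x] linear_imp_has_derivative
        h_linear(2) x has_derivative_const a)
  moreover have "(h x u v * \<alpha> x y - h x y v * (h x y u / \<alpha> x y)) / (\<alpha> x y * \<alpha> x y) + 0
      = h x u v / \<alpha> x y - h x y u * h x y v / (\<alpha> x y) ^ 3" for u
    using a by (simp add: divide_simps power3_eq_cube)
  ultimately show ?thesis unfolding ell_def by simp
qed

lemma ell_pos_deriv:
  assumes x: "x \<in> U" "y \<noteq> 0"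
  shows "((\<lambda>x. ell v x y) has_derivative
    (\<lambda>u. dh x u y v / \<alpha> x y - h x y v * dh x u y y / (2 * (\<alpha> x y) ^ 3) + db x u v)) (at x)"
proof -
  have a: "\<alpha> x y \<noteq> 0" using alpha_pos[OF x] by simp
  have "((\<lambda>x. h x y v / \<alpha> x y + b x v) has_derivative
      (\<lambda>u. (dh x u y v * \<alpha> x y - h x y v * (dh x u y y / (2 * \<alpha> x y))) / (\<alpha> x y * \<alpha> x y) + db x u v)) (at x)"
    by (intro has_derivative_add has_derivative_divide' alpha_pos_deriv[OF x] a
        smooth_on_has_derivative[OF b_smooth x(1)] smooth_on_has_derivative[OF h_smooth x(1)])
  moreover have "(dh x u y v * \<alpha> x y - h x y v * (dh x u y y / (2 * \<alpha> x y))) / (\<alpha> x y * \<alpha> x y) + db x u v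
      = dh x u y v / \<alpha> x y - h x y v * dh x u y y / (2 * (\<alpha> x y) ^ 3) + db x u v" for u
    using a by (simp add: divide_simps power3_eq_cube)
  ultimately show ?thesis unfolding ell_def by simp
qed

sublocale smooth_energy U L
proof
  show "smooth2 (\<lambda>x y. (L x y)\<^sup>2)"
    using smooth2_L unfolding smooth2_def power2_eq_square by (intro smooth_intros open_W)
qed

lemma Ev_eq: "x \<in> U \<Longrightarrow> y \<noteq> 0 \<Longrightarrow> vert_deriv E x y v = 2 * L x y * ell v x y"
proof -
  assume x: "x \<in> U" "y \<noteq> 0"
  have "((\<lambda>y. (L x y)\<^sup>2) has_derivative (\<lambda>u. 2 * L x y * ell u x y)) (at y)"
    unfolding power2_eq_square
    by (rule has_derivative_eq_rhs[OF has_derivative_mult[OF L_vert[OF x] L_vert[OF x]]]) (simp add: fun_eq_iff)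
  then show ?thesis by (rule vert_derivI)
qed

lemma fund_tensor_randers:
  assumes x: "x \<in> U" "y \<noteq> 0"
  shows "fund_tensor L x y u v =
    L x y * (h x u v / \<alpha> x y - h x y u * h x y v / (\<alpha> x y) ^ 3) + ell u x y * ell v x y"
proof -
  have "((\<lambda>y. 2 * L x y * ell v x y) has_derivative
     (\<lambda>u. 2 * L x y * (h x u v / \<alpha> x y - h x y u * h x y v / (\<alpha> x y) ^ 3) + 2 * ell u x y * ell v x y)) (at y)"
    by (intro has_derivative_mult bounded_linear.has_derivative[OF bounded_linear_mult_right] ell_vert L_vert x)
  then have "((\<lambda>y. vert_deriv E x y v) has_derivative
     (\<lambda>u. 2 * L x y * (h x u v / \<alpha> x y - h x y u * h x y v / (\<alpha> x y) ^ 3) + 2 * ell u x y * ell v x y)) (at y)"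
    by (rule has_derivative_transform_within_open[of _ _ _ _ "- {0}"]) (use x in \<open>simp_all add: Ev_eq open_Compl\<close>)
  note eq = vert_derivI[of "Ev v", OF this]
  have "(2 * l * a + 2 * c * d) / 2 = l * a + c * d" for l a c d :: real by simp
  then show ?thesis by (simp only: fund_tensor_eq[OF x] eq)
qed

text \<open>The angular part of the fundamental tensor vanishes only on multiples of \<open>y\<close>, where \<open>ell\<close> does not.\<close>

lemma fund_tensor_randers_diag:
  assumes x: "x \<in> U" "y \<noteq> 0"
  shows "fund_tensor L x y u u = L x y / (\<alpha> x y) ^ 3 * gram x u y + (ell u x y)\<^sup>2"
proof -
  have "h x y y * h x u u / (\<alpha> x y) ^ 3 = h x u u / \<alpha> x y"
    using alpha_pos[OF x] by (simp add: alpha_square[OF x(1), of y, symmetric] power2_eq_square power3_eq_cube)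
  then show ?thesis
    by (simp add: fund_tensor_randers[OF x] gram_def power2_eq_square right_diff_distrib diff_divide_distrib
        flip: times_divide_eq_right)
qed

lemma ell_position: "x \<in> U \<Longrightarrow> y \<noteq> 0 \<Longrightarrow> ell y x y = L x y"
  using alpha_pos[of x y]
  by (simp add: ell_def L_alpha power2_eq_square flip: alpha_square)

lemma ell_linear: "x \<in> U \<Longrightarrow> linear (\<lambda>u. ell u x y)"
  using h_linear(1)[of x y] b_linear[of x] by (auto simp: linear_iff ell_def add_divide_distrib algebra_simps)

sublocale finsler U L
proof
  show "homogeneous 1 L"
    unfolding homogeneous_def
  proof (intro ballI allI impI)
    fix x y :: 'e and c :: real assume x: "x \<in> U" "y \<noteq> 0" "c > 0"
    have "h x (c *\<^sub>R y) (c *\<^sub>R y) = c\<^sup>2 * h x y y"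
      by (simp add: h_algebra[OF x(1)] power2_eq_square)
    then show "L x (c *\<^sub>R y) = c ^ 1 *\<^sub>R L x y"
      using x(3) by (simp add: L_alpha[OF x(1)] \<alpha>_def linear_cmul[OF b_linear[OF x(1)]] real_sqrt_mult algebra_simps)
  qed
next
  fix x y u :: 'e assume x: "x \<in> U" "y \<noteq> 0" and u: "u \<noteq> 0"
  have c: "0 < L x y / (\<alpha> x y) ^ 3" using L_pos[OF x] alpha_pos[OF x] by simp
  show "0 < fund_tensor L x y u u"
  proof (cases "\<exists>t. u = t *\<^sub>R y")
    case True
    then obtain t where t: "u = t *\<^sub>R y" by blast
    then have "ell u x y = t * L x y" by (simp add: linear_cmul[OF ell_linear[OF x(1)]] ell_position[OF x])
    moreover have "gram x u y = 0"
      by (simp add: t gram_def h_algebra[OF x(1)] power2_eq_square)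
    ultimately show ?thesis using t u L_pos[OF x] by (simp add: fund_tensor_randers_diag[OF x])
  next
    case False
    then have "0 < gram x u y" by (intro gram_pos x) auto
    then have "0 < L x y / (\<alpha> x y) ^ 3 * gram x u y" using c by (rule mult_pos_pos[rotated])
    then show ?thesis by (simp add: fund_tensor_randers_diag[OF x] add_pos_nonneg)
  qed
qed

section \<open>The spray of a Randers metric\<close>

lemma spray_form_randers:
  assumes x: "x \<in> U" "y \<noteq> 0"
  shows "spray_form w x y = (ell w x y * (dh x y y y / (2 * \<alpha> x y) + db x y y)
    + L x y * (dh x y y w / \<alpha> x y - h x y w * dh x y y y / (2 * (\<alpha> x y) ^ 3) + db x y w
       - dh x w y y / (2 * \<alpha> x y) - db x w y)) / 2"
proof -
  have "((\<lambda>x. 2 * L x y * ell w x y) has_derivative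
     (\<lambda>u. 2 * L x y * (dh x u y w / \<alpha> x y - h x y w * dh x u y y / (2 * (\<alpha> x y) ^ 3) + db x u w)
       + 2 * (dh x u y y / (2 * \<alpha> x y) + db x u y) * ell w x y)) (at x)"
    by (intro has_derivative_mult bounded_linear.has_derivative[OF bounded_linear_mult_right] ell_pos_deriv L_pos_deriv x)
  then have "((\<lambda>x. vert_deriv E x y w) has_derivative
     (\<lambda>u. 2 * L x y * (dh x u y w / \<alpha> x y - h x y w * dh x u y y / (2 * (\<alpha> x y) ^ 3) + db x u w)
       + 2 * (dh x u y y / (2 * \<alpha> x y) + db x u y) * ell w x y)) (at x)"
    by (rule has_derivative_transform_within_open[OF _ open_U x(1)]) (simp add: Ev_eq x)
  note 1 = pos_derivI[of "Ev w", OF this]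
  have "((\<lambda>x. (L x y)\<^sup>2) has_derivative (\<lambda>u. 2 * L x y * (dh x u y y / (2 * \<alpha> x y) + db x u y))) (at x)"
    unfolding power2_eq_square
    by (rule has_derivative_eq_rhs[OF has_derivative_mult[OF L_pos_deriv[OF x] L_pos_deriv[OF x]]])
      (simp add: fun_eq_iff algebra_simps)
  note 2 = pos_derivI[of E, OF this]
  show ?thesis unfolding spray_form_def 1 2 by (simp add: algebra_simps add_divide_distrib diff_divide_distrib)
qed

text \<open>The candidate is verified in the spray equation. The fundamental tensor and the
  right-hand side both split into \<open>L\<close> times an angular expression and a multiple of
  \<open>ell w x y\<close>, so the two identities \<open>ang\<close> and \<open>ell\<close>
  suffice.\<close>

lemma spray_randers:
  assumes x: "x \<in> U" "y \<noteq> 0" and S: "\<And>w. h x S w = (db x y w - db x w y) / 2"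
  shows "spray L x y = (1/2) *\<^sub>R chr x y y
    + ((db x y y - b x (chr x y y) - 2 * \<alpha> x y * b x S) / (2 * L x y)) *\<^sub>R y + \<alpha> x y *\<^sub>R S"
    (is "_ = ?\<xi>")
proof (rule spray_eqI[OF x])
  fix w
  \<comment> \<open>The coefficient of \<open>y\<close> has no effect on the angular part, where
    \<open>y\<close> is a null vector. It is fixed by the identity \<open>ell\<close>, and
    \<open>ell y x y = L x y\<close> explains its denominator.\<close>
  define P where "P = (db x y y - b x (chr x y y) - 2 * \<alpha> x y * b x S) / (2 * L x y)"
  have a: "\<alpha> x y \<noteq> 0" and L: "L x y \<noteq> 0" using alpha_pos[OF x] L_pos[OF x] by auto
  have P: "P * L x y = (db x y y - b x (chr x y y)) / 2 - \<alpha> x y * b x S"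
    using L by (simp add: P_def field_simps)
  have c: "h x (chr x y y) v = dh x y y v - dh x v y y / 2" for v
    by (simp add: chr_equation[OF x(1)] field_simps)
  have hx: "h x ?\<xi> v = h x (chr x y y) v / 2 + P * h x y v + \<alpha> x y * h x S v" for v
    by (simp add: P_def h_algebra[OF x(1)])
  have hy: "h x y ?\<xi> = dh x y y y / 4 + P * (\<alpha> x y)\<^sup>2"
    by (subst h_sym[OF x(1)]) (simp only: hx c S alpha_square[OF x(1)], simp)
  have ell: "ell ?\<xi> x y = (dh x y y y / (2 * \<alpha> x y) + db x y y) / 2"
  proof -
    have "ell ?\<xi> x y = h x y ?\<xi> / \<alpha> x y + b x (chr x y y) / 2 + P * b x y + \<alpha> x y * b x S"
      by (simp add: ell_def P_def linear_add[OF b_linear[OF x(1)]] linear_cmul[OF b_linear[OF x(1)]])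
    also have "h x y ?\<xi> / \<alpha> x y = dh x y y y / (4 * \<alpha> x y) + P * \<alpha> x y"
      using a by (simp add: hy power2_eq_square add_divide_distrib)
    also have "dh x y y y / (4 * \<alpha> x y) + P * \<alpha> x y + b x (chr x y y) / 2 + P * b x y + \<alpha> x y * b x S
       = dh x y y y / (4 * \<alpha> x y) + P * L x y + b x (chr x y y) / 2 + \<alpha> x y * b x S"
      by (simp add: L_alpha[OF x(1)] algebra_simps)
    finally show ?thesis unfolding P by (simp add: field_simps)
  qed
  have ang: "h x ?\<xi> w / \<alpha> x y - h x y ?\<xi> * h x y w / (\<alpha> x y) ^ 3
     = (dh x y y w / \<alpha> x y - h x y w * dh x y y y / (2 * (\<alpha> x y) ^ 3) + db x y w
       - dh x w y y / (2 * \<alpha> x y) - db x w y) / 2"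
    unfolding hx hy c S using a by (simp add: divide_simps power2_eq_square power3_eq_cube) (simp add: algebra_simps)
  have id: "l * (X / 2) + (Y / 2) * e = (e * Y + l * X) / 2" for l X Y e :: real
    by (simp add: field_simps)
  show "fund_tensor L x y ?\<xi> w = spray_form w x y"
    unfolding fund_tensor_randers[OF x] spray_form_randers[OF x] ell ang by (rule id)
qed

text \<open>Comparing the spray at \<open>y\<close> and \<open>-y\<close> cancels the quadratic part and leaves the skew part of the derivative
  of \<open>b\<close>, which is orthogonal to \<open>y\<close>.\<close>

lemma douglas_imp_closed:
  assumes x: "x \<in> U" and B: "bilinear B"
    and spray: "\<And>y. y \<noteq> 0 \<Longrightarrow> spray L x y = (1/2) *\<^sub>R B y y + Q y *\<^sub>R y"
  shows "db x y w = db x w y"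
proof (cases "y = 0")
  case True
  then show ?thesis by (simp add: db_algebra[OF x])
next
  case y: False
  then have my: "- y \<noteq> 0" by simp
  have "linear (\<lambda>w. (db x y w - db x w y) / 2)"
    using db_linear(2)[OF x, of y] db_linear(1)[OF x, of y] by (auto simp: linear_iff algebra_simps diff_divide_distrib add_divide_distrib)
  from bilinear_solution_ex1[where B = "h x", OF h_bilinear[OF x] h_pos[OF x] this]
  obtain S where S: "\<And>w. h x S w = (db x y w - db x w y) / 2" by blast
  \<comment> \<open>The skew part of the derivative is linear in \<open>y\<close>, so
    \<open>- S\<close> solves the system at \<open>- y\<close>, while the norm takes the same value
    at both points.\<close>
  have mS: "h x (- S) w = (db x (- y) w - db x w (- y)) / 2" for w
    by (simp add: h_algebra[OF x] db_algebra[OF x] S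
        minus_divide_left)
  obtain P P' where "(1/2) *\<^sub>R chr x y y + P *\<^sub>R y + \<alpha> x y *\<^sub>R S = (1/2) *\<^sub>R B y y + Q y *\<^sub>R y"
    and "(1/2) *\<^sub>R chr x (- y) (- y) + P' *\<^sub>R (- y) + \<alpha> x (- y) *\<^sub>R (- S) = (1/2) *\<^sub>R B (- y) (- y) + Q (- y) *\<^sub>R (- y)"
    using spray_randers[OF x y S] spray_randers[OF x my mS] spray[OF y] spray[OF my] by metis
  then have "(1/2) *\<^sub>R chr x y y + P *\<^sub>R y + \<alpha> x y *\<^sub>R S = (1/2) *\<^sub>R B y y + Q y *\<^sub>R y"
    and "(1/2) *\<^sub>R chr x y y - P' *\<^sub>R y - \<alpha> x y *\<^sub>R S = (1/2) *\<^sub>R B y y - Q (- y) *\<^sub>R y"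
    by (simp_all add: \<alpha>_def h_algebra[OF x]
        chr_algebra[OF x] bilinear_lneg[OF B] bilinear_rneg[OF B])
  then have "((1/2) *\<^sub>R chr x y y + P *\<^sub>R y + \<alpha> x y *\<^sub>R S) - ((1/2) *\<^sub>R chr x y y - P' *\<^sub>R y - \<alpha> x y *\<^sub>R S)
     = ((1/2) *\<^sub>R B y y + Q y *\<^sub>R y) - ((1/2) *\<^sub>R B y y - Q (- y) *\<^sub>R y)" by simp
  then have "(2 * \<alpha> x y) *\<^sub>R S = (Q y + Q (- y) - P - P') *\<^sub>R y"
    by (simp add: algebra_simps scaleR_2 flip: scaleR_scaleR)
  then obtain c where c: "(2 * \<alpha> x y) *\<^sub>R S = c *\<^sub>R y" by blast
  have "h x ((2 * \<alpha> x y) *\<^sub>R S) y = 0" by (simp add: h_algebra[OF x] S)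
  then have "c * h x y y = 0" unfolding c by (simp add: linear_cmul[OF h_linear(2)[OF x]])
  then have "S = 0" using c h_pos[OF x y] alpha_pos[OF x y] by auto
  then show ?thesis using S[of w] by (simp add: h_algebra[OF x])
qed

end

section \<open>Flag curvature for closed covector fields\<close>

locale closed_randers = randers U h b L for U :: "'e::euclidean_space set" and h b L +
  assumes b_closed: "x \<in> U \<Longrightarrow> db x u w = db x w u"
begin

definition r :: "'e \<Rightarrow> 'e \<Rightarrow> real" where "r x y = db x y y - b x (chr x y y)"

definition P :: "'e \<Rightarrow> 'e \<Rightarrow> real" where "P x y = r x y / (2 * L x y)"

lemma spray_closed:
  assumes x: "x \<in> U" "y \<noteq> 0"
  shows "spray L x y = (1/2) *\<^sub>R chr x y y + P x y *\<^sub>R y"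
proof -
  have "h x 0 w = (db x y w - db x w y) / 2" for w
    using b_closed[OF x(1), of y w] by (simp add: h_algebra[OF x(1)])
  from spray_randers[OF x this] show ?thesis
    by (simp add: P_def r_def linear_0[OF b_linear[OF x(1)]])
qed

lemma smooth2_chr: "smooth2 f \<Longrightarrow> smooth2 k \<Longrightarrow> smooth2 (\<lambda>x y. chr x (f x y) (k x y))"
  unfolding smooth2_def
  by (rule smooth_on_bilinear_family[of W U chr fst])
    (auto simp: open_W chr_bilinear chr_smooth in_W intro!: smooth_on_fst smooth_on_id)

lemma smooth2_db: "smooth2 f \<Longrightarrow> smooth2 k \<Longrightarrow> smooth2 (\<lambda>x y. db x (f x y) (k x y))"
  unfolding smooth2_def
  by (rule smooth_on_bilinear_family[of W U "\<lambda>x u v. db x u v" fst])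
    (auto simp: open_W bilinear_def db_linear in_W intro!: smooth_on_fst smooth_on_id
      smooth_on_frechet_derivative[OF b_smooth])

lemma smooth2_r: "smooth2 r"
  using smooth2_db[OF smooth2_snd smooth2_snd] smooth2_b[OF smooth2_chr[OF smooth2_snd smooth2_snd]]
  unfolding smooth2_def r_def by (intro smooth_intros open_W)

lemma smooth2_P: "smooth2 P"
  using smooth2_r smooth2_L unfolding smooth2_def P_def
  by (intro smooth_intros open_W) (auto simp: in_W L_pos)

lemma homogeneous_P: "homogeneous 1 P"
  unfolding homogeneous_def
proof (intro ballI allI impI)
  fix x y :: 'e and c :: real assume x: "x \<in> U" "y \<noteq> 0" "c > 0"
  have "r x (c *\<^sub>R y) = c\<^sup>2 * r x y"
    by (simp add: r_def db_algebra[OF x(1)]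
        chr_algebra[OF x(1)]
        linear_cmul[OF b_linear[OF x(1)]] power2_eq_square algebra_simps)
  moreover have "L x (c *\<^sub>R y) = c * L x y" using homogeneousD[OF L_homogeneous x] by simp
  ultimately show "P x (c *\<^sub>R y) = c ^ 1 *\<^sub>R P x y" using x(3) by (simp add: P_def power2_eq_square)
qed

lemma vert_P_position: "x \<in> U \<Longrightarrow> y \<noteq> 0 \<Longrightarrow> vert_deriv P x y y = P x y"
  using euler[OF smooth2_P homogeneous_P] by simp

lemma N_closed:
  assumes x: "x \<in> U" "y \<noteq> 0"
  shows "N u x y = chr x y u + vert_deriv P x y u *\<^sub>R y + P x y *\<^sub>R u"
proof -
  have bb: "bounded_bilinear (chr x)" using chr_bilinear[OF x(1)] by (simp add: bilinear_conv_bounded_bilinear)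
  have "((\<lambda>y. (1/2) *\<^sub>R chr x y y + P x y *\<^sub>R y) has_derivative
     (\<lambda>u. (1/2) *\<^sub>R (chr x y u + chr x u y) + (P x y *\<^sub>R u + vert_deriv P x y u *\<^sub>R y))) (at y)"
    by (intro has_derivative_add has_derivative_scaleR_right has_derivative_scaleR has_derivative_ident
        bounded_bilinear.FDERIV[OF bb] has_derivative_vert[OF smooth2_P x])
  then have "((\<lambda>y. spray L x y) has_derivative
     (\<lambda>u. (1/2) *\<^sub>R (chr x y u + chr x u y) + (P x y *\<^sub>R u + vert_deriv P x y u *\<^sub>R y))) (at y)"
    by (rule has_derivative_transform_within_open[of _ _ _ _ "- {0}"]) (use x in \<open>simp_all add: spray_closed open_Compl\<close>)
  from vert_derivI[of G, OF this] show ?thesis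
    by (simp add: chr_sym[OF x(1), of u y] scaleR_2[symmetric] del: scaleR_half_double)
qed

lemma N_closed_position: "x \<in> U \<Longrightarrow> y \<noteq> 0 \<Longrightarrow> N y x y = chr x y y + (2 * P x y) *\<^sub>R y"
  by (simp add: N_closed vert_P_position algebra_simps flip: scaleR_add_left)

lemma pos_N_closed:
  assumes x: "x \<in> U" "y \<noteq> 0"
  shows "pos_deriv (N w) x y z = dchr x z y w + pos_deriv (\<lambda>x y. vert_deriv P x y w) x y z *\<^sub>R y
    + pos_deriv P x y z *\<^sub>R w"
proof -
  have "((\<lambda>x. chr x y w + vert_deriv P x y w *\<^sub>R y + P x y *\<^sub>R w) has_derivative
    (\<lambda>z. dchr x z y w + pos_deriv (\<lambda>x y. vert_deriv P x y w) x y z *\<^sub>R y + pos_deriv P x y z *\<^sub>R w)) (at x)"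
    by (intro has_derivative_add bounded_linear.has_derivative[OF bounded_linear_scaleR_left]
        smooth_on_has_derivative[OF chr_smooth x(1)] has_derivative_pos smooth2_vert_deriv smooth2_P x)
  then have "((\<lambda>x. N w x y) has_derivative
    (\<lambda>z. dchr x z y w + pos_deriv (\<lambda>x y. vert_deriv P x y w) x y z *\<^sub>R y + pos_deriv P x y z *\<^sub>R w)) (at x)"
    by (rule has_derivative_transform_within_open[OF _ open_U x(1)]) (simp add: N_closed x)
  then show ?thesis by (rule pos_derivI)
qed

lemma vert_N_closed:
  assumes x: "x \<in> U" "y \<noteq> 0"
  shows "vert_deriv (N w) x y z = chr x z w + vert_deriv (\<lambda>x y. vert_deriv P x y w) x y z *\<^sub>R y
    + vert_deriv P x y w *\<^sub>R z + vert_deriv P x y z *\<^sub>R w"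
proof -
  have "((\<lambda>y. chr x y w + vert_deriv P x y w *\<^sub>R y + P x y *\<^sub>R w) has_derivative
    (\<lambda>z. chr x z w + (vert_deriv P x y w *\<^sub>R z + vert_deriv (\<lambda>x y. vert_deriv P x y w) x y z *\<^sub>R y)
      + vert_deriv P x y z *\<^sub>R w)) (at y)"
    by (intro has_derivative_add bounded_linear.has_derivative[OF bounded_linear_scaleR_left] has_derivative_scaleR
        has_derivative_ident linear_imp_has_derivative chr_linear(2) has_derivative_vert smooth2_vert_deriv smooth2_P x)
  then have "((\<lambda>y. N w x y) has_derivative
    (\<lambda>z. chr x z w + (vert_deriv P x y w *\<^sub>R z + vert_deriv (\<lambda>x y. vert_deriv P x y w) x y z *\<^sub>R y)
      + vert_deriv P x y z *\<^sub>R w)) (at y)"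
    by (rule has_derivative_transform_within_open[of _ _ _ _ "- {0}"]) (use x in \<open>simp_all add: N_closed open_Compl\<close>)
  from vert_derivI[of "N w", OF this] show ?thesis by (simp add: add_ac)
qed

lemma dchr_sym: "x \<in> U \<Longrightarrow> dchr x z u v = dchr x z v u"
  by (rule fun_cong[OF frechet_derivative_cong_open[OF open_U]]) (auto simp: chr_sym)

text \<open>\<open>pos_deriv P x y y - vert_deriv P x y (chr x y y)\<close> is the derivative of
  \<open>P\<close> along the geodesic spray of \<open>h\<close>, whose components at
  \<open>(x, y)\<close> are \<open>y\<close> and \<open>- chr x y y\<close>.\<close>

definition \<Xi> :: "'e \<Rightarrow> 'e \<Rightarrow> real" where
  "\<Xi> x y = (P x y)\<^sup>2 - pos_deriv P x y y + vert_deriv P x y (chr x y y)"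

text \<open>The spray of the Randers metric is projectively related to that of \<open>h\<close>, so that the flag operators
  agree up to multiples of \<open>u\<close> and \<open>y\<close>.\<close>

lemma flag_operator_closed:
  assumes x: "x \<in> U" "y \<noteq> 0"
  obtains c where "flag_operator L x y u = riemann_curvature h x u y y + \<Xi> x y *\<^sub>R u + c *\<^sub>R y"
proof -
  \<comment> \<open>\<open>A1\<close> to \<open>A4\<close> and \<open>q\<close> only feed the
    coefficient of \<open>y\<close>. They stay unevaluated, since that coefficient has no effect on
    the flag curvature.\<close>
  define A1 where "A1 = pos_deriv (\<lambda>x y'. vert_deriv P x y' y) x y u"
  define A2 where "A2 = vert_deriv (\<lambda>x y'. vert_deriv P x y' y) x y (N u x y)"
  define A3 where "A3 = pos_deriv (\<lambda>x y'. vert_deriv P x y' u) x y y"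
  define A4 where "A4 = vert_deriv (\<lambda>x y'. vert_deriv P x y' u) x y (N y x y)"
  define p where "p = P x y"
  define pu where "pu = vert_deriv P x y u"
  define q where "q = pos_deriv P x y u - vert_deriv P x y (N u x y)"
  have "flag_operator L x y u =
     (dchr x u y y + A1 *\<^sub>R y + pos_deriv P x y u *\<^sub>R y)
     - (chr x (N u x y) y + A2 *\<^sub>R y + p *\<^sub>R N u x y + vert_deriv P x y (N u x y) *\<^sub>R y)
     - (dchr x y y u + A3 *\<^sub>R y + pos_deriv P x y y *\<^sub>R u)
     + (chr x (N y x y) u + A4 *\<^sub>R y + pu *\<^sub>R N y x y + vert_deriv P x y (N y x y) *\<^sub>R u)"
    unfolding flag_operator_eq[OF x] pos_N_closed[OF x] vert_N_closed[OF x] A1_def A2_def A3_def A4_def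
      p_def pu_def vert_P_position[OF x] ..
  \<comment> \<open>Euler's theorem for the 1-homogeneous \<open>P\<close>. Of
    \<open>2 * p * p\<close> one square is consumed by the term \<open>p *\<^sub>R N u x y\<close>,
    and the other is the square of \<open>P\<close> in \<open>\<Xi>\<close>.\<close>
  also have "vert_deriv P x y (N y x y) = vert_deriv P x y (chr x y y) + 2 * p * p"
    by (simp add: N_closed_position[OF x] linear_add[OF linear_vert_deriv[OF smooth2_P x]]
        linear_cmul[OF linear_vert_deriv[OF smooth2_P x]] vert_P_position[OF x] p_def)
  also have "chr x (N y x y) u = chr x u (chr x y y) + (2 * p) *\<^sub>R chr x y u"
    by (simp add: N_closed_position[OF x] chr_algebra[OF x(1)] chr_sym[OF x(1), of "chr x y y"]
        chr_algebra[OF x(1)] p_def)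
  also have "chr x (N u x y) y = chr x y (chr x u y) + pu *\<^sub>R chr x y y + p *\<^sub>R chr x y u"
    by (simp add: N_closed[OF x] chr_algebra[OF x(1)] chr_sym[OF x(1), of "chr x y u"]
        chr_sym[OF x(1), of u y] chr_algebra[OF x(1)] p_def pu_def)
  finally have "flag_operator L x y u = riemann_curvature h x u y y + \<Xi> x y *\<^sub>R u
      + (A1 - A2 - A3 + A4 + q + p * pu) *\<^sub>R y"
    unfolding riemann_curvature_eq[OF x(1)] \<Xi>_def N_closed_position[OF x] N_closed[OF x, of u]
      p_def[symmetric] pu_def[symmetric] q_def dchr_sym[OF x(1), of y u y]
      mult_2 distrib_right scaleR_add_left
    by (simp add: algebra_simps power2_eq_square)
  then show thesis by (rule that)
qed

definition Sr :: "'e \<Rightarrow> 'e \<Rightarrow> real" where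
  "Sr x y = pos_deriv r x y y - vert_deriv r x y (chr x y y)"

text \<open>Let a prime denote the derivative along the geodesic spray of \<open>h\<close>, so that
  \<open>Sr\<close> is r'. There \<alpha> is constant and b' = r, hence L' = r, which is the fact
  \<open>SL\<close>. For P = r / (2 L) this gives P' = r' / (2 L) - r^2 / (2 L^2), while P^2 = r^2 /
  (4 L^2); the coefficient 3 in P^2 - P' is 1 + 2 over the common denominator 4 L^2.\<close>

lemma Xi_eq:
  assumes x: "x \<in> U" "y \<noteq> 0"
  shows "\<Xi> x y = (3 * (r x y)\<^sup>2 - 2 * L x y * Sr x y) / (4 * (L x y)\<^sup>2)"
proof -
  have L: "L x y \<noteq> 0" using L_pos[OF x] by simp
  have quotient: "(p * (2 * l) - k * (2 * q)) / ((2 * l) * (2 * l)) = p / (2 * l) - k * q / (2 * l\<^sup>2)"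
    if "l \<noteq> 0" for p q k l :: real
    using that by (simp add: divide_simps power2_eq_square)
  have "((\<lambda>y. P x y) has_derivative (\<lambda>z. (vert_deriv r x y z * (2 * L x y) - r x y * (2 * ell z x y)) / ((2 * L x y) * (2 * L x y)))) (at y)"
    unfolding P_def using L
    by (intro has_derivative_divide' has_derivative_vert smooth2_r x
        bounded_linear.has_derivative[OF bounded_linear_mult_right] L_vert) auto
  note vert = vert_derivI[of P, OF this, unfolded quotient[OF L]]
  have "((\<lambda>x. P x y) has_derivative (\<lambda>z. (pos_deriv r x y z * (2 * L x y)
      - r x y * (2 * (dh x z y y / (2 * \<alpha> x y) + db x z y))) / ((2 * L x y) * (2 * L x y)))) (at x)"
    unfolding P_def using L
    by (intro has_derivative_divide' has_derivative_pos smooth2_r x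
        bounded_linear.has_derivative[OF bounded_linear_mult_right] L_pos_deriv) auto
  note pos = pos_derivI[of P, OF this, unfolded quotient[OF L]]
  have hc: "h x y (chr x y y) = dh x y y y / 2"
    by (subst h_sym[OF x(1)]) (simp add: chr_equation[OF x(1)])
  have SL: "dh x y y y / (2 * \<alpha> x y) + db x y y = ell (chr x y y) x y + r x y"
    by (simp add: ell_def r_def hc)
  show ?thesis
    unfolding \<Xi>_def pos vert SL P_def Sr_def using L
    by (simp add: divide_simps power2_eq_square) (simp add: algebra_simps)
qed

lemma flag_quotient:
  assumes x: "x \<in> U" "y \<noteq> 0" and gram: "gram x u y \<noteq> 0"
  shows "fund_tensor L x y (flag_operator L x y u) u /
      (fund_tensor L x y y y * fund_tensor L x y u u - (fund_tensor L x y y u)\<^sup>2)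
    = h x y y / (L x y)\<^sup>2 * (curv x u y / gram x u y)
      + (3 * (r x y)\<^sup>2 - 2 * L x y * Sr x y) / (4 * (L x y) ^ 4)"
proof -
  define R where "R = flag_operator L x y u"
  obtain c where R: "R = riemann_curvature h x u y y + \<Xi> x y *\<^sub>R u + c *\<^sub>R y"
    using flag_operator_closed[OF x, of u] unfolding R_def by blast
  have L: "L x y \<noteq> 0" and a: "\<alpha> x y \<noteq> 0" using L_pos[OF x] alpha_pos[OF x] by auto
  \<comment> \<open>The flag operator is orthogonal to \<open>y\<close>, so only the angular part of
    the fundamental tensor acts on \<open>R\<close>. That part annihilates \<open>y\<close>, and the
    unknown \<open>c\<close> cancels in \<open>num\<close>.\<close>
  have "ell R x y = 0"
    using energy_flag_operator[OF x, of u] L by (simp add: Ev_eq[OF x] R_def)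
  moreover have "h x R u = curv x u y + \<Xi> x y * h x u u + c * h x y u"
    by (simp add: R curv_def h_algebra[OF x(1)])
  moreover have "h x y R = \<Xi> x y * h x y u + c * h x y y"
    by (simp add: R h_algebra[OF x(1)]
        h_sym[OF x(1), of y "riemann_curvature h x u y y"] riemann_skew_diag[OF x(1)])
  ultimately have num: "fund_tensor L x y R u = L x y / (\<alpha> x y) ^ 3 * (h x y y * curv x u y + \<Xi> x y * gram x u y)"
    using a by (simp add: fund_tensor_randers[OF x] gram_def alpha_square[OF x(1), of y, symmetric] divide_simps
        power2_eq_square power3_eq_cube) (simp add: algebra_simps)
  have yy: "fund_tensor L x y y y = (L x y)\<^sup>2"
    using fund_tensor_randers_diag[OF x, of y] by (simp add: gram_def ell_position[OF x] power2_eq_square)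
  have yu: "fund_tensor L x y y u = L x y * ell u x y"
    using a by (simp add: fund_tensor_randers[OF x] ell_position[OF x] alpha_square[OF x(1), of y, symmetric] divide_simps
        power2_eq_square power3_eq_cube)
  \<comment> \<open>The squares of \<open>ell\<close> cancel, leaving \<open>L\<^sup>2\<close> times
    the angular part, itself the Gram determinant of \<open>h\<close> up to the factor
    \<open>L / \<alpha>^3\<close> that the numerator carries as well.\<close>
  have den: "fund_tensor L x y y y * fund_tensor L x y u u - (fund_tensor L x y y u)\<^sup>2
     = (L x y)\<^sup>2 * (L x y / (\<alpha> x y) ^ 3 * gram x u y)"
    unfolding yy yu fund_tensor_randers_diag[OF x, of u] by (simp add: algebra_simps power_mult_distrib)
  have "(k * (hh * C + X * g)) / (l\<^sup>2 * (k * g)) = hh / l\<^sup>2 * (C / g) + X / l\<^sup>2"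
    if "k \<noteq> 0" "l \<noteq> 0" "g \<noteq> 0" for k hh C X g l :: real
    using that by (simp add: divide_simps)
  from this[of "L x y / (\<alpha> x y) ^ 3" "L x y" "gram x u y" "h x y y" "curv x u y" "\<Xi> x y"]
  have "fund_tensor L x y R u / (fund_tensor L x y y y * fund_tensor L x y u u - (fund_tensor L x y y u)\<^sup>2)
    = h x y y / (L x y)\<^sup>2 * (curv x u y / gram x u y) + \<Xi> x y / (L x y)\<^sup>2"
    unfolding num den using L a gram by simp
  moreover have "\<Xi> x y / (L x y)\<^sup>2 = (3 * (r x y)\<^sup>2 - 2 * L x y * Sr x y) / (4 * (L x y) ^ 4)"
    unfolding Xi_eq[OF x] by (simp add: power2_eq_square power4_eq_xxxx)
  ultimately show ?thesis by (simp add: R_def)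
qed

end

section \<open>Left invariant data\<close>

text \<open>\<open>fr u\<close> stands for the left invariant field with value \<open>u\<close> at the identity \<open>x\<^sub>0\<close>, and \<open>br\<close> for the Lie bracket.\<close>

locale invariant_randers = closed_randers U h b L for U :: "'e::euclidean_space set" and h b L +
  fixes x\<^sub>0 X\<^sub>0 :: 'e and fr :: "'e \<Rightarrow> 'e \<Rightarrow> 'e" and br :: "'e \<Rightarrow> 'e \<Rightarrow> 'e"
  assumes x0: "x\<^sub>0 \<in> U"
    and fr_smooth: "smooth_on (fr u) U"
    and fr_linear: "x \<in> U \<Longrightarrow> linear (\<lambda>u. fr u x)"
    and fr_x0: "fr u x\<^sub>0 = u"
    and h_fr: "x \<in> U \<Longrightarrow> h x (fr u x) (fr v x) = h x\<^sub>0 u v"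
    and b_fr: "x \<in> U \<Longrightarrow> b x (fr v x) = h x\<^sub>0 X\<^sub>0 v"
    and br_fr: "x \<in> U \<Longrightarrow> frechet_derivative (fr v) (at x) (fr u x) - frechet_derivative (fr u) (at x) (fr v x)
       = fr (br u v) x"
begin

abbreviation dfr :: "'e \<Rightarrow> 'e \<Rightarrow> 'e \<Rightarrow> 'e" where "dfr v x z \<equiv> frechet_derivative (fr v) (at x) z"

lemma fr_derivative: "x \<in> U \<Longrightarrow> (fr u has_derivative dfr u x) (at x)"
  by (rule smooth_on_has_derivative[OF fr_smooth])

lemma br_eq: "br u v = dfr v x\<^sub>0 u - dfr u x\<^sub>0 v"
  using br_fr[OF x0, of v u] by (simp add: fr_x0)

lemma br_antisym: "br u v = - br v u"
  by (simp add: br_eq)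

lemma br_linear: "linear (br u)"
proof -
  have "linear (\<lambda>v. dfr v x\<^sub>0 u)"
    by (rule linear_family_frechet_derivative[of U x\<^sub>0 "\<lambda>x v. fr v x", OF open_U x0 fr_linear
        differentiableI[OF fr_derivative[OF x0]]])
  moreover have "linear (dfr u x\<^sub>0)" by (rule has_derivative_linear[OF fr_derivative[OF x0]])
  ultimately have "linear (\<lambda>v. dfr v x\<^sub>0 u - dfr u x\<^sub>0 v)" by (rule linear_compose_sub)
  then show ?thesis by (simp add: br_eq[abs_def])
qed

lemma fr_surj:
  assumes x: "x \<in> U"
  obtains u where "v = fr u x"
proof -
  have "inj (\<lambda>u. fr u x)"
  proof (subst linear_injective_0[OF fr_linear[OF x]], intro allI impI)
    fix u assume "fr u x = 0"
    then have "h x\<^sub>0 u u = 0" using h_fr[OF x, of u u] h_algebra[OF x] by simp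
    then show "u = 0" using h_pos[OF x0, of u] by fastforce
  qed
  then have "surj (\<lambda>u. fr u x)" by (rule eucl.linear_inj_imp_surj[OF fr_linear[OF x]])
  then show ?thesis using that by (metis surjD)
qed

text \<open>Scalar products of left invariant fields are constant; differentiating them expresses
  the derivatives of \<open>h\<close> through those of the fields.\<close>

lemma dh_fr:
  assumes x: "x \<in> U"
  shows "dh x z (fr u x) (fr v x) = - h x (dfr u x z) (fr v x) - h x (fr u x) (dfr v x z)"
proof -
  have "((\<lambda>x. h x (fr u x) (fr v x)) has_derivative
    (\<lambda>z. dh x z (fr u x) (fr v x) + h x (dfr u x z) (fr v x) + h x (fr u x) (dfr v x z))) (at x)"
    by (rule has_derivative_bilinear_family[of U x h, OF open_U x h_bilinear h_differentiable[OF x]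
        fr_derivative[OF x] fr_derivative[OF x]])
  moreover have "((\<lambda>x. h x (fr u x) (fr v x)) has_derivative (\<lambda>z. 0)) (at x)"
    by (rule has_derivative_transform_within_open[OF has_derivative_const open_U x, of "h x\<^sub>0 u v"]) (simp add: h_fr)
  ultimately have "(\<lambda>z. dh x z (fr u x) (fr v x) + h x (dfr u x z) (fr v x) + h x (fr u x) (dfr v x z)) = (\<lambda>z. 0)"
    by (rule has_derivative_unique)
  from fun_cong[OF this, of z] show ?thesis by simp
qed

lemma db_fr:
  assumes x: "x \<in> U"
  shows "db x z (fr v x) = - b x (dfr v x z)"
proof -
  have "((\<lambda>x. b x (fr v x)) has_derivative (\<lambda>z. db x z (fr v x) + b x (dfr v x z))) (at x)"
    by (rule has_derivative_linear_family[of U x b, OF open_U x b_linear b_differentiable[OF x] fr_derivative[OF x]])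
  moreover have "((\<lambda>x. b x (fr v x)) has_derivative (\<lambda>z. 0)) (at x)"
    by (rule has_derivative_transform_within_open[OF has_derivative_const open_U x, of "h x\<^sub>0 X\<^sub>0 v"]) (simp add: b_fr)
  ultimately have "(\<lambda>z. db x z (fr v x) + b x (dfr v x z)) = (\<lambda>z. 0)" by (rule has_derivative_unique)
  from fun_cong[OF this, of z] show ?thesis by simp
qed

text \<open>On left invariant fields the exterior derivative of \<open>b\<close> is minus
  \<open>b\<close> of their bracket, because \<open>b\<close> is constant on each of them.
  Closedness therefore reads as this orthogonality.\<close>

lemma X0_orthogonal_br: "h x\<^sub>0 X\<^sub>0 (br u v) = 0"
proof -
  have "h x\<^sub>0 X\<^sub>0 (br u v) = b x\<^sub>0 (br u v)" using b_fr[OF x0, of "br u v"] by (simp add: fr_x0)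
  then show ?thesis
    using db_fr[OF x0, of u v] db_fr[OF x0, of v u] b_closed[OF x0, of u v]
    by (simp add: br_eq fr_x0 linear_diff[OF b_linear[OF x0]])
qed

text \<open>The covariant derivative of a left invariant field along itself, by Koszul's formula.\<close>

definition acc :: "'e \<Rightarrow> 'e" where
  "acc u = (THE w. \<forall>z. h x\<^sub>0 w z = h x\<^sub>0 u (br z u))"

lemma h_acc: "h x\<^sub>0 (acc u) z = h x\<^sub>0 u (br z u)"
proof -
  have "linear (\<lambda>z. h x\<^sub>0 u (br z u))"
    unfolding br_antisym[of _ u]
    using linear_compose[OF br_linear[of u] h_linear(1)[OF x0, of u]]
    by (auto simp: linear_iff o_def h_algebra[OF x0])
  from THE_bilinear_solution[where B = "h x\<^sub>0", OF h_bilinear[OF x0] h_pos[OF x0] this]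
  show ?thesis by (simp add: acc_def)
qed

text \<open>It suffices to test against left invariant fields \<open>fr z x\<close>, since these
  span. Their scalar products being constant, the Christoffel term reduces to derivatives of the
  fields, and these combine to a bracket.\<close>

lemma fr_acc:
  assumes x: "x \<in> U"
  shows "dfr u x (fr u x) + chr x (fr u x) (fr u x) = fr (acc u) x"
proof (rule h_cancel[OF x])
  fix w
  obtain z where w: "w = fr z x" by (rule fr_surj[OF x])
  have "h x (chr x (fr u x) (fr u x)) (fr z x) = dh x (fr u x) (fr u x) (fr z x) - dh x (fr z x) (fr u x) (fr u x) / 2"
    by (simp add: chr_equation[OF x] field_simps)
  also have "\<dots> = - h x (dfr u x (fr u x)) (fr z x) - h x (fr u x) (dfr z x (fr u x) - dfr u x (fr z x))"
    by (simp add: dh_fr[OF x] h_algebra[OF x] h_sym[OF x, of "dfr u x (fr z x)"])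
  also have "h x (fr u x) (dfr z x (fr u x) - dfr u x (fr z x)) = h x\<^sub>0 u (br u z)"
    by (simp add: br_fr[OF x] h_fr[OF x])
  finally show "h x (dfr u x (fr u x) + chr x (fr u x) (fr u x)) w = h x (fr (acc u) x) w"
    by (simp add: w h_algebra[OF x] h_fr[OF x] h_acc br_antisym[of z u]
        h_algebra[OF x0])
qed

text \<open>As \<open>b x (fr u x)\<close> does not depend on \<open>x\<close>, \<open>r\<close> is
  minus \<open>b\<close> of the covariant derivative of \<open>fr u\<close> along itself.\<close>

lemma r_fr: "x \<in> U \<Longrightarrow> r x (fr u x) = - h x\<^sub>0 u (br X\<^sub>0 u)"
proof -
  assume x: "x \<in> U"
  have "r x (fr u x) = - b x (dfr u x (fr u x) + chr x (fr u x) (fr u x))"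
    by (simp add: r_def db_fr[OF x] linear_add[OF b_linear[OF x]])
  also have "\<dots> = - h x\<^sub>0 X\<^sub>0 (acc u)" by (simp only: fr_acc[OF x] b_fr[OF x])
  also have "\<dots> = - h x\<^sub>0 u (br X\<^sub>0 u)" by (subst h_sym[OF x0]) (simp add: h_acc)
  finally show ?thesis .
qed

lemma r_x0: "r x\<^sub>0 u = - h x\<^sub>0 u (br X\<^sub>0 u)"
  using r_fr[OF x0, of u] by (simp add: fr_x0)

text \<open>The function \<open>r x (fr u x)\<close> is constant, so the position derivative of
  \<open>r\<close> along \<open>u\<close> is minus its vertical derivative along the change of
  \<open>fr u\<close>. Together with the spray term this gives minus the vertical derivative along
  \<open>acc u\<close>, which is that of an explicit quadratic form at
  \<open>x\<^sub>0\<close>.\<close>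

lemma Sr_x0:
  assumes u: "u \<noteq> 0"
  shows "Sr x\<^sub>0 u = h x\<^sub>0 (acc u) (br X\<^sub>0 u) + h x\<^sub>0 u (br X\<^sub>0 (acc u))"
proof -
  have 1: "((\<lambda>z. r (fst z) (snd z)) has_derivative
      frechet_derivative (\<lambda>z. r (fst z) (snd z)) (at (x\<^sub>0, u))) (at (x\<^sub>0, fr u x\<^sub>0))"
    using has_derivative_pair[OF smooth2_r x0 u] by (simp add: fr_x0)
  have "((\<lambda>x. (x, fr u x)) has_derivative (\<lambda>z. (z, dfr u x\<^sub>0 z))) (at x\<^sub>0)"
    by (intro has_derivative_Pair has_derivative_ident fr_derivative x0)
  from diff_chain_at[OF this 1]
  have "((\<lambda>x. r x (fr u x)) has_derivative
      (\<lambda>z. frechet_derivative (\<lambda>z. r (fst z) (snd z)) (at (x\<^sub>0, u)) (z, dfr u x\<^sub>0 z))) (at x\<^sub>0)"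
    by (simp add: o_def)
  moreover have "((\<lambda>x. r x (fr u x)) has_derivative (\<lambda>z. 0)) (at x\<^sub>0)"
    by (rule has_derivative_transform_within_open[OF has_derivative_const open_U x0]) (rule r_fr[symmetric])
  ultimately have "(\<lambda>z. frechet_derivative (\<lambda>z. r (fst z) (snd z)) (at (x\<^sub>0, u)) (z, dfr u x\<^sub>0 z)) = (\<lambda>z. 0)"
    by (rule has_derivative_unique)
  then have "frechet_derivative (\<lambda>z. r (fst z) (snd z)) (at (x\<^sub>0, u)) ((u, 0) + (0, dfr u x\<^sub>0 u)) = 0"
    by (simp add: fun_eq_iff)
  then have total: "pos_deriv r x\<^sub>0 u u + vert_deriv r x\<^sub>0 u (dfr u x\<^sub>0 u) = 0"
    unfolding linear_add[OF has_derivative_linear[OF has_derivative_pair[OF smooth2_r x0 u]]]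
    by (simp add: pos_deriv_eq[OF smooth2_r x0 u] vert_deriv_eq[OF smooth2_r x0 u])
  have "dfr u x\<^sub>0 u + chr x\<^sub>0 u u = acc u" using fr_acc[OF x0, of u] by (simp add: fr_x0)
  then have "vert_deriv r x\<^sub>0 u (dfr u x\<^sub>0 u) + vert_deriv r x\<^sub>0 u (chr x\<^sub>0 u u) = vert_deriv r x\<^sub>0 u (acc u)"
    by (simp flip: linear_add[OF linear_vert_deriv[OF smooth2_r x0 u]])
  with total have "Sr x\<^sub>0 u = - vert_deriv r x\<^sub>0 u (acc u)" by (simp add: Sr_def)
  moreover have "((\<lambda>y. r x\<^sub>0 y) has_derivative (\<lambda>z. - (h x\<^sub>0 u (br X\<^sub>0 z) + h x\<^sub>0 z (br X\<^sub>0 u)))) (at u)"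
    unfolding r_x0
    by (intro has_derivative_minus linear_imp_has_derivative br_linear
        bounded_bilinear.FDERIV[OF h_bilinear[OF x0, unfolded bilinear_conv_bounded_bilinear]] has_derivative_ident)
  from vert_derivI[of r, OF this]
  have "vert_deriv r x\<^sub>0 u (acc u) = - (h x\<^sub>0 u (br X\<^sub>0 (acc u)) + h x\<^sub>0 (acc u) (br X\<^sub>0 u))" .
  ultimately show ?thesis by simp
qed

section \<open>The invariants \<open>r\<close> and \<open>Sr\<close> in terms of \<phi> and
  \<open>f\<close>\<close>

context
  fixes e :: 'e and \<Gamma> :: "'e set" and \<phi> :: "'e \<Rightarrow> real" and f :: "'e \<Rightarrow> 'e" and \<eta> :: real and v y :: 'e
  assumes ee: "h x\<^sub>0 e e = 1" and \<Gamma>: "\<Gamma> = {z. h x\<^sub>0 z e = 0}"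
    and \<phi>: "\<forall>z\<in>\<Gamma>. br z e = \<phi> z *\<^sub>R e"
    and f: "\<forall>z\<in>\<Gamma>. f z \<in> \<Gamma> \<and> (\<forall>y\<in>\<Gamma>. br z y = h x\<^sub>0 (f z) y *\<^sub>R e)"
    and X0: "X\<^sub>0 \<in> \<Gamma>" and v: "v \<in> \<Gamma>" and y: "y = \<eta> *\<^sub>R e + v"
begin

private lemmas h_add = linear_add[OF h_linear(1)[OF x0]] linear_add[OF h_linear(2)[OF x0]]
private lemmas h_scale = linear_cmul[OF h_linear(1)[OF x0]] linear_cmul[OF h_linear(2)[OF x0]]

private lemma br_split: "z \<in> \<Gamma> \<Longrightarrow> w \<in> \<Gamma> \<Longrightarrow> br z (c *\<^sub>R e + w) = (c * \<phi> z + h x\<^sub>0 (f z) w) *\<^sub>R e"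
  using \<phi> f by (simp add: linear_add[OF br_linear] linear_cmul[OF br_linear] scaleR_add_left)

private lemma h_y_e: "h x\<^sub>0 y e = \<eta>" "h x\<^sub>0 e y = \<eta>"
  using v ee by (auto simp: y \<Gamma> h_add h_scale h_sym[OF x0, of e v])

lemma r_structure: "r x\<^sub>0 y = - (\<eta>\<^sup>2 * \<phi> X\<^sub>0 + \<eta> * h x\<^sub>0 (f X\<^sub>0) v)"
proof -
  have "br X\<^sub>0 y = (\<eta> * \<phi> X\<^sub>0 + h x\<^sub>0 (f X\<^sub>0) v) *\<^sub>R e"
    using br_split[OF X0 v] by (simp only: y)
  then have "r x\<^sub>0 y = - ((\<eta> * \<phi> X\<^sub>0 + h x\<^sub>0 (f X\<^sub>0) v) * \<eta>)"
    by (simp only: r_x0 h_scale h_y_e real_scaleR_def)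
  then show ?thesis by (simp add: power2_eq_square algebra_simps)
qed

lemma f_skew: "z \<in> \<Gamma> \<Longrightarrow> w \<in> \<Gamma> \<Longrightarrow> h x\<^sub>0 (f z) w = - h x\<^sub>0 (f w) z"
proof -
  assume z: "z \<in> \<Gamma>" "w \<in> \<Gamma>"
  have "h x\<^sub>0 (br z w) e = - h x\<^sub>0 (br w z) e"
    by (subst br_antisym) (simp add: h_algebra[OF x0])
  then show ?thesis using f z by (simp add: h_scale ee)
qed

lemma Sr_structure:
  assumes "y \<noteq> 0"
  shows "Sr x\<^sub>0 y = - (2 * \<eta>\<^sup>2 * \<phi> v * \<phi> X\<^sub>0 + \<eta> * \<phi> v * h x\<^sub>0 (f X\<^sub>0) v
    + \<eta>\<^sup>2 * h x\<^sub>0 (f X\<^sub>0) (f v) - \<eta>^3 * \<phi> (f X\<^sub>0))"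
proof -
  define w where "w = acc y"
  have fX: "f X\<^sub>0 \<in> \<Gamma>" and fv: "f v \<in> \<Gamma>" using f X0 v by auto
  have "br e e = 0" by (simp add: br_eq)
  moreover have "br e v = - (\<phi> v *\<^sub>R e)" using br_antisym[of e v] \<phi> v by simp
  ultimately have "br e y = - (\<phi> v *\<^sub>R e)"
    by (simp add: y linear_add[OF br_linear] linear_cmul[OF br_linear])
  then have we: "h x\<^sub>0 w e = - \<eta> * \<phi> v"
    by (simp add: w_def h_acc h_scale h_y_e h_algebra[OF x0])
  have wz: "h x\<^sub>0 w z = \<eta> * (\<eta> * \<phi> z + h x\<^sub>0 (f z) v)" if "z \<in> \<Gamma>" for z
    using br_split[OF that v, of \<eta>] by (simp add: w_def h_acc flip: y) (simp add: h_scale h_y_e)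
  \<comment> \<open>The component of \<open>acc y\<close> in \<open>\<Gamma>\<close>, on which the
    bracket with \<open>X\<^sub>0\<close> is given by \<open>f\<close>; along \<open>e\<close> it is
    given by \<open>\<phi>\<close>.\<close>
  define w' where "w' = w + (\<eta> * \<phi> v) *\<^sub>R e"
  have w': "w' \<in> \<Gamma>" and w_eq: "w = (- \<eta> * \<phi> v) *\<^sub>R e + w'"
    by (simp_all add: w'_def \<Gamma> h_add h_scale we ee)
  have "h x\<^sub>0 (f X\<^sub>0) w' = h x\<^sub>0 w (f X\<^sub>0)"
    using fX by (simp add: w'_def h_add h_scale h_sym[OF x0, of w] \<Gamma>)
  \<comment> \<open>Skew symmetry moves one \<open>f\<close> across:
    \<open>h x\<^sub>0 (f (f X\<^sub>0)) v\<close> becomes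
    \<open>- h x\<^sub>0 (f X\<^sub>0) (f v)\<close>.\<close>
  also have "\<dots> = \<eta> * (\<eta> * \<phi> (f X\<^sub>0) - h x\<^sub>0 (f X\<^sub>0) (f v))"
    using wz[OF fX] f_skew[OF fX v] h_sym[OF x0, of "f v"] by simp
  finally have brw: "br X\<^sub>0 w = (- \<eta> * \<phi> v * \<phi> X\<^sub>0 + \<eta> * (\<eta> * \<phi> (f X\<^sub>0) - h x\<^sub>0 (f X\<^sub>0) (f v))) *\<^sub>R e"
    using br_split[OF X0 w'] by (simp only: w_eq)
  have bry: "br X\<^sub>0 y = (\<eta> * \<phi> X\<^sub>0 + h x\<^sub>0 (f X\<^sub>0) v) *\<^sub>R e"
    using br_split[OF X0 v] by (simp only: y)
  \<comment> \<open>Each of the two summands of \<open>Sr\<close> contributes the product of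
    \<open>\<phi> v\<close> and \<open>\<phi> X\<^sub>0\<close> once, which accounts for its factor
    2.\<close>
  show ?thesis
    unfolding Sr_x0[OF assms] w_def[symmetric] brw bry h_scale we h_y_e
    by (simp add: power2_eq_square power3_eq_cube algebra_simps)
qed

end

end

section \<open>Charts of manifolds and Lie groups\<close>

lemma bilinear_Cauchy_Schwarz:
  fixes B :: "'a::real_vector \<Rightarrow> 'a \<Rightarrow> real"
  assumes B: "bilinear B" and sym: "\<And>u v. B u v = B v u" and pos: "\<And>u. u \<noteq> 0 \<Longrightarrow> 0 < B u u"
  shows "(B v u)\<^sup>2 \<le> B v v * B u u"
proof (cases "\<exists>t. u = t *\<^sub>R v")
  case True
  then show ?thesis by (auto simp: bilinear_lmul[OF B] bilinear_rmul[OF B] power2_eq_square)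
next
  case False
  show ?thesis
  proof (cases "v = 0")
    case True
    then show ?thesis by (simp add: bilinear_lzero[OF B])
  next
    case v: False
    then show ?thesis using strict_Cauchy_Schwarz[where B = B, OF B sym pos v] False by fastforce
  qed
qed

locale manifold =
  fixes M :: "('a::{t2_space,second_countable_topology}, 'e::euclidean_space, 'm) atlas_scheme"
  assumes manifold: "smooth_manifold M"
begin

abbreviation ch :: "'a \<Rightarrow> 'a \<Rightarrow> 'e" where "ch \<equiv> chart M"
abbreviation ci :: "'a \<Rightarrow> 'e \<Rightarrow> 'a" where "ci \<equiv> chart_inv M"
abbreviation dom :: "'a \<Rightarrow> 'a set" where "dom \<equiv> chart_dom M"
abbreviation im :: "'a \<Rightarrow> 'e set" where "im \<equiv> chart_image M"

lemma
  shows in_dom: "p \<in> dom p" and open_dom: "open (dom p)" and open_im: "open (im p)"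
    and chart_homeo: "homeomorphism (dom p) (im p) (ch p) (ci p)"
  using manifold unfolding smooth_manifold_def by blast+

lemma ci_ch: "a \<in> dom p \<Longrightarrow> ci p (ch p a) = a"
  and ch_ci: "x \<in> im p \<Longrightarrow> ch p (ci p x) = x"
  and ci_dom: "x \<in> im p \<Longrightarrow> ci p x \<in> dom p"
  and ch_im: "a \<in> dom p \<Longrightarrow> ch p a \<in> im p"
  and ci_continuous: "continuous_on (im p) (ci p)"
  using chart_homeo[of p] unfolding homeomorphism_def by auto

definition overlap :: "'a \<Rightarrow> 'a \<Rightarrow> 'e set" where "overlap p q = {x \<in> im p. ci p x \<in> dom q}"

lemma open_overlap: "open (overlap p q)"
proof -
  have "open (im p \<inter> ci p -` dom q)"
    by (rule continuous_open_preimage[OF ci_continuous open_im open_dom])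
  moreover have "im p \<inter> ci p -` dom q = overlap p q" by (auto simp: overlap_def)
  ultimately show ?thesis by simp
qed

lemma transition_smooth: "smooth_on (ch q \<circ> ci p) (overlap p q)"
proof -
  have "ch p ` (dom p \<inter> dom q) = overlap p q"
  proof
    show "ch p ` (dom p \<inter> dom q) \<subseteq> overlap p q" by (auto simp: overlap_def ch_im ci_ch)
    show "overlap p q \<subseteq> ch p ` (dom p \<inter> dom q)"
    proof
      fix x assume x: "x \<in> overlap p q"
      then have "x = ch p (ci p x)" by (simp add: overlap_def ch_ci)
      then show "x \<in> ch p ` (dom p \<inter> dom q)" using x by (auto simp: overlap_def ci_dom)
    qed
  qed
  then show ?thesis using manifold unfolding smooth_manifold_def by metis
qed

lemma transition_derivative:
  "x \<in> overlap p q \<Longrightarrow> ((ch q \<circ> ci p) has_derivative transition M p q x) (at x)"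
  unfolding transition_def by (rule smooth_on_has_derivative[OF transition_smooth])

lemma transition_linear: "x \<in> overlap p q \<Longrightarrow> linear (transition M p q x)"
  by (rule has_derivative_linear[OF transition_derivative])

lemma transition_inverse:
  assumes x: "x \<in> overlap p q"
  shows "transition M q p (ch q (ci p x)) (transition M p q x u) = u"
proof -
  have "ch q (ci p x) \<in> overlap q p"
    using x by (auto simp: overlap_def ch_im ci_ch ci_dom)
  then have "((ch p \<circ> ci q) has_derivative transition M q p (ch q (ci p x))) (at ((ch q \<circ> ci p) x))"
    using transition_derivative[of "ch q (ci p x)" q p] by simp
  from diff_chain_at[OF transition_derivative[OF x] this]
  have "((\<lambda>x. x) has_derivative transition M q p (ch q (ci p x)) \<circ> transition M p q x) (at x)"
    by (rule has_derivative_transform_within_open[OF _ open_overlap x])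
      (simp add: overlap_def ci_ch ch_ci)
  from has_derivative_unique[OF this has_derivative_ident] show ?thesis by (simp add: fun_eq_iff)
qed

lemma in_overlap:
  assumes "x \<in> im p"
  shows "x \<in> overlap p (ci p x)" "ch (ci p x) (ci p x) \<in> overlap (ci p x) p"
  using assms by (auto simp: overlap_def in_dom ch_im ci_ch ci_dom)

lemma transition_center:
  assumes x: "x \<in> im p"
  shows "transition M (ci p x) p (ch (ci p x) (ci p x)) (transition M p (ci p x) x u) = u"
    and "transition M p (ci p x) x (transition M (ci p x) p (ch (ci p x) (ci p x)) u) = u"
  using transition_inverse[OF in_overlap(1)[OF x]] transition_inverse[OF in_overlap(2)[OF x]]
  by (simp_all add: ci_ch in_dom ch_ci[OF x])

text \<open>At its centre the preferred chart represents tangent vectors by their own components, so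
  coordinate expressions evaluated at \<open>ch p p\<close> return the original data at
  \<open>p\<close>.\<close>

lemma transition_id: "transition M p p (ch p p) u = u"
proof -
  have "((\<lambda>x. x) has_derivative transition M p p (ch p p)) (at (ch p p))"
    by (rule has_derivative_transform_within_open[OF transition_derivative open_im[of p]])
      (auto simp: overlap_def ch_im in_dom ci_ch ch_ci)
  from has_derivative_unique[OF this has_derivative_ident] show ?thesis by simp
qed

lemma riemannian_local_metric:
  assumes g: "riemannian_metric M g"
  shows "riemannian (im p) (local_metric M g p)"
proof
  show "open (im p)" by (rule open_im)
next
  fix x u v assume x: "x \<in> im p"
  let ?q = "ci p x"
  have gq: "bilinear (g ?q)" "\<And>u v. g ?q u v = g ?q v u" "\<And>u. u \<noteq> 0 \<Longrightarrow> g ?q u u > 0"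
    using g unfolding riemannian_metric_def by blast+
  have l: "linear (transition M p ?q x)" by (rule transition_linear[OF in_overlap(1)[OF x]])
  show "bilinear (local_metric M g p x)"
    unfolding local_metric_def Let_def bilinear_def
    using gq(1) linear_compose[OF l, of "g ?q _"] linear_compose[OF l, of "\<lambda>u. g ?q u _"]
    by (auto simp: bilinear_def o_def)
  show "local_metric M g p x u v = local_metric M g p x v u"
    by (simp add: local_metric_def Let_def gq(2))
  assume "u \<noteq> 0"
  then have "transition M p ?q x u \<noteq> 0"
    using transition_center(1)[OF x, of u] transition_linear[OF in_overlap(2)[OF x]] by (auto simp: linear_0)
  then show "0 < local_metric M g p x u u" by (simp add: local_metric_def Let_def gq(3))
next
  show "smooth_on (\<lambda>x. local_metric M g p x u v) (im p)" for u v
    using g unfolding riemannian_metric_def by blast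
qed

text \<open>The transitions to and from the chart at the base point cancel. This identifies the
  linear part of the Randers metric in a chart with the dual of the local expression of
  \<open>X\<close>.\<close>

lemma local_metric_field:
  assumes x: "x \<in> im p"
  shows "local_metric M g p x (local_field M X p x) v = g (ci p x) (X (ci p x)) (transition M p (ci p x) x v)"
  by (simp add: local_metric_def local_field_def Let_def transition_center(2)[OF x])

lemma randers_local:
  assumes g: "riemannian_metric M g" and X: "smooth_field M X" and bound: "\<forall>a. sqrt (g a (X a) (X a)) < 1"
  shows "randers (im p) (local_metric M g p) (\<lambda>x. local_metric M g p x (local_field M X p x))
    (local_finsler M (randers_metric g X) p)"
proof -
  interpret riemannian "im p" "local_metric M g p" by (rule riemannian_local_metric[OF g])
  show ?thesis
  proof (intro randers.intro randers_axioms.intro)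
    show "riemannian (im p) (local_metric M g p)" by (rule riemannian_local_metric[OF g])
  next
    fix x assume x: "x \<in> im p"
    let ?q = "ci p x"
    have gq: "bilinear (g ?q)" "\<And>u v. g ?q u v = g ?q v u" "\<And>u. u \<noteq> 0 \<Longrightarrow> g ?q u u > 0"
      using g unfolding riemannian_metric_def by blast+
    show "linear (local_metric M g p x (local_field M X p x))" by (rule h_linear(1)[OF x])
    show "local_finsler M (randers_metric g X) p x y
        = sqrt (local_metric M g p x y y) + local_metric M g p x (local_field M X p x) y" for y
      unfolding local_metric_field[OF x] by (simp add: local_finsler_def randers_metric_def local_metric_def Let_def)
    fix y :: 'e assume y: "y \<noteq> 0"
    define Y where "Y = transition M p ?q x y"
    have Yp: "0 < g ?q Y Y" using h_pos[OF x y] by (simp add: local_metric_def Y_def Let_def)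
    have "sqrt (g ?q (X ?q) (X ?q)) < 1" using bound by blast
    then have "g ?q (X ?q) (X ?q) < 1" by simp
    \<comment> \<open>Cauchy-Schwarz turns the norm bound on \<open>X\<close> into the bound on the
      covector; it stays strict because \<open>g ?q Y Y\<close> is positive.\<close>
    have "(g ?q (X ?q) Y)\<^sup>2 \<le> g ?q (X ?q) (X ?q) * g ?q Y Y"
      by (rule bilinear_Cauchy_Schwarz[where B = "g ?q", OF gq])
    also have "\<dots> < 1 * g ?q Y Y" using \<open>g ?q (X ?q) (X ?q) < 1\<close> Yp by (rule mult_strict_right_mono)
    finally have "\<bar>g ?q (X ?q) Y\<bar> < sqrt (g ?q Y Y)" by (simp add: real_less_rsqrt)
    then show "\<bar>local_metric M g p x (local_field M X p x) y\<bar> < sqrt (local_metric M g p x y y)"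
      unfolding local_metric_field[OF x] by (simp add: local_metric_def Y_def Let_def)
  next
    fix u
    have "smooth_on (local_field M X p) (im p)" using X unfolding smooth_field_def by blast
    then show "smooth_on (\<lambda>x. local_metric M g p x (local_field M X p x) u) (im p)"
      by (intro smooth_on_bilinear_family[where S = "im p" and T = "im p" and B = "local_metric M g p"
            and k = "\<lambda>x. x" and f = "local_field M X p" and g = "\<lambda>x. u"])
        (simp_all add: open_im h_bilinear h_smooth smooth_on_id smooth_on_const)
  qed
qed

lemma closed_randers_local:
  assumes g: "riemannian_metric M g" and X: "smooth_field M X" and bound: "\<forall>a. sqrt (g a (X a) (X a)) < 1"
    and D: "douglas_type M (randers_metric g X)"
  shows "closed_randers (im p) (local_metric M g p) (\<lambda>x. local_metric M g p x (local_field M X p x))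
    (local_finsler M (randers_metric g X) p)"
proof -
  interpret randers "im p" "local_metric M g p" "\<lambda>x. local_metric M g p x (local_field M X p x)"
    "local_finsler M (randers_metric g X) p" by (rule randers_local[OF g X bound])
  show ?thesis
  proof
    fix x u w assume x: "x \<in> im p"
    obtain B Q where "\<forall>x\<in>im p. bilinear (B x) \<and> (\<forall>c y. c > 0 \<and> y \<noteq> 0 \<longrightarrow> Q x (c *\<^sub>R y) = c * Q x y) \<and>
        (\<forall>y. y \<noteq> 0 \<longrightarrow> spray (local_finsler M (randers_metric g X) p) x y = (1/2) *\<^sub>R B x y y + Q x y *\<^sub>R y)"
      using D unfolding douglas_type_def by blast
    with x have "bilinear (B x)" "\<And>y. y \<noteq> 0 \<Longrightarrow>
        spray (local_finsler M (randers_metric g X) p) x y = (1/2) *\<^sub>R B x y y + Q x y *\<^sub>R y" by blast+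
    then show "db x u w = db x w u" by (rule douglas_imp_closed[OF x])
  qed
qed

end

section \<open>Left invariant fields in the chart at the identity\<close>

locale lie =
  fixes G :: "('a::{t2_space,second_countable_topology}, 'e::euclidean_space, 'm) lie_group_data_scheme"
  assumes lie: "lie_group G"

sublocale lie \<subseteq> manifold G
  by unfold_locales (use lie in \<open>simp add: lie_group_def\<close>)

sublocale lie \<subseteq> grp: group "gmul G" "gone G" "ginv G"
  using lie by (simp add: lie_group_def)

context lie
begin

abbreviation one :: 'a where "one \<equiv> gone G"
abbreviation x0 :: 'e where "x0 \<equiv> ch one one"

definition Sm :: "'a \<Rightarrow> 'a \<Rightarrow> 'a \<Rightarrow> ('e \<times> 'e) set" where
  "Sm p q r = {z. fst z \<in> im p \<and> snd z \<in> im q \<and> gmul G (ci p (fst z)) (ci q (snd z)) \<in> dom r}"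

lemma gmul_continuous: "continuous_on UNIV (\<lambda>z. gmul G (fst z) (snd z))"
  using lie by (simp add: lie_group_def case_prod_beta)

lemma open_Sm: "open (Sm p q r)"
proof -
  have "continuous_on (im p \<times> im q) (\<lambda>z. gmul G (fst (ci p (fst z), ci q (snd z))) (snd (ci p (fst z), ci q (snd z))))"
    by (rule continuous_on_compose2[OF gmul_continuous])
      (auto intro!: continuous_intros continuous_on_compose2[OF ci_continuous])
  then have "open ((im p \<times> im q) \<inter> (\<lambda>z. gmul G (ci p (fst z)) (ci q (snd z))) -` dom r)"
    by (intro continuous_open_preimage open_Times open_im open_dom) simp
  moreover have "(im p \<times> im q) \<inter> (\<lambda>z. gmul G (ci p (fst z)) (ci q (snd z))) -` dom r = Sm p q r"
    by (auto simp: Sm_def)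
  ultimately show ?thesis by simp
qed

lemma gmul_smooth: "smooth_on (\<lambda>z. ch r (gmul G (ci p (fst z)) (ci q (snd z)))) (Sm p q r)"
proof -
  have "{(ch p a, ch q b) | a b. a \<in> dom p \<and> b \<in> dom q \<and> gmul G a b \<in> dom r} = Sm p q r" (is "?A = _")
  proof
    show "?A \<subseteq> Sm p q r" by (auto simp: Sm_def ch_im ci_ch)
    show "Sm p q r \<subseteq> ?A"
    proof
      fix z assume z: "z \<in> Sm p q r"
      show "z \<in> ?A"
        unfolding mem_Collect_eq
        by (rule exI[of _ "ci p (fst z)"], rule exI[of _ "ci q (snd z)"]) (use z in \<open>simp add: Sm_def ci_dom ch_ci\<close>)
    qed
  qed
  moreover have "smooth_on (\<lambda>(x, y). ch r (gmul G (ci p x) (ci q y))) ?A"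
    using lie unfolding lie_group_def by blast
  ultimately show ?thesis by (simp add: case_prod_unfold)
qed

definition T :: "'a \<Rightarrow> 'a \<Rightarrow> 'e set" where "T a r = {z \<in> im one. gmul G a (ci one z) \<in> dom r}"

lemma open_T: "open (T a r)"
proof -
  have "open ((\<lambda>z. (ch a a, z)) -` Sm a one r)"
    by (rule open_vimage[OF open_Sm]) (intro continuous_intros)
  moreover have "(\<lambda>z. (ch a a, z)) -` Sm a one r = T a r"
    by (auto simp: Sm_def T_def ci_ch in_dom ch_im)
  ultimately show ?thesis by simp
qed

lemma translation_smooth: "smooth_on (\<lambda>z. ch r (gmul G a (ci one z))) (T a r)"
proof -
  have "smooth_on (\<lambda>z. (\<lambda>z. ch r (gmul G (ci a (fst z)) (ci one (snd z)))) (ch a a, z)) (T a r)"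
  proof (rule smooth_on_compose[OF open_T gmul_smooth[of r a one]])
    show "smooth_on (\<lambda>z. (ch a a, z)) (T a r)" by (intro smooth_intros open_T)
    show "(\<lambda>z. (ch a a, z)) ` T a r \<subseteq> Sm a one r" by (auto simp: Sm_def T_def ci_ch in_dom ch_im)
  qed
  then show ?thesis by (simp add: ci_ch in_dom)
qed

lemma x0_im: "x0 \<in> im one"
  by (simp add: ch_im in_dom)

lemma ci_x0: "ci one x0 = one"
  by (simp add: ci_ch in_dom)

lemma x0_T: "a \<in> dom r \<Longrightarrow> x0 \<in> T a r"
  by (simp add: T_def x0_im ci_x0)

text \<open>A local group law, meaningful only where the product stays in the chart, that is, for
  \<open>z \<in> T (ci one x) one\<close>.\<close>

definition m :: "'e \<Rightarrow> 'e \<Rightarrow> 'e" where "m x z = ch one (gmul G (ci one x) (ci one z))"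

definition fr :: "'e \<Rightarrow> 'e \<Rightarrow> 'e" where "fr u = local_field G (left_field G u) one"

lemma m_derivative:
  assumes "x \<in> im one" "z \<in> T (ci one x) one"
  shows "(m x has_derivative frechet_derivative (m x) (at z)) (at z)"
  using smooth_on_has_derivative[OF translation_smooth[of one "ci one x"] assms(2)]
  by (simp add: m_def[abs_def])

lemma m_x0: "x \<in> im one \<Longrightarrow> m x x0 = x"
  by (simp add: m_def ci_x0 ch_ci)

lemma x0_in_T: "x \<in> im one \<Longrightarrow> x0 \<in> T (ci one x) one"
  by (simp add: x0_T ci_dom)

lemma left_field_eq: "left_field G u q = frechet_derivative (\<lambda>z. ch q (gmul G q (ci one z))) (at x0) u"
  by (simp add: left_field_def tangent_map_def o_def)

text \<open>\<open>left_field\<close> gives the value at \<open>q\<close> in the chart at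
  \<open>q\<close>; the transition to the chart at the identity is absorbed by the chain rule. The
  frame thereby becomes a partial derivative of the local group law.\<close>

lemma fr_eq:
  assumes x: "x \<in> im one"
  shows "fr u x = frechet_derivative (m x) (at x0) u"
proof -
  define q where "q = ci one x"
  have A: "((\<lambda>z. ch q (gmul G q (ci one z))) has_derivative (\<lambda>u. left_field G u q)) (at x0)"
    unfolding left_field_eq by (rule smooth_on_has_derivative[OF translation_smooth x0_T[OF in_dom]])
  have B: "((ch one \<circ> ci q) has_derivative transition G q one (ch q q)) (at (ch q (gmul G q (ci one x0))))"
    using transition_derivative[OF in_overlap(2)[OF x]] by (simp add: ci_x0 q_def)
  have "((\<lambda>z. m x z) has_derivative transition G q one (ch q q) \<circ> (\<lambda>u. left_field G u q)) (at x0)"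
    by (rule has_derivative_transform_within_open[OF diff_chain_at[OF A B] open_T[of q q] x0_T[OF in_dom[of q]]])
      (simp add: m_def T_def ci_ch q_def)
  from frechet_derivative_eqI[OF this, of u] show ?thesis
    by (simp add: fr_def local_field_def Let_def q_def)
qed

lemma fr_linear: "x \<in> im one \<Longrightarrow> linear (\<lambda>u. fr u x)"
  using has_derivative_linear[OF m_derivative[OF _ x0_in_T]] by (simp add: fr_eq)

lemma fr_x0: "fr u x0 = u"
proof -
  have "(m x0 has_derivative (\<lambda>u. u)) (at x0)"
    by (rule has_derivative_transform_within_open[OF has_derivative_ident open_im x0_im])
      (simp add: m_def ci_x0 ch_ci)
  from frechet_derivative_eqI[OF this] show ?thesis by (simp add: fr_eq[OF x0_im])
qed

text \<open>The field is a derivative of the jointly smooth local group law in the fixed direction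
  \<open>(0, u)\<close>, restricted to the slice of points \<open>(x, x0)\<close>.\<close>

lemma fr_smooth: "smooth_on (fr u) (im one)"
proof -
  let ?D = "\<lambda>z. frechet_derivative (\<lambda>z. m (fst z) (snd z)) (at z) (0, u)"
  have ms: "smooth_on (\<lambda>z. m (fst z) (snd z)) (Sm one one one)"
    unfolding m_def by (rule gmul_smooth)
  have in_Sm: "(x, x0) \<in> Sm one one one" if "x \<in> im one" for x
    using that by (simp add: Sm_def x0_im ci_x0 ci_dom)
  have "smooth_on (\<lambda>x. ?D (x, x0)) (im one)"
    by (rule smooth_on_compose[OF open_im smooth_on_frechet_derivative[OF ms]])
      (auto intro!: smooth_intros open_im simp: in_Sm)
  moreover have "?D (x, x0) = fr u x" if x: "x \<in> im one" for x
  proof -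
    have "((\<lambda>z. (x, z)) has_derivative (\<lambda>u. (0, u))) (at x0)" by (auto intro!: derivative_eq_intros)
    from diff_chain_at[OF this smooth_on_has_derivative[OF ms in_Sm[OF x]]]
    have "(m x has_derivative (\<lambda>u. frechet_derivative (\<lambda>z. m (fst z) (snd z)) (at (x, x0)) (0, u))) (at x0)"
      by (simp add: o_def)
    from frechet_derivative_eqI[OF this, of u] show ?thesis by (simp add: fr_eq[OF x])
  qed
  ultimately show ?thesis by (rule smooth_on_transform[OF open_im])
qed

lemma fr_derivative: "x \<in> im one \<Longrightarrow> (fr u has_derivative frechet_derivative (fr u) (at x)) (at x)"
  by (rule smooth_on_has_derivative[OF fr_smooth])

lemma left_field_one: "left_field G u one = u"
proof -
  have "((\<lambda>z. ch one (gmul G one (ci one z))) has_derivative (\<lambda>u. u)) (at x0)"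
    by (rule has_derivative_transform_within_open[OF has_derivative_ident open_im x0_im]) (simp add: ch_ci)
  from frechet_derivative_eqI[OF this] show ?thesis by (simp add: left_field_eq)
qed

lemma bracket_eq: "bracket G u v = frechet_derivative (fr v) (at x0) u - frechet_derivative (fr u) (at x0) v"
  by (simp add: bracket_def field_bracket_def left_field_one flip: fr_def)

text \<open>Left invariance in coordinates. By associativity \<open>m (m x z)\<close> agrees near
  \<open>x0\<close> with \<open>m x \<circ> m z\<close>; the chain rule at \<open>x0\<close> gives
  the claim.\<close>

lemma fr_translation:
  assumes x: "x \<in> im one" and z: "z \<in> T (ci one x) one"
  shows "frechet_derivative (m x) (at z) (fr u z) = fr u (m x z)"
proof -
  have zi: "z \<in> im one" and xz: "gmul G (ci one x) (ci one z) \<in> dom one" using z by (auto simp: T_def)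
  have mi: "m x z \<in> im one" and cm: "ci one (m x z) = gmul G (ci one x) (ci one z)"
    using xz by (simp_all add: m_def ch_im ci_ch)
  have 1: "(m z has_derivative (\<lambda>u. fr u z)) (at x0)"
    using m_derivative[OF zi x0_in_T[OF zi]] by (simp add: fr_eq[OF zi, abs_def])
  have 2: "(m x has_derivative frechet_derivative (m x) (at z)) (at (m z x0))"
    using m_derivative[OF x z] by (simp add: m_x0[OF zi])
  have "(m (m x z) has_derivative frechet_derivative (m x) (at z) \<circ> (\<lambda>u. fr u z)) (at x0)"
    by (rule has_derivative_transform_within_open[OF diff_chain_at[OF 1 2] open_T x0_in_T[OF zi]])
      (auto simp: m_def T_def ci_ch cm[unfolded m_def] grp.assoc)
  from frechet_derivative_eqI[OF this, of u] show ?thesis by (simp add: fr_eq[OF mi])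
qed

text \<open>Each \<open>fr u\<close> is related to itself by the translation \<open>m x\<close>, and
  related fields have related brackets: differentiating \<open>fr_translation\<close> at
  \<open>x0\<close> produces the second derivative of \<open>m x\<close>, which is symmetric and
  drops out of the commutator.\<close>

lemma bracket_fr:
  assumes x: "x \<in> im one"
  shows "frechet_derivative (fr v) (at x) (fr u x) - frechet_derivative (fr u) (at x) (fr v x) = fr (bracket G u v) x"
proof -
  let ?S = "T (ci one x) one"
  let ?D2 = "\<lambda>u v. frechet_derivative (\<lambda>z. frechet_derivative (m x) (at z) u) (at x0) v"
  have ms: "smooth_on (m x) ?S" using translation_smooth[of one "ci one x"] by (simp add: m_def[abs_def])
  have S0: "x0 \<in> ?S" by (rule x0_in_T[OF x])
  have key: "frechet_derivative (fr u) (at x) (fr v x)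
      = ?D2 u v + fr (frechet_derivative (fr u) (at x0) v) x" for u v
  proof -
    have "((\<lambda>z. frechet_derivative (m x) (at z) (fr u z)) has_derivative
      (\<lambda>v. frechet_derivative (\<lambda>z. frechet_derivative (m x) (at z) (fr u x0)) (at x0) v
        + frechet_derivative (m x) (at x0) (frechet_derivative (fr u) (at x0) v))) (at x0)"
      by (rule has_derivative_linear_family[of ?S x0 "\<lambda>z. frechet_derivative (m x) (at z)", OF open_T S0
            has_derivative_linear[OF m_derivative[OF x]]
            smooth_on_differentiable[OF smooth_on_frechet_derivative[OF ms] S0] fr_derivative[OF x0_im]])
    then have 1: "((\<lambda>z. frechet_derivative (m x) (at z) (fr u z)) has_derivative
      (\<lambda>v. ?D2 u v + fr (frechet_derivative (fr u) (at x0) v) x)) (at x0)"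
      by (simp add: fr_x0 fr_eq[OF x])
    have "(fr u has_derivative frechet_derivative (fr u) (at x)) (at (m x x0))"
      using fr_derivative[OF x] by (simp add: m_x0[OF x])
    from diff_chain_at[OF m_derivative[OF x S0] this]
    have "((\<lambda>z. frechet_derivative (m x) (at z) (fr u z)) has_derivative
      frechet_derivative (fr u) (at x) \<circ> frechet_derivative (m x) (at x0)) (at x0)"
      by (rule has_derivative_transform_within_open[OF _ open_T S0]) (simp add: fr_translation[OF x])
    from fun_cong[OF has_derivative_unique[OF this 1], of v] show ?thesis by (simp add: fr_eq[OF x])
  qed
  have "?D2 u v = ?D2 v u" by (rule second_derivative_symmetric[OF open_T ms S0])
  then show ?thesis
    by (simp add: key bracket_eq linear_diff[OF fr_linear[OF x]])
qed

lemma transition_fr: "x \<in> im one \<Longrightarrow> transition G one (ci one x) x (fr u x) = left_field G u (ci one x)"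
  by (simp add: fr_def local_field_def Let_def transition_center(2))

lemma local_metric_fr:
  assumes "left_invariant_metric G g" "x \<in> im one"
  shows "local_metric G g one x (fr u x) (fr v x) = g one u v"
proof -
  have "local_metric G g one x (fr u x) (fr v x) = g (gmul G (ci one x) one)
     (tangent_map G (gmul G (ci one x)) one u) (tangent_map G (gmul G (ci one x)) one v)"
    by (simp add: local_metric_def Let_def transition_fr[OF assms(2)] left_field_def)
  also have "\<dots> = g one u v" using assms(1) unfolding left_invariant_metric_def by blast
  finally show ?thesis .
qed

lemma left_invariant_field_eq:
  assumes "left_invariant_field G X"
  shows "local_field G X one = fr (X one)"
proof -
  have "X q = left_field G (X one) q" for q
  proof -
    have "X (gmul G q one) = tangent_map G (gmul G q) one (X one)"
      using assms unfolding left_invariant_field_def by blast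
    then show ?thesis by (simp add: left_field_def)
  qed
  then have X: "X = left_field G (X one)" by (rule ext)
  show ?thesis by (simp only: fr_def X[symmetric])
qed

end

lemma (in lie) invariant_randers_lie:
  assumes g: "riemannian_metric G g" and gl: "left_invariant_metric G g"
    and X: "smooth_field G X" and Xl: "left_invariant_field G X"
    and bound: "\<forall>a. sqrt (g a (X a) (X a)) < 1" and D: "douglas_type G (randers_metric g X)"
  shows "invariant_randers (im one) (local_metric G g one) (\<lambda>x. local_metric G g one x (local_field G X one x))
    (local_finsler G (randers_metric g X) one) x0 (X one) fr (bracket G)"
proof (intro invariant_randers.intro invariant_randers_axioms.intro)
  show "closed_randers (im one) (local_metric G g one) (\<lambda>x. local_metric G g one x (local_field G X one x))
    (local_finsler G (randers_metric g X) one)"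
    by (rule closed_randers_local[OF g X bound D])
  have h0: "local_metric G g one x0 u v = g one u v" for u v
    using local_metric_fr[OF gl x0_im, of u v] by (simp add: fr_x0)
  show "local_metric G g one x (fr u x) (fr v x) = local_metric G g one x0 u v" if "x \<in> im one" for x u v
    by (simp add: h0 local_metric_fr[OF gl that])
  show "local_metric G g one x (local_field G X one x) (fr v x) = local_metric G g one x0 (X one) v"
    if "x \<in> im one" for x v
    by (simp add: h0 left_invariant_field_eq[OF Xl] local_metric_fr[OF gl that])
qed (fact x0_im fr_smooth fr_linear fr_x0 bracket_fr)+

section \<open>Flags and the curvature formula at the identity\<close>

lemma plane_spanning_vector:
  fixes P :: "'e::euclidean_space set"
  assumes "is_flag P y"
  obtains u where "P = span {u, y}" "\<And>t. u \<noteq> t *\<^sub>R y"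
proof -
  have P: "subspace P" "dim P = 2" "y \<in> P" "y \<noteq> 0" using assms by (auto simp: is_flag_def)
  obtain B where B: "{y} \<subseteq> B" "B \<subseteq> P" "independent B" "P \<subseteq> span B"
    using maximal_independent_subset_extend[of "{y}" P] P by auto
  then have "card B = 2" using basis_card_eq_dim[of B P] P(2) by simp
  then obtain u where u: "B = {u, y}" "u \<noteq> y" using B(1) by (auto simp: card_2_iff)
  have "P = span {u, y}" using span_subspace[OF B(2,4) P(1)] u(1) by simp
  moreover have "u \<notin> span {y}" using B(3) u by (simp add: independent_insert)
  then have "u \<noteq> t *\<^sub>R y" for t by (auto simp: span_base span_scale)
  ultimately show ?thesis by (rule that)
qed

theorem theorem5p3:
  fixes G :: "('a::{t2_space,second_countable_topology}, 'e::euclidean_space) lie_group_data"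
    and g :: "'a \<Rightarrow> 'e \<Rightarrow> 'e \<Rightarrow> real" and X :: "'a \<Rightarrow> 'e" and F :: "'a \<Rightarrow> 'e \<Rightarrow> real"
    and p :: 'a and e X\<^sub>p :: 'e and \<Gamma> :: "'e set" and \<phi> :: "'e \<Rightarrow> real" and f :: "'e \<Rightarrow> 'e"
    and P :: "'e set" and y v :: 'e and \<eta> :: real
  assumes "in_G2 G"
    and "riemannian_metric G g" "left_invariant_metric G g"
    and "smooth_field G X" "left_invariant_field G X"
    and "\<forall>a. sqrt (g a (X a) (X a)) < 1"
    and "F = randers_metric g X" "douglas_type G F"
    and "p = gone G" "X\<^sub>p = X p"
    and "e \<in> derived_algebra G" "g p e e = 1"
    and "\<Gamma> = {z. g p z e = 0}"
    and "\<forall>z\<in>\<Gamma>. bracket G z e = \<phi> z *\<^sub>R e"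
    and "\<forall>z\<in>\<Gamma>. f z \<in> \<Gamma> \<and> (\<forall>y\<in>\<Gamma>. bracket G z y = g p (f z) y *\<^sub>R e)"
    and "is_flag P y" "y = \<eta> *\<^sub>R e + v" "v \<in> \<Gamma>"
  shows "flag_curvature G F p P y =
           g p y y / (F p y)^2 * sectional_curvature G g p P
           + 1 / (4 * (F p y)^4) *
             (3 * (\<eta>^2 * \<phi> X\<^sub>p + \<eta> * g p (f X\<^sub>p) v)^2
              + 2 * F p y * (2 * \<eta>^2 * \<phi> v * \<phi> X\<^sub>p + \<eta> * \<phi> v * g p (f X\<^sub>p) v
                             + \<eta>^2 * g p (f X\<^sub>p) (f v) - \<eta>^3 * \<phi> (f X\<^sub>p)))
       \<and> (y \<in> span {e} \<longrightarrow>
           flag_curvature G F p P y =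
             g p y y / (F p y)^2 * sectional_curvature G g p P
             + 1 / (4 * (F p y)^4) * (3 * \<eta>^4 * (\<phi> X\<^sub>p)^2 - 2 * F p y * \<eta>^3 * \<phi> (f X\<^sub>p)))
       \<and> (y \<in> \<Gamma> \<longrightarrow>
           flag_curvature G F p P y = g p y y / (F p y)^2 * sectional_curvature G g p P)"
proof -
  interpret lie G using assms(1) by unfold_locales (simp add: in_G2_def)
  let ?h = "local_metric G g p" and ?L = "local_finsler G F p"
  have I: "invariant_randers (im p) ?h (\<lambda>x. ?h x (local_field G X p x)) ?L (ch p p) X\<^sub>p fr (bracket G)"
    using invariant_randers_lie[OF assms(2-6)] assms(7-10) by simp
  interpret I: invariant_randers "im p" ?h "\<lambda>x. ?h x (local_field G X p x)" ?L "ch p p" X\<^sub>p fr "bracket G"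
    by (rule I)
  let ?x = "ch p p"
  let ?lhs = "flag_curvature G F p P y" and ?K = "g p y y / (F p y)^2 * sectional_curvature G g p P"
  have h0: "?h ?x u w = g p u w" for u w
    by (simp add: local_metric_def Let_def ci_ch in_dom transition_id)
  have L0: "?L ?x y = F p y"
    by (simp add: local_finsler_def Let_def ci_ch in_dom transition_id)
  have x: "?x \<in> im p" by (simp add: ch_im in_dom)
  have y: "y \<noteq> 0" using assms(16) by (simp add: is_flag_def)
  have lin: "linear (g p w)" "linear (\<lambda>z. g p z w)" for w
    using I.h_linear[OF x, of w] ext[of "?h ?x w" "g p w", OF h0] by (simp_all add: h0)
  \<comment> \<open>Douglas type enters here: it makes \<open>X\<^sub>p\<close> orthogonal to every
    bracket, hence to \<open>e\<close>, so that the assumptions on \<open>\<phi>\<close> and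
    \<open>f\<close> apply to \<open>X\<^sub>p\<close>.\<close>
  have "derived_algebra G \<subseteq> {z. g p X\<^sub>p z = 0}"
    unfolding derived_algebra_def
  proof (rule span_minimal)
    show "{bracket G u w |u w. True} \<subseteq> {z. g p X\<^sub>p z = 0}"
      using I.X0_orthogonal_br by (auto simp: h0)
    show "subspace {z. g p X\<^sub>p z = 0}" by (rule linear_subspace_kernel[OF lin(1)])
  qed
  then have X0: "X\<^sub>p \<in> \<Gamma>" using assms(11,13) by auto
  note lie_data = h0 assms(12-15) X0 assms(18,17)
  have r: "I.r ?x y = - (\<eta>^2 * \<phi> X\<^sub>p + \<eta> * g p (f X\<^sub>p) v)"
    using I.r_structure[of e \<Gamma> \<phi> f v y \<eta>] lie_data by simp
  have Sr: "I.Sr ?x y = - (2 * \<eta>^2 * \<phi> v * \<phi> X\<^sub>p + \<eta> * \<phi> v * g p (f X\<^sub>p) v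
                             + \<eta>^2 * g p (f X\<^sub>p) (f v) - \<eta>^3 * \<phi> (f X\<^sub>p))"
    using I.Sr_structure[of e \<Gamma> \<phi> f v y \<eta>] lie_data y by simp
  obtain u where u: "P = span {u, y}" "\<And>t. u \<noteq> t *\<^sub>R y"
    using plane_spanning_vector[OF assms(16)] by blast
  have gram: "I.gram ?x u y \<noteq> 0" using I.gram_pos[OF x y u(2)] by simp
  define K where "K = I.curv ?x u y / I.gram ?x u y"
  \<comment> \<open>The \<open>THE\<close> in \<open>sectional_curvature\<close> asks for one value
    common to all pairs spanning \<open>P\<close>. Existence is independence of the basis;
    uniqueness holds because \<open>u\<close> and \<open>y\<close> are such a pair.\<close>
  have K: "sectional_curvature G g p P = K"
    unfolding sectional_curvature_def Let_def
  proof (rule the_equality)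
    let ?k = "\<lambda>u v. ?h ?x (riemann_curvature ?h ?x u v v) u / (?h ?x v v * ?h ?x u u - (?h ?x v u)\<^sup>2)"
    show "\<forall>u' v'. P = span {u', v'} \<longrightarrow> K = ?k u' v'"
    proof (intro allI impI)
      fix u' v' assume "P = span {u', v'}"
      then have "span {u', v'} = span {u, y}" using u(1) by simp
      from I.curvature_quotient_basis_independent(1)[OF x this gram]
      show "K = ?k u' v'" by (simp add: K_def I.curv_def I.gram_def)
    qed
    fix k assume "\<forall>u v. P = span {u, v} \<longrightarrow> k = ?k u v"
    then show "k = K" using u(1) by (simp add: K_def I.curv_def I.gram_def)
  qed
  define Q where "Q = g p y y / (F p y)\<^sup>2 * K + (3 * (I.r ?x y)\<^sup>2 - 2 * F p y * I.Sr ?x y) / (4 * (F p y) ^ 4)"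
  let ?gy = "fund_tensor ?L ?x y"
  let ?q = "\<lambda>u. ?gy (flag_operator ?L ?x y u) u / (?gy y y * ?gy u u - (?gy y u)\<^sup>2)"
  \<comment> \<open>\<open>flag_curvature\<close> admits every \<open>u'\<close> that spans
    \<open>P\<close> together with \<open>y\<close>; the nonvanishing Gram determinant passes from
    \<open>u\<close> to \<open>u'\<close>.\<close>
  have quot: "?q u' = Q" if "P = span {u', y}" for u'
  proof -
    have s: "span {u', y} = span {u, y}" using that u(1) by simp
    show ?thesis
      using I.flag_quotient[OF x y I.curvature_quotient_basis_independent(2)[OF x s gram]]
        I.curvature_quotient_basis_independent(1)[OF x s gram]
      by (simp add: Q_def K_def h0 L0)
  qed
  have flag: "?lhs = Q"
    unfolding flag_curvature_def Let_def
  proof (rule the_equality)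
    show "\<forall>u. P = span {u, y} \<longrightarrow> Q = ?q u" using quot by simp
    fix k assume "\<forall>u. P = span {u, y} \<longrightarrow> k = ?q u"
    then have "k = ?q u" using u(1) by blast
    then show "k = Q" using quot[OF u(1)] by simp
  qed
  have main: "?lhs = ?K + 1 / (4 * (F p y)^4) *
             (3 * (\<eta>^2 * \<phi> X\<^sub>p + \<eta> * g p (f X\<^sub>p) v)^2
              + 2 * F p y * (2 * \<eta>^2 * \<phi> v * \<phi> X\<^sub>p + \<eta> * \<phi> v * g p (f X\<^sub>p) v
                             + \<eta>^2 * g p (f X\<^sub>p) (f v) - \<eta>^3 * \<phi> (f X\<^sub>p)))"
  proof -
    \<comment> \<open>The formulas for \<open>r\<close> and \<open>Sr\<close> both carry a minus
      sign: the square absorbs the first, and the second turns the subtracted term into an added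
      one.\<close>
    have "(3 * (- a)\<^sup>2 - 2 * c * - s) / d = 1 / d * (3 * a\<^sup>2 + 2 * c * s)" for a c s d :: real by simp
    then show ?thesis using flag by (simp only: Q_def K r Sr)
  qed
  have ve: "g p v e = 0" using assms(13,18) by simp
  have "v = 0" if axis: "y \<in> span {e}"
  proof -
    obtain c where "y = c *\<^sub>R e" using axis by (auto simp: span_singleton)
    then have v: "v = (c - \<eta>) *\<^sub>R e" using assms(17) by (simp add: algebra_simps)
    then have "c = \<eta>" using ve assms(12) by (simp add: linear_cmul[OF lin(2)])
    then show ?thesis using v by simp
  qed
  \<comment> \<open>\<open>\<phi>\<close> and \<open>f\<close> are given only through the brackets
    they describe, so their vanishing at 0 is read off from \<open>bracket G 0 z = 0\<close> and
    \<open>e \<noteq> 0\<close>.\<close>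
  moreover have "\<phi> 0 = 0" "g p w (f 0) = 0" if "0 \<in> \<Gamma>" "w \<in> \<Gamma>" for w
  proof -
    have e: "e \<noteq> 0" using assms(12) linear_0[OF lin(1)] by auto
    have "bracket G 0 z = 0" for z
      using I.br_antisym[of 0 z] linear_0[OF I.br_linear, of z] by simp
    then show "\<phi> 0 = 0" using assms(14) that(1) e by auto
    have "g p (f 0) w = 0" using assms(15) that \<open>\<And>z. bracket G 0 z = 0\<close> e by auto
    then show "g p w (f 0) = 0" using I.h_sym[OF x, of w "f 0"] by (simp add: h0)
  qed
  moreover have "f X\<^sub>p \<in> \<Gamma>" using assms(15) X0 by blast
  ultimately have "\<phi> v = 0 \<and> g p (f X\<^sub>p) v = 0 \<and> g p (f X\<^sub>p) (f v) = 0" if "y \<in> span {e}"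
    using that assms(18) linear_0[OF lin(1)] by auto
  then have axis: "?lhs = ?K + 1 / (4 * (F p y)^4) * (3 * \<eta>^4 * (\<phi> X\<^sub>p)^2 - 2 * F p y * \<eta>^3 * \<phi> (f X\<^sub>p))" if "y \<in> span {e}"
    using that main by (simp add: power_mult_distrib)
  \<comment> \<open>\<open>\<eta>\<close> is the scalar product of \<open>y\<close> with
    \<open>e\<close>, and every correction term contains it as a factor.\<close>
  have "\<eta> = 0" if "y \<in> \<Gamma>"
    using that assms(12,13,17) ve by (simp add: linear_add[OF lin(2)] linear_cmul[OF lin(2)])
  then have plane: "?lhs = ?K" if "y \<in> \<Gamma>"
    using that main by simp
  show ?thesis using main axis plane by blast
qed

end
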